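(* Let $M$ be a smooth, compact, connected, two-dimensional, orientable manifold without boundary, $g$ a smooth Riemannian metric on $M$, and $f$ a Morse-eigenfunction on $M$. Let $\mu$ denote the number of Neumann domains of $f$ and let $\nu$ denote the number of nodal domains of $f$. Then $2\mu\geq\nu$.
   Context: A Morse-eigenfunction is a real function $f$ on $M$ satisfying $-\Delta_g f=\lambda f$ for some $\lambda$ ($\Delta_g$ the Laplace-Beltrami operator) which is a Morse function (no degenerate critical points). Nodal domains of $f$ are the connected components of $M\setminus f^{-1}(0)$. Let $\varphi$ be the flow of $-\nabla f$ on $M$ ($\partial_t\varphi(t,x)=-\nabla f|_{\varphi(t,x)}$, $\varphi(0,x)=x$), and for a critical point $x$ put $W^s(x)=\{y:\lim_{t\to\infty}\varphi(t,y)=x\}$, $W^u(x)=\{y:\lim_{t\to-\infty}\varphi(t,y)=x\}$. A Neumann domain of $f$ is a connected component of $W^s(p)\cap W^u(q)$ for some (local) minimum $p$ and (local) maximum $q$ of $f$. *)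

theory Defs
  imports "HOL-Analysis.Analysis" "HOL-Library.Extended_Nat"
begin

subsection \<open>Smooth maps between open subsets of Euclidean spaces\<close>

definition partial_deriv ::
    "'n::finite \<Rightarrow> (real^'n \<Rightarrow> 'b::real_normed_vector) \<Rightarrow> real^'n \<Rightarrow> 'b" where
  "partial_deriv i h z = frechet_derivative h (at z) (axis i 1)"

text \<open>Continuous differentiability of order \<open>k\<close>; only meaningful for open \<open>S\<close>, since
  \<^const>\<open>partial_deriv\<close> refers to full neighbourhoods.\<close>

primrec Ck_on :: "nat \<Rightarrow> (real^'n::finite) set \<Rightarrow> (real^'n \<Rightarrow> 'b::real_normed_vector) \<Rightarrow> bool" where
  "Ck_on 0 S h \<longleftrightarrow> continuous_on S h"
| "Ck_on (Suc k) S h \<longleftrightarrow>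
     (\<forall>z\<in>S. h differentiable at z) \<and> (\<forall>i. Ck_on k S (partial_deriv i h))"

definition smooth_on :: "(real^'n::finite) set \<Rightarrow> (real^'n \<Rightarrow> 'b::real_normed_vector) \<Rightarrow> bool" where
  "smooth_on S h \<longleftrightarrow> (\<forall>k. Ck_on k S h)"


subsection \<open>Smooth manifolds given by an atlas\<close>

text \<open>A chart is a pair of its domain and its coordinate map; the values of the map outside the
  domain are irrelevant.\<close>

type_synonym ('a, 'n) chart = "'a set \<times> ('a \<Rightarrow> real^'n)"

abbreviation chart_dom :: "('a, 'n::finite) chart \<Rightarrow> 'a set" where
  "chart_dom c \<equiv> fst c"

abbreviation coord :: "('a, 'n::finite) chart \<Rightarrow> 'a \<Rightarrow> real^'n" where
  "coord c \<equiv> snd c"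

definition chart_inv :: "('a, 'n::finite) chart \<Rightarrow> real^'n \<Rightarrow> 'a" where
  "chart_inv c = inv_into (chart_dom c) (coord c)"

definition is_chart :: "'a::topological_space set \<Rightarrow> ('a, 'n::finite) chart \<Rightarrow> bool" where
  "is_chart M c \<longleftrightarrow>
     openin (top_of_set M) (chart_dom c) \<and> open (coord c ` chart_dom c) \<and>
     homeomorphism (chart_dom c) (coord c ` chart_dom c) (coord c) (chart_inv c)"

definition transition ::
    "('a, 'n::finite) chart \<Rightarrow> ('a, 'n) chart \<Rightarrow> real^'n \<Rightarrow> real^'n" where
  "transition c d = coord d \<circ> chart_inv c"

definition smooth_atlas ::
    "'a::topological_space set \<Rightarrow> ('a, 'n::finite) chart set \<Rightarrow> bool" where
  "smooth_atlas M A \<longleftrightarrow>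
     (\<forall>c\<in>A. is_chart M c) \<and> (\<Union>c\<in>A. chart_dom c) = M \<and>
     (\<forall>c\<in>A. \<forall>d\<in>A. smooth_on (coord c ` (chart_dom c \<inter> chart_dom d)) (transition c d))"

text \<open>A smooth manifold without boundary, of dimension \<open>CARD('n)\<close>. The Hausdorff condition is
  provided by the sort constraint. The atlas need not be maximal.\<close>

definition smooth_manifold :: "'a::t2_space set \<Rightarrow> ('a, 'n::finite) chart set \<Rightarrow> bool" where
  "smooth_manifold M A \<longleftrightarrow> second_countable (top_of_set M) \<and> smooth_atlas M A"

definition jacobian :: "(real^'n::finite \<Rightarrow> real^'n) \<Rightarrow> real^'n \<Rightarrow> real^'n^'n" where
  "jacobian h z = matrix (frechet_derivative h (at z))"

text \<open>Orientability: the smooth structure contains an atlas all of whose transition maps preserve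
  orientation.\<close>

definition orientable :: "'a::topological_space set \<Rightarrow> ('a, 'n::finite) chart set \<Rightarrow> bool" where
  "orientable M A \<longleftrightarrow>
     (\<exists>B :: ('a, 'n) chart set. smooth_atlas M B \<and> smooth_atlas M (A \<union> B) \<and>
        (\<forall>c\<in>B. \<forall>d\<in>B. \<forall>x \<in> chart_dom c \<inter> chart_dom d.
           det (jacobian (transition c d) (coord c x)) > 0))"

definition smooth_fun ::
    "('a, 'n::finite) chart set \<Rightarrow> ('a \<Rightarrow> 'b::real_normed_vector) \<Rightarrow> bool" where
  "smooth_fun A f \<longleftrightarrow> (\<forall>c\<in>A. smooth_on (coord c ` chart_dom c) (f \<circ> chart_inv c))"


subsection \<open>Riemannian metrics\<close>

text \<open>A metric is given by its components: \<open>g c x\<close> is the Gram matrix of the coordinate basis of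
  the chart \<open>c\<close> at the point \<open>x\<close>. The last clause is the transformation law of a covariant
  2-tensor, which makes these matrices represent one bilinear form on each tangent space.\<close>

type_synonym ('a, 'n) metric = "('a, 'n) chart \<Rightarrow> 'a \<Rightarrow> real^'n^'n"

definition riemannian_metric ::
    "('a, 'n::finite) chart set \<Rightarrow> ('a, 'n) metric \<Rightarrow> bool" where
  "riemannian_metric A g \<longleftrightarrow>
     (\<forall>c\<in>A. smooth_on (coord c ` chart_dom c) (g c \<circ> chart_inv c) \<and>
        (\<forall>x\<in>chart_dom c. transpose (g c x) = g c x \<and> (\<forall>v. v \<noteq> 0 \<longrightarrow> v \<bullet> (g c x *v v) > 0))) \<and>
     (\<forall>c\<in>A. \<forall>d\<in>A. \<forall>x \<in> chart_dom c \<inter> chart_dom d.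
        g c x = transpose (jacobian (transition c d) (coord c x)) ** g d x **
                jacobian (transition c d) (coord c x))"

text \<open>Components of the differential and of the Riemannian gradient in the chart \<open>c\<close>.\<close>

definition differential :: "('a, 'n::finite) chart \<Rightarrow> ('a \<Rightarrow> real) \<Rightarrow> 'a \<Rightarrow> real^'n" where
  "differential c f x = (\<chi> i. partial_deriv i (f \<circ> chart_inv c) (coord c x))"

definition gradient ::
    "('a, 'n::finite) metric \<Rightarrow> ('a, 'n) chart \<Rightarrow> ('a \<Rightarrow> real) \<Rightarrow> 'a \<Rightarrow> real^'n" where
  "gradient g c f x = matrix_inv (g c x) *v differential c f x"

text \<open>The Laplace-Beltrami operator, as the divergence of the gradient:
  \<open>|g|\<^sup>-\<^sup>1\<^sup>/\<^sup>2 \<Sum>\<^sub>i \<partial>\<^sub>i (|g|\<^sup>1\<^sup>/\<^sup>2 \<Sum>\<^sub>j g\<^sup>i\<^sup>j \<partial>\<^sub>j f)\<close>. For a smooth \<open>f\<close> the value does not depend on the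
  chart \<open>c\<close> around \<open>x\<close>.\<close>

definition laplace_beltrami ::
    "('a, 'n::finite) metric \<Rightarrow> ('a, 'n) chart \<Rightarrow> ('a \<Rightarrow> real) \<Rightarrow> 'a \<Rightarrow> real" where
  "laplace_beltrami g c f x =
     (\<Sum>i\<in>UNIV. partial_deriv i
        ((\<lambda>y. sqrt (det (g c y)) * gradient g c f y $ i) \<circ> chart_inv c) (coord c x))
     / sqrt (det (g c x))"


subsection \<open>Morse eigenfunctions\<close>

definition hessian :: "('a, 'n::finite) chart \<Rightarrow> ('a \<Rightarrow> real) \<Rightarrow> 'a \<Rightarrow> real^'n^'n" where
  "hessian c f x =
     (\<chi> i j. partial_deriv i (partial_deriv j (f \<circ> chart_inv c)) (coord c x))"

text \<open>Both the vanishing of the differential and, at a critical point, the nondegeneracy of the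
  Hessian are independent of the chart.\<close>

definition morse_function :: "('a, 'n::finite) chart set \<Rightarrow> ('a \<Rightarrow> real) \<Rightarrow> bool" where
  "morse_function A f \<longleftrightarrow> smooth_fun A f \<and>
     (\<forall>c\<in>A. \<forall>x\<in>chart_dom c. differential c f x = 0 \<longrightarrow> det (hessian c f x) \<noteq> 0)"

definition morse_eigenfunction ::
    "('a, 'n::finite) chart set \<Rightarrow> ('a, 'n) metric \<Rightarrow> ('a \<Rightarrow> real) \<Rightarrow> bool" where
  "morse_eigenfunction A g f \<longleftrightarrow> morse_function A f \<and>
     (\<exists>l::real. \<forall>c\<in>A. \<forall>x\<in>chart_dom c. - laplace_beltrami g c f x = l * f x)"


subsection \<open>The gradient flow, nodal domains and Neumann domains\<close>

definition is_neg_gradient_flow ::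
    "'a::topological_space set \<Rightarrow> ('a, 'n::finite) chart set \<Rightarrow> ('a, 'n) metric \<Rightarrow> ('a \<Rightarrow> real) \<Rightarrow>
     (real \<Rightarrow> 'a \<Rightarrow> 'a) \<Rightarrow> bool" where
  "is_neg_gradient_flow M A g f \<phi> \<longleftrightarrow>
     (\<forall>x\<in>M. \<phi> 0 x = x \<and> (\<forall>t. \<phi> t x \<in> M) \<and> continuous_on UNIV (\<lambda>t. \<phi> t x) \<and>
        (\<forall>t. \<forall>c\<in>A. \<phi> t x \<in> chart_dom c \<longrightarrow>
           ((\<lambda>s. coord c (\<phi> s x)) has_vector_derivative - gradient g c f (\<phi> t x)) (at t)))"

text \<open>For smooth \<open>f\<close> on a compact manifold the flow exists for all times and its values at points
  of \<open>M\<close> are uniquely determined; only the irrelevant values outside \<open>M\<close> are chosen arbitrarily.\<close>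

definition neg_gradient_flow ::
    "'a::topological_space set \<Rightarrow> ('a, 'n::finite) chart set \<Rightarrow> ('a, 'n) metric \<Rightarrow> ('a \<Rightarrow> real) \<Rightarrow>
     real \<Rightarrow> 'a \<Rightarrow> 'a" where
  "neg_gradient_flow M A g f = (SOME \<phi>. is_neg_gradient_flow M A g f \<phi>)"

definition stable_set ::
    "'a::topological_space set \<Rightarrow> ('a, 'n::finite) chart set \<Rightarrow> ('a, 'n) metric \<Rightarrow> ('a \<Rightarrow> real) \<Rightarrow>
     'a \<Rightarrow> 'a set" where
  "stable_set M A g f x = {y\<in>M. ((\<lambda>t. neg_gradient_flow M A g f t y) \<longlongrightarrow> x) at_top}"

definition unstable_set ::
    "'a::topological_space set \<Rightarrow> ('a, 'n::finite) chart set \<Rightarrow> ('a, 'n) metric \<Rightarrow> ('a \<Rightarrow> real) \<Rightarrow>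
     'a \<Rightarrow> 'a set" where
  "unstable_set M A g f x = {y\<in>M. ((\<lambda>t. neg_gradient_flow M A g f t y) \<longlongrightarrow> x) at_bot}"

definition local_minimum :: "'a::topological_space set \<Rightarrow> ('a \<Rightarrow> real) \<Rightarrow> 'a \<Rightarrow> bool" where
  "local_minimum M f p \<longleftrightarrow>
     (\<exists>U. openin (top_of_set M) U \<and> p \<in> U \<and> (\<forall>y\<in>U. f p \<le> f y))"

definition local_maximum :: "'a::topological_space set \<Rightarrow> ('a \<Rightarrow> real) \<Rightarrow> 'a \<Rightarrow> bool" where
  "local_maximum M f q \<longleftrightarrow>
     (\<exists>U. openin (top_of_set M) U \<and> q \<in> U \<and> (\<forall>y\<in>U. f y \<le> f q))"

definition nodal_domains :: "'a::topological_space set \<Rightarrow> ('a \<Rightarrow> real) \<Rightarrow> 'a set set" where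
  "nodal_domains M f = components (M - f -` {0})"

definition neumann_domains ::
    "'a::topological_space set \<Rightarrow> ('a, 'n::finite) chart set \<Rightarrow> ('a, 'n) metric \<Rightarrow> ('a \<Rightarrow> real) \<Rightarrow>
     'a set set" where
  "neumann_domains M A g f =
     (\<Union>p\<in>{p. local_minimum M f p}. \<Union>q\<in>{q. local_maximum M f q}.
        components (stable_set M A g f p \<inter> unstable_set M A g f q))"

text \<open>The number of elements of a set, as an element of \<open>{0, 1, 2, \<dots>, \<infinity>}\<close>.\<close>

definition ecard :: "'b set \<Rightarrow> enat" where
  "ecard S = (if finite S then enat (card S) else \<infinity>)"

end

theory Submission
  imports Defs
begin

text \<open>Every nodal domain \<open>D\<close> is a nonempty open set, and a generic orbit of the
  gradient flow runs from a local maximum \<open>q\<close> to a local minimum \<open>p\<close>: every orbit converges in both time directions to one of the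
  finitely many critical points, and by Baire's theorem the points converging forwards to a critical
  point other than a local minimum, or backwards to one other than a local maximum, form a meagre set.
  Meagreness needs no stable manifold theorem: where the Hessian \<open>H\<close> has a negative direction, the form
  \<open>- H \<delta> \<bullet> \<delta>\<close> of the difference \<open>\<delta>\<close> of two nearby orbits grows, so a set of points whose orbits stay close
  to the critical point has empty interior.

  If \<open>f\<close> is positive on \<open>D\<close>, then so it is on the backward orbit of \<open>y \<in> D\<close>, and hence \<open>q \<in> D\<close>; if it is
  negative, then \<open>p \<in> D\<close>. So \<open>D\<close> is determined by its sign together with the Neumann domain
  containing \<open>y\<close>, which determines \<open>p\<close> and \<open>q\<close>.\<close>

subsection \<open>Strong derivatives\<close>

text \<open>The difficulty in the meagreness argument is that it compares two orbits, neither of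
  which rests at the critical point. A derivative at that point only compares a point with the
  centre, so the estimates are phrased with strong derivatives, whose error is uniform over pairs of
  nearby points. Two orbits suffice, because an open set always contains two points that differ by a
  small multiple of a negative direction of the Hessian. The gradient involves an inverse matrix,
  which is never differentiated. In a chart the field \<open>X\<close> solves
  \<open>G X = - F\<close>, with \<open>G\<close> the metric and \<open>F\<close> the differential,
  and coercivity of \<open>G\<close> turns bounds on \<open>F\<close> and \<open>G\<close> into
  bounds on \<open>X\<close>: a Lipschitz bound, which yields the flow and its continuity, and near
  a critical point a sign for the growth of the quadratic form of the Hessian. Statements about
  backward limits and local maxima are the forward ones for \<open>- f\<close>, whose flow is the
  reversed flow. The factor 2 in the theorem is the number of signs that \<open>f\<close> can have
  on a nodal domain.\<close>

lemma eventually_ball_ball: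
  assumes "r > 0" "\<And>x y. x \<in> ball p r \<Longrightarrow> y \<in> ball p r \<Longrightarrow> P x y"
  shows "\<forall>\<^sub>F r in at_right 0. \<forall>x\<in>ball p r. \<forall>y\<in>ball p r. P x y"
  unfolding eventually_at_right_field using assms by (intro exI[of _ r]) auto

lemma eventually_ball_subset:
  assumes "open S" "p \<in> S"
  shows "\<forall>\<^sub>F r in at_right 0. ball p r \<subseteq> S"
proof -
  obtain r where "r > 0" "ball p r \<subseteq> S" using assms open_contains_ball by blast
  then show ?thesis unfolding eventually_at_right_field
    by (intro exI[of _ r]) (auto simp: subset_ball subset_iff)
qed

lemma eventually_at_right_0_ex:
  assumes "\<forall>\<^sub>F r in at_right (0::real). P r"
  shows "\<exists>r>0. P r"
proof -
  obtain b where "b > 0" "\<And>y. y > 0 \<Longrightarrow> y < b \<Longrightarrow> P y"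
    using assms unfolding eventually_at_right_field by auto
  then show ?thesis by (intro exI[of _ "b/2"]) auto
qed

text \<open>The error is uniform over all pairs \<open>x\<close>, \<open>y\<close> near
  \<open>p\<close>, whereas a Frechet derivative at \<open>p\<close> fixes one of them to be
  \<open>p\<close>. Stating it for all small radii lets several such conditions be combined by
  \<open>eventually_elim\<close>.\<close>

definition has_strong_derivative ::
    "('a::real_normed_vector \<Rightarrow> 'b::real_normed_vector) \<Rightarrow> ('a \<Rightarrow> 'b) \<Rightarrow> 'a \<Rightarrow> bool" where
  "has_strong_derivative h D p \<longleftrightarrow> bounded_linear D \<and>
     (\<forall>e>0. \<forall>\<^sub>F r in at_right 0. \<forall>x\<in>ball p r. \<forall>y\<in>ball p r.
        norm (h x - h y - D (x - y)) \<le> e * norm (x - y))"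

lemma has_derivative_partial:
  assumes "h differentiable (at z)"
  shows "(h has_derivative (\<lambda>v. \<Sum>i\<in>UNIV. v $ i *\<^sub>R partial_deriv i h z)) (at z)"
proof -
  have D: "(h has_derivative frechet_derivative h (at z)) (at z)"
    using assms frechet_derivative_works by blast
  have "frechet_derivative h (at z) v = (\<Sum>i\<in>UNIV. v $ i *\<^sub>R partial_deriv i h z)" for v
  proof -
    interpret linear "frechet_derivative h (at z)"
      using D has_derivative_linear by blast
    have "v = (\<Sum>i\<in>UNIV. v $ i *\<^sub>R axis i 1)"
      using basis_expansion[of v] by (simp add: scalar_mult_eq_scaleR)
    then have "frechet_derivative h (at z) v = frechet_derivative h (at z) (\<Sum>i\<in>UNIV. v $ i *\<^sub>R axis i 1)"
      by simp
    also have "\<dots> = (\<Sum>i\<in>UNIV. v $ i *\<^sub>R partial_deriv i h z)"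
      by (simp add: sum scale partial_deriv_def)
    finally show ?thesis .
  qed
  then show ?thesis using D by (metis (no_types, lifting) ext)
qed

text \<open>Mean value inequality on a ball for \<open>h - D p\<close>: its derivative
  \<open>D z - D p\<close> is small because the partial derivatives are continuous.\<close>

lemma C1_has_strong_derivative:
  fixes h :: "real^'n::finite \<Rightarrow> 'b::real_normed_vector"
  assumes "open S" "Ck_on (Suc 0) S h" "p \<in> S"
  shows "has_strong_derivative h (\<lambda>v. \<Sum>i\<in>UNIV. v $ i *\<^sub>R partial_deriv i h p) p"
proof -
  define D where "D z v = (\<Sum>i\<in>UNIV. v $ i *\<^sub>R partial_deriv i h z)" for z v
  have dif: "(h has_derivative D z) (at z)" if "z \<in> S" for z
    unfolding D_def using has_derivative_partial assms(2) that by auto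
  have bl: "bounded_linear (D z)" if "z \<in> S" for z
    using dif[OF that] has_derivative_bounded_linear by blast
  have "\<forall>\<^sub>F r in at_right 0. \<forall>x\<in>ball p r. \<forall>y\<in>ball p r.
        norm (h x - h y - D p (x - y)) \<le> e * norm (x - y)" if "e > 0" for e
  proof -
    let ?N = "real CARD('n)"
    \<comment> \<open>Each coordinate gets the share \<open>e / ?N\<close>, since
      \<open>D z - D p\<close> is a sum over \<open>?N\<close> coordinates, each bounded through
      \<open>component_le_norm_cart\<close>.\<close>
    have "\<forall>\<^sub>F z in nhds p. dist (partial_deriv i h z) (partial_deriv i h p) < e / ?N" for i
    proof -
      have "continuous_on S (partial_deriv i h)" using assms(2) by auto
      then have "isCont (partial_deriv i h) p" using assms(1,3) continuous_on_eq_continuous_at by blast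
      then have "(partial_deriv i h \<longlongrightarrow> partial_deriv i h p) (nhds p)"
        using isContD tendsto_at_iff_tendsto_nhds by blast
      then show ?thesis using tendstoD that by (metis divide_pos_pos of_nat_0_less_iff zero_less_card_finite)
    qed
    then have "\<forall>\<^sub>F z in nhds p. \<forall>i. dist (partial_deriv i h z) (partial_deriv i h p) < e / ?N"
      by (rule eventually_all_finite)
    moreover have "\<forall>\<^sub>F z in nhds p. z \<in> S" using assms(1,3) eventually_nhds by blast
    ultimately have "\<forall>\<^sub>F z in nhds p. z \<in> S \<and> (\<forall>i. dist (partial_deriv i h z) (partial_deriv i h p) < e / ?N)"
      by eventually_elim auto
    then obtain r where r0: "r > 0" "\<forall>z. dist z p < r \<longrightarrow>
        z \<in> S \<and> (\<forall>i. dist (partial_deriv i h z) (partial_deriv i h p) < e / ?N)"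
      unfolding eventually_nhds_metric by blast
    then have r: "r > 0" "\<And>z. z \<in> ball p r \<Longrightarrow> z \<in> S"
        "\<And>z i. z \<in> ball p r \<Longrightarrow> dist (partial_deriv i h z) (partial_deriv i h p) < e / ?N"
      by (simp_all add: dist_commute)
    have "norm ((h x - D p x) - (h y - D p y)) \<le> e * norm (x - y)" if "x \<in> ball p r" "y \<in> ball p r" for x y
    proof (rule differentiable_bound[OF convex_ball _ _ that, where f' = "\<lambda>z v. D z v - D p v"])
      fix z assume z: "z \<in> ball p r"
      show "((\<lambda>z. h z - D p z) has_derivative (\<lambda>v. D z v - D p v)) (at z within ball p r)"
        by (rule has_derivative_at_withinI, rule has_derivative_diff[OF dif[OF r(2)[OF z]]
            bounded_linear_imp_has_derivative[OF bl[OF assms(3)]]])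
      show "onorm (\<lambda>v. D z v - D p v) \<le> e"
      proof (rule onorm_le)
        fix v
        have "D z v - D p v = (\<Sum>i\<in>UNIV. v $ i *\<^sub>R (partial_deriv i h z - partial_deriv i h p))"
          by (simp add: D_def sum_subtractf scaleR_diff_right)
        also have "norm \<dots> \<le> (\<Sum>i\<in>(UNIV::'n set). norm v * (e / ?N))"
          by (rule order_trans[OF norm_sum sum_mono])
            (use r(3)[OF z] mult_mono[OF component_le_norm_cart less_imp_le] in \<open>force simp: dist_norm\<close>)
        also have "\<dots> = e * norm v" by simp
        finally show "norm (D z v - D p v) \<le> e * norm v" .
      qed
    qed
    moreover have "D p (x - y) = D p x - D p y" for x y
      using bl[OF assms(3)] by (simp add: linear_simps)
    moreover have "h x - h y - (D p x - D p y) = (h x - D p x) - (h y - D p y)" for x y by simp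
    ultimately have "norm (h x - h y - D p (x - y)) \<le> e * norm (x - y)"
      if "x \<in> ball p r" "y \<in> ball p r" for x y
      using that by metis
    then show ?thesis by (rule eventually_ball_ball[OF r(1)])
  qed
  then show ?thesis
    unfolding has_strong_derivative_def using bl[OF assms(3)] unfolding D_def by blast
qed

lemma has_strong_derivative_vec:
  fixes h :: "'a::real_normed_vector \<Rightarrow> real^'n::finite"
  assumes "\<And>i. has_strong_derivative (\<lambda>z. h z $ i) (\<lambda>v. D v $ i) p"
  shows "has_strong_derivative h D p"
  unfolding has_strong_derivative_def
proof (intro conjI allI impI)
  have "bounded_linear (\<lambda>v. D v \<bullet> b)" if "b \<in> Basis" for b
    using assms that unfolding has_strong_derivative_def by (auto simp: Basis_vec_def inner_axis)
  then show "bounded_linear D" by (rule bounded_linear_componentwise_iff[THEN iffD2, OF ballI])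
  fix e :: real assume e: "e > 0"
  let ?N = "real CARD('n)"
  have "\<forall>\<^sub>F r in at_right 0. \<forall>x\<in>ball p r. \<forall>y\<in>ball p r.
        norm (h x $ i - h y $ i - D (x - y) $ i) \<le> e / ?N * norm (x - y)" for i
    using assms[of i, unfolded has_strong_derivative_def, THEN conjunct2, rule_format,
        OF divide_pos_pos[OF e, of ?N]] by simp
  then have "\<forall>\<^sub>F r in at_right 0. \<forall>i. \<forall>x\<in>ball p r. \<forall>y\<in>ball p r.
        norm (h x $ i - h y $ i - D (x - y) $ i) \<le> e / ?N * norm (x - y)"
    by (intro eventually_all_finite)
  then show "\<forall>\<^sub>F r in at_right 0. \<forall>x\<in>ball p r. \<forall>y\<in>ball p r.
        norm (h x - h y - D (x - y)) \<le> e * norm (x - y)"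
  proof eventually_elim
    case (elim r)
    show ?case
    proof (intro ballI)
      fix x y assume xy: "x \<in> ball p r" "y \<in> ball p r"
      have "norm (h x - h y - D (x - y)) \<le> (\<Sum>i\<in>UNIV. norm ((h x - h y - D (x - y)) $ i))"
        using norm_le_l1_cart[of "h x - h y - D (x - y)"] by simp
      also have "\<dots> \<le> (\<Sum>i\<in>(UNIV::'n set). e / ?N * norm (x - y))"
        using elim xy by (intro sum_mono) simp
      finally show "norm (h x - h y - D (x - y)) \<le> e * norm (x - y)" by simp
    qed
  qed
qed

lemma has_strong_derivative_lipschitz:
  assumes "has_strong_derivative h D p"
  shows "\<exists>L>0. \<forall>\<^sub>F r in at_right 0. \<forall>x\<in>ball p r. \<forall>y\<in>ball p r. norm (h x - h y) \<le> L * norm (x - y)"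
proof -
  have "bounded_linear D" using assms unfolding has_strong_derivative_def by auto
  then obtain K where K: "K > 0" "\<And>v. norm (D v) \<le> norm v * K"
    using bounded_linear.pos_bounded by blast
  have "\<forall>\<^sub>F r in at_right 0. \<forall>x\<in>ball p r. \<forall>y\<in>ball p r. norm (h x - h y - D (x - y)) \<le> 1 * norm (x - y)"
    using assms zero_less_one unfolding has_strong_derivative_def by blast
  then have "\<forall>\<^sub>F r in at_right 0. \<forall>x\<in>ball p r. \<forall>y\<in>ball p r. norm (h x - h y) \<le> (K + 1) * norm (x - y)"
  proof eventually_elim
    case (elim r)
    have "norm (h x - h y) \<le> (K + 1) * norm (x - y)" if "x \<in> ball p r" "y \<in> ball p r" for x y
    proof -
      have "norm (h x - h y) \<le> norm (h x - h y - D (x - y)) + norm (D (x - y))"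
        by (metis add.commute add.right_neutral diff_add_cancel norm_triangle_ineq)
      moreover have "norm (h x - h y - D (x - y)) \<le> 1 * norm (x - y)" using elim that by blast
      ultimately show ?thesis using K(2)[of "x - y"] unfolding distrib_right by (simp add: mult.commute)
    qed
    then show ?case by auto
  qed
  then show ?thesis using K(1) by (intro exI[of _ "K + 1"]) auto
qed

text \<open>The second difference \<open>h (p + s u + s v) - h (p + s u) - h (p + s v) + h p\<close> is symmetric in
  \<open>u\<close> and \<open>v\<close>, and it is \<open>s\<^sup>2 (D u \<bullet> v) + o(s\<^sup>2)\<close>.\<close>

lemma strong_derivative_gradient_symmetric:
  fixes h :: "'a::euclidean_space \<Rightarrow> real"
  assumes "open S" "p \<in> S" and grad: "\<And>z. z \<in> S \<Longrightarrow> (h has_derivative (\<lambda>v. F z \<bullet> v)) (at z)"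
    and D: "has_strong_derivative F D p"
  shows "D u \<bullet> v = D v \<bullet> u"
proof -
  have bl: "bounded_linear D" using D unfolding has_strong_derivative_def by auto
  have est: "\<bar>D u \<bullet> v - D v \<bullet> u\<bar> \<le> 2 * e * norm u * norm v" if e: "e > 0" for e
  proof -
    have "\<forall>\<^sub>F r in at_right 0. ball p r \<subseteq> S \<and> (\<forall>x\<in>ball p r. \<forall>y\<in>ball p r.
        norm (F x - F y - D (x - y)) \<le> e * norm (x - y))"
      using D e eventually_ball_subset[OF assms(1,2)]
      unfolding has_strong_derivative_def by (auto intro: eventually_conj)
    then obtain r where r: "r > 0" "ball p r \<subseteq> S"
        "\<And>x y. x \<in> ball p r \<Longrightarrow> y \<in> ball p r \<Longrightarrow> norm (F x - F y - D (x - y)) \<le> e * norm (x - y)"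
      using eventually_at_right_0_ex by (metis (no_types, lifting))
    \<comment> \<open>Small enough that the parallelogram spanned by \<open>s *\<^sub>R u\<close>
      and \<open>s *\<^sub>R v\<close> at \<open>p\<close> lies in the ball; the 1 covers the case
      that \<open>u\<close> and \<open>v\<close> both vanish.\<close>
    define s where "s = r / (2 * (norm u + norm v + 1))"
    have s: "s > 0" unfolding s_def using r(1) by (auto intro!: divide_pos_pos add_nonneg_pos)
    have sr: "s * (norm u + norm v) < r"
    proof -
      have "s * (norm u + norm v) < s * (2 * (norm u + norm v + 1))"
        using s by (intro mult_strict_left_mono) (auto simp: add_nonneg_pos)
      also have "\<dots> = r" unfolding s_def
        by (metis add.commute add_nonneg_nonneg add_nonneg_pos less_numeral_extra(1) less_numeral_extra(3) mult_pos_pos nonzero_eq_divide_eq norm_ge_zero zero_less_numeral)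
      finally show ?thesis .
    qed
    have inb: "p + a *\<^sub>R w + t *\<^sub>R w' \<in> ball p r"
      if "0 \<le> a" "a \<le> s" "0 \<le> t" "t \<le> s" "norm w + norm w' = norm u + norm v" for a t w w'
    proof -
      have "norm (a *\<^sub>R w + t *\<^sub>R w') \<le> a * norm w + t * norm w'"
        using that norm_triangle_ineq[of "a *\<^sub>R w" "t *\<^sub>R w'"] by simp
      also have "\<dots> \<le> s * norm w + s * norm w'" using that by (intro add_mono mult_right_mono) auto
      also have "\<dots> < r" using sr that(5) by (simp flip: distrib_left)
      finally have "norm (a *\<^sub>R w + t *\<^sub>R w') < r" .
      moreover have "dist p (p + a *\<^sub>R w + t *\<^sub>R w') = norm (a *\<^sub>R w + t *\<^sub>R w')"
        by (metis add.assoc add_diff_cancel_left' dist_commute dist_norm)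
      ultimately show ?thesis by simp
    qed
    define \<Delta> where "\<Delta> = h (p + s *\<^sub>R u + s *\<^sub>R v) - h (p + s *\<^sub>R u) - h (p + s *\<^sub>R v) + h p"
    \<comment> \<open>Stated for any \<open>w\<close>, \<open>w'\<close> with this sum of norms, so
      that it applies to the pair \<open>u\<close>, \<open>v\<close> in both orders.\<close>
    have key: "\<bar>h (p + s *\<^sub>R w + s *\<^sub>R w') - h (p + s *\<^sub>R w) - h (p + s *\<^sub>R w') + h p - s * s * (D w \<bullet> w')\<bar>
         \<le> e * s * norm w * norm w' * s"
      if nw: "norm w + norm w' = norm u + norm v" for w w'
    proof -
      \<comment> \<open>The second difference as a function of the length of its second side, minus
        the expected growth. Its derivative compares \<open>F\<close> at two points differing by
        \<open>s *\<^sub>R w\<close>, neither of which need be \<open>p\<close>. The summand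
        \<open>0 *\<^sub>R w\<close> gives both points one shape, so that fact \<open>1\<close>
        serves for both.\<close>
      define k where "k t = h (p + s *\<^sub>R w + t *\<^sub>R w') - h (p + 0 *\<^sub>R w + t *\<^sub>R w') - t * (s * (D w \<bullet> w'))" for t
      have dk: "(k has_derivative (\<lambda>x. x * ((F (p + s *\<^sub>R w + t *\<^sub>R w') - F (p + 0 *\<^sub>R w + t *\<^sub>R w') - s *\<^sub>R D w) \<bullet> w')))
            (at t within {0..s})" if "t \<in> {0..s}" for t
      proof -
        have 1: "((\<lambda>t. h (p + a *\<^sub>R w + t *\<^sub>R w')) has_derivative (\<lambda>x. F (p + a *\<^sub>R w + t *\<^sub>R w') \<bullet> (x *\<^sub>R w')))
           (at t within {0..s})" if "a = 0 \<or> a = s" for a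
        proof (rule has_derivative_compose[where f = "\<lambda>t. p + a *\<^sub>R w + t *\<^sub>R w'" and g = h])
          show "((\<lambda>t. p + a *\<^sub>R w + t *\<^sub>R w') has_derivative (\<lambda>x. x *\<^sub>R w')) (at t within {0..s})"
            by (auto intro!: derivative_eq_intros)
          have "p + a *\<^sub>R w + t *\<^sub>R w' \<in> S"
            using inb[of a t w w'] nw r(2) that \<open>t \<in> {0..s}\<close> s by auto
          then show "(h has_derivative (\<bullet>) (F (p + a *\<^sub>R w + t *\<^sub>R w'))) (at (p + a *\<^sub>R w + t *\<^sub>R w'))"
            using grad by blast
        qed
        show ?thesis unfolding k_def
          by (rule has_derivative_eq_rhs[OF has_derivative_diff[OF has_derivative_diff[OF 1 1]
                has_derivative_mult_left[OF has_derivative_ident]]])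
             (auto simp: algebra_simps inner_diff_left inner_diff_right inner_add_left)
      qed
      have "norm (k s - k 0) \<le> e * s * norm w * norm w' * norm (s - 0)"
      proof (rule differentiable_bound[OF _ dk])
        fix t assume t: "t \<in> {0..s}"
        show "onorm (\<lambda>x. x * ((F (p + s *\<^sub>R w + t *\<^sub>R w') - F (p + 0 *\<^sub>R w + t *\<^sub>R w') - s *\<^sub>R D w) \<bullet> w'))
             \<le> e * s * norm w * norm w'"
        proof (rule onorm_le)
          fix x :: real
          let ?E = "F (p + s *\<^sub>R w + t *\<^sub>R w') - F (p + 0 *\<^sub>R w + t *\<^sub>R w') - s *\<^sub>R D w"
          have "norm ?E \<le> e * norm (s *\<^sub>R w)"
            using r(3)[OF inb[of s t w w'] inb[of 0 t w w']] nw t s bl by (simp add: linear_simps)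
          then have "\<bar>?E \<bullet> w'\<bar> \<le> e * s * norm w * norm w'"
            using s mult_right_mono[of "norm ?E" "e * norm (s *\<^sub>R w)" "norm w'"]
            by (intro order_trans[OF Cauchy_Schwarz_ineq2]) (simp add: mult.assoc)
          then show "norm (x * (?E \<bullet> w')) \<le> e * s * norm w * norm w' * norm x"
            by (simp add: abs_mult mult.commute mult_left_mono)
        qed
      qed (use s in auto)
      then show ?thesis using s unfolding k_def by (simp add: algebra_simps)
    qed
    have 1: "\<bar>\<Delta> - s * s * (D u \<bullet> v)\<bar> \<le> e * s * norm u * norm v * s"
      unfolding \<Delta>_def using key[of u v] by simp
    have 2: "\<bar>\<Delta> - s * s * (D v \<bullet> u)\<bar> \<le> e * s * norm u * norm v * s"
      unfolding \<Delta>_def using key[of v u] by (simp add: algebra_simps)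
    have "\<bar>s * s * (D u \<bullet> v) - s * s * (D v \<bullet> u)\<bar> \<le> 2 * (e * s * norm u * norm v * s)"
      using 1 2 by linarith
    moreover have "\<bar>s * s * (D u \<bullet> v) - s * s * (D v \<bullet> u)\<bar> = s * s * \<bar>D u \<bullet> v - D v \<bullet> u\<bar>"
      using s by (simp add: abs_mult flip: right_diff_distrib)
    ultimately have "s * s * \<bar>D u \<bullet> v - D v \<bullet> u\<bar> \<le> s * s * (2 * e * norm u * norm v)"
      by (simp add: mult_ac)
    then show ?thesis using s by simp
  qed
  have "\<bar>D u \<bullet> v - D v \<bullet> u\<bar> \<le> 0"
  proof (rule field_le_epsilon)
    fix e :: real assume e: "e > 0"
    define m where "m = 2 * norm u * norm v + 1"
    have "m > 0" unfolding m_def by (simp add: add_nonneg_pos)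
    have "\<bar>D u \<bullet> v - D v \<bullet> u\<bar> \<le> 2 * (e / m) * norm u * norm v"
      using est[of "e / m"] e \<open>m > 0\<close> by simp
    also have "\<dots> = (e / m) * (2 * norm u * norm v)" by (simp only: mult_ac)
    also have "\<dots> \<le> (e / m) * m" unfolding m_def using e
      by (intro mult_left_mono divide_nonneg_nonneg) auto
    also have "\<dots> = e" using \<open>m > 0\<close> by simp
    finally show "\<bar>D u \<bullet> v - D v \<bullet> u\<bar> \<le> 0 + e" by simp
  qed
  then show ?thesis by simp
qed

subsection \<open>Ordinary differential equations\<close>

text \<open>The squared norm stays differentiable where \<delta> vanishes. Weighted with
  \<open>exp (- 2 * L * t)\<close> it has a nonpositive derivative by Cauchy-Schwarz.\<close>

lemma gronwall_nonneg:
  fixes \<delta> :: "real \<Rightarrow> 'a::euclidean_space"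
  assumes der: "\<And>t. t \<in> {-e<..<e} \<Longrightarrow> (\<delta> has_vector_derivative \<delta>' t) (at t)"
    and le: "\<And>t. t \<in> {-e<..<e} \<Longrightarrow> norm (\<delta>' t) \<le> L * norm (\<delta> t)"
    and t: "0 \<le> t" "t < e"
  shows "norm (\<delta> t) \<le> exp (L * t) * norm (\<delta> 0)"
proof -
  define k where "k t = exp (- 2 * L * t) * (\<delta> t \<bullet> \<delta> t)" for t
  have "k 0 \<ge> k t"
  proof (rule DERIV_nonpos_imp_nonincreasing[OF t(1)])
    fix x assume x: "0 \<le> x" "x \<le> t"
    then have x': "x \<in> {-e<..<e}" using t by auto
    have "((\<lambda>t. \<delta> t \<bullet> \<delta> t) has_real_derivative 2 * (\<delta> x \<bullet> \<delta>' x)) (at x)"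
      using has_derivative_inner[OF der[OF x', unfolded has_vector_derivative_def] der[OF x', unfolded has_vector_derivative_def]]
      unfolding has_field_derivative_def
      by (rule has_derivative_eq_rhs) (auto simp: inner_commute algebra_simps)
    then have "(k has_real_derivative exp (- 2 * L * x) * (2 * (\<delta> x \<bullet> \<delta>' x) - 2 * L * (\<delta> x \<bullet> \<delta> x))) (at x)"
      unfolding k_def by (auto intro!: derivative_eq_intros simp: algebra_simps)
    moreover have "\<delta> x \<bullet> \<delta>' x \<le> L * (\<delta> x \<bullet> \<delta> x)"
    proof -
      have "\<delta> x \<bullet> \<delta>' x \<le> norm (\<delta> x) * norm (\<delta>' x)" by (rule norm_cauchy_schwarz)
      also have "\<dots> \<le> norm (\<delta> x) * (L * norm (\<delta> x))" using le[OF x'] by (intro mult_left_mono) auto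
      also have "\<dots> = L * (\<delta> x \<bullet> \<delta> x)" by (simp add: dot_square_norm power2_eq_square)
      finally show ?thesis .
    qed
    ultimately show "\<exists>y. DERIV k x :> y \<and> y \<le> 0" by (auto intro!: mult_nonneg_nonpos exI)
  qed
  then have "exp (- 2 * L * t) * (norm (\<delta> t))\<^sup>2 \<le> (norm (\<delta> 0))\<^sup>2"
    unfolding k_def by (simp add: dot_square_norm)
  then have "(exp (L * t))\<^sup>2 * (exp (- 2 * L * t) * (norm (\<delta> t))\<^sup>2) \<le> (exp (L * t))\<^sup>2 * (norm (\<delta> 0))\<^sup>2"
    by (intro mult_left_mono) auto
  moreover have "(exp (L * t))\<^sup>2 * exp (- 2 * L * t) = 1"
    by (simp add: power2_eq_square flip: exp_add)
  ultimately have "(norm (\<delta> t))\<^sup>2 \<le> (exp (L * t) * norm (\<delta> 0))\<^sup>2"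
    unfolding power_mult_distrib by (metis mult.assoc mult_1)
  then show ?thesis by (rule power2_le_imp_le) simp
qed

lemma gronwall:
  fixes \<delta> :: "real \<Rightarrow> 'a::euclidean_space"
  assumes der: "\<And>t. t \<in> {-e<..<e} \<Longrightarrow> (\<delta> has_vector_derivative \<delta>' t) (at t)"
    and le: "\<And>t. t \<in> {-e<..<e} \<Longrightarrow> norm (\<delta>' t) \<le> L * norm (\<delta> t)"
    and t: "t \<in> {-e<..<e}"
  shows "norm (\<delta> t) \<le> exp (L * \<bar>t\<bar>) * norm (\<delta> 0)"
proof (cases "t \<ge> 0")
  case True
  then show ?thesis using gronwall_nonneg[OF der le, where t = t] t by auto
next
  case False
  have "norm ((\<delta> \<circ> uminus) (- t)) \<le> exp (L * (- t)) * norm ((\<delta> \<circ> uminus) 0)"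
  proof (rule gronwall_nonneg[where e = e and \<delta>' = "\<lambda>t. - \<delta>' (- t)"])
    fix s assume s: "s \<in> {-e<..<e}"
    have "(\<delta> has_vector_derivative \<delta>' (- s)) (at (- s))" using der[of "- s"] s by auto
    moreover have "(uminus has_real_derivative - 1) (at s)" by (auto intro!: derivative_eq_intros)
    ultimately show "(\<delta> \<circ> uminus has_vector_derivative - \<delta>' (- s)) (at s)"
      using vector_diff_chain_at[of uminus "- 1" s \<delta> "\<delta>' (- s)"] has_real_derivative_iff_has_vector_derivative
      by auto
    show "norm (- \<delta>' (- s)) \<le> L * norm ((\<delta> \<circ> uminus) s)" using le[of "- s"] s by auto
  qed (use False t in auto)
  then show ?thesis using False by simp
qed

text \<open>Composing with the projection to the ball makes the vector field globally Lipschitz; the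
  solution does not leave the ball, so the modification is not felt.\<close>

lemma picard:
  fixes X :: "'a::euclidean_space \<Rightarrow> 'a"
  assumes lip: "\<And>x y. x \<in> cball z0 R \<Longrightarrow> y \<in> cball z0 R \<Longrightarrow> norm (X x - X y) \<le> L * norm (x - y)"
    and bd: "\<And>x. x \<in> cball z0 R \<Longrightarrow> norm (X x) \<le> K"
    and R: "R \<ge> 0" and L: "L \<ge> 0" and e: "e > 0" "L * e \<le> 1/4" and y: "dist z0 y + K * e \<le> R"
  shows "\<exists>z. z 0 = y \<and> (\<forall>t\<in>{-e<..<e}. z t \<in> cball z0 R \<and> (z has_vector_derivative X (z t)) (at t))"
proof -
  define B where "B = cball z0 R"
  have B: "convex B" "closed B" "B \<noteq> {}" unfolding B_def using R by auto
  have clip: "closest_point B x \<in> B" for x using B closest_point_in_set by blast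
  define X' where "X' x = X (closest_point B x)" for x
  have lip': "norm (X' x - X' y) \<le> L * norm (x - y)" for x y
  proof -
    have "norm (X' x - X' y) \<le> L * norm (closest_point B x - closest_point B y)"
      unfolding X'_def using clip lip B_def by blast
    also have "\<dots> \<le> L * norm (x - y)"
      using closest_point_lipschitz[OF B, of x y] L by (intro mult_left_mono) (auto simp: dist_norm)
    finally show ?thesis .
  qed
  have bd': "norm (X' x) \<le> K" for x unfolding X'_def using clip bd B_def by blast
  have K: "K \<ge> 0" using bd'[of y] norm_ge_zero order_trans by blast
  have contX': "continuous_on UNIV X'"
  proof (rule lipschitz_on_continuous_on[of L], rule lipschitz_onI)
    show "dist (X' x) (X' y) \<le> L * dist x y" for x y using lip' by (simp add: dist_norm)
  qed (rule L)
  \<comment> \<open>The fixed point is sought among bounded continuous functions on the whole line;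
    clamping the time makes the integral operator well defined there.\<close>
  define c where "c t = max (- e) (min e t)" for t
  have c: "c t \<in> {-e..e}" for t unfolding c_def using e(1) by auto
  have contc: "continuous_on UNIV c" unfolding c_def by (intro continuous_intros)
  \<comment> \<open>Integrals start at \<open>- e\<close>, and subtracting \<open>J u 0\<close> in
    \<open>T\<close> moves the base time to 0. This avoids integrals with reversed limits for
    negative times.\<close>
  define J where "J u t = integral {-e..t} (\<lambda>s. X' (apply_bcontfun u s))" for u :: "real \<Rightarrow>\<^sub>C 'a" and t
  have contg: "continuous_on S (\<lambda>s. X' (apply_bcontfun u s))" for u and S :: "real set"
    by (rule continuous_on_compose2[OF contX']) auto
  have derJ: "(J u has_vector_derivative X' (apply_bcontfun u t)) (at t within {-e..e})"
    if "t \<in> {-e..e}" for u t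
    unfolding J_def by (rule integral_has_vector_derivative[OF contg that])
  have contJ: "continuous_on {-e..e} (J u)" for u
    by (meson continuous_on_eq_continuous_within derJ has_vector_derivative_continuous)
  define T where "T u t = y + (J u (c t) - J u 0)" for u t
  have Tcont: "continuous_on UNIV (T u)" for u
    unfolding T_def using c by (intro continuous_intros continuous_on_compose2[OF contJ contc]) auto
  have derJ2: "norm (J u t - J u 0) \<le> K * \<bar>t\<bar>" if "t \<in> {-e..e}" for u t
  proof -
    have "norm (J u t - J u 0) \<le> K * norm (t - 0)"
    proof (rule differentiable_bound[of "{-e..e}"])
      fix s assume "s \<in> {-e..e}"
      then show "(J u has_derivative (\<lambda>x. x *\<^sub>R X' (apply_bcontfun u s))) (at s within {-e..e})"
        using derJ unfolding has_vector_derivative_def by blast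
      show "onorm (\<lambda>x. x *\<^sub>R X' (apply_bcontfun u s)) \<le> K"
        by (rule onorm_le) (use mult_right_mono[OF bd' abs_ge_zero] in \<open>simp add: mult.commute\<close>)
    qed (use that e in auto)
    then show ?thesis by simp
  qed
  have Tbd: "norm (T u t) \<le> norm y + K * e" for u t
  proof -
    have "norm (T u t) \<le> norm y + norm (J u (c t) - J u 0)" unfolding T_def by (rule norm_triangle_ineq)
    also have "\<dots> \<le> norm y + K * \<bar>c t\<bar>" using derJ2[OF c] by simp
    also have "\<dots> \<le> norm y + K * e" using c[of t] K by (intro add_left_mono mult_left_mono) auto
    finally show ?thesis .
  qed
  define TT where "TT u = Bcontfun (T u)" for u
  have TT: "apply_bcontfun (TT u) = T u" for u
    unfolding TT_def by (rule Bcontfun_inverse, rule bcontfun_normI[OF Tcont Tbd])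
  \<comment> \<open>The contraction factor is 1/2 + 1/4: \<open>J\<close> at a general time
    integrates over a length of at most \<open>2 * e\<close>, \<open>J\<close> at 0 over the length
    \<open>e\<close>, and \<open>L * e \<le> 1/4\<close>.\<close>
  have "\<exists>!u. TT u = u"
  proof (rule banach_fix_type[of "3/4"])
    show "\<forall>u v. dist (TT u) (TT v) \<le> 3 / 4 * dist u v"
    proof (intro allI, rule dist_bound)
      fix u v :: "real \<Rightarrow>\<^sub>C 'a" and t :: real
      have gd: "norm (X' (apply_bcontfun u s) - X' (apply_bcontfun v s)) \<le> L * dist u v" for s :: real
        using lip'[of "apply_bcontfun u s" "apply_bcontfun v s"]
          mult_left_mono[OF dist_bounded[of u s v] L] by (simp add: dist_norm)
      have J: "norm (J u t - J v t) \<le> 1/2 * dist u v" if "t \<in> {-e..e}" for t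
      proof -
        have "J u t - J v t = integral {-e..t} (\<lambda>s. X' (apply_bcontfun u s) - X' (apply_bcontfun v s))"
          unfolding J_def by (intro Henstock_Kurzweil_Integration.integral_diff[symmetric]
              integrable_continuous_real contg)
        also have "norm \<dots> \<le> (L * dist u v) * (t - (- e))"
        proof (rule integral_bound)
          show "norm (X' (apply_bcontfun u s) - X' (apply_bcontfun v s)) \<le> L * dist u v" for s
            by (rule gd)
        qed (use that contg in \<open>auto intro!: continuous_on_diff\<close>)
        also have "\<dots> \<le> (L * dist u v) * (2 * e)" using that L by (intro mult_left_mono) auto
        also have "\<dots> = (L * e) * (2 * dist u v)" by simp
        also have "\<dots> \<le> (1/4) * (2 * dist u v)" using e by (intro mult_right_mono) auto
        finally show ?thesis by simp
      qed
      have J0: "norm (J u 0 - J v 0) \<le> 1/4 * dist u v"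
      proof -
        have "J u 0 - J v 0 = integral {-e..0} (\<lambda>s. X' (apply_bcontfun u s) - X' (apply_bcontfun v s))"
          unfolding J_def by (intro Henstock_Kurzweil_Integration.integral_diff[symmetric]
              integrable_continuous_real contg)
        also have "norm \<dots> \<le> (L * dist u v) * (0 - (- e))"
        proof (rule integral_bound)
          show "norm (X' (apply_bcontfun u s) - X' (apply_bcontfun v s)) \<le> L * dist u v" for s
            by (rule gd)
        qed (use e contg in \<open>auto intro!: continuous_on_diff\<close>)
        also have "\<dots> = (L * e) * dist u v" by simp
        also have "\<dots> \<le> (1/4) * dist u v" using e by (intro mult_right_mono) auto
        finally show ?thesis by simp
      qed
      have "dist (T u t) (T v t) = norm ((J u (c t) - J v (c t)) - (J u 0 - J v 0))"
        unfolding T_def dist_norm by (simp add: algebra_simps)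
      also have "\<dots> \<le> 1/2 * dist u v + 1/4 * dist u v"
        using norm_triangle_ineq4 J[OF c] J0 by (meson add_mono order_trans)
      finally show "dist (apply_bcontfun (TT u) t) (apply_bcontfun (TT v) t) \<le> 3 / 4 * dist u v"
        unfolding TT by simp
    qed
  qed auto
  then obtain u where u: "TT u = u" by blast
  define z where "z = apply_bcontfun u"
  have zT: "z t = T u t" for t unfolding z_def using TT u by metis
  have zJ: "z t = y + (J u t - J u 0)" if "t \<in> {-e<..<e}" for t
    using that unfolding zT T_def c_def by auto
  show ?thesis
  proof (intro exI conjI ballI)
    show "z 0 = y" using zJ[of 0] e by simp
    fix t assume t: "t \<in> {-e<..<e}"
    have "dist y (z t) \<le> K * \<bar>t\<bar>" unfolding zJ[OF t] dist_norm using derJ2[of t u] t by (simp add: norm_minus_commute)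
    also have "\<dots> \<le> K * e" using t K by (intro mult_left_mono) auto
    finally have "dist z0 (z t) \<le> R" using y dist_triangle[of z0 "z t" y] by linarith
    then show zB: "z t \<in> cball z0 R" by simp
    have "(J u has_vector_derivative X' (z t)) (at t within {-e..e})" using derJ[of t u] t z_def by auto
    then have "(J u has_vector_derivative X' (z t)) (at t)" using t at_within_Icc_at[of "-e" t e] by auto
    then have "((\<lambda>t. y + (J u t - J u 0)) has_vector_derivative X' (z t)) (at t)"
      by (auto intro!: derivative_eq_intros)
    then have "(z has_vector_derivative X' (z t)) (at t)"
      by (rule has_vector_derivative_transform_within_open[OF _ open_greaterThanLessThan t]) (rule zJ[symmetric])
    moreover have "X' (z t) = X (z t)" unfolding X'_def using zB closest_point_self B_def by metis
    ultimately show "(z has_vector_derivative X (z t)) (at t)" by simp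
  qed
qed

subsection \<open>Solutions of a linear system depending on a point\<close>

text \<open>The norm of a matrix, as a vector of vectors, is the Frobenius norm, so Cauchy-Schwarz
  is applied row by row.\<close>

lemma norm_matrix_vector_mult_le:
  fixes A :: "real^'n::finite^'m::finite"
  shows "norm (A *v x) \<le> norm A * norm x"
proof -
  have "norm (A *v x) = L2_set (\<lambda>i. norm ((A $ i) \<bullet> x)) UNIV"
    by (simp add: norm_vec_def matrix_mult_dot)
  also have "\<dots> \<le> L2_set (\<lambda>i. norm (A $ i) * norm x) UNIV"
    by (rule L2_set_mono) (auto simp: Cauchy_Schwarz_ineq2)
  also have "\<dots> = norm A * norm x"
    by (simp add: norm_vec_def L2_set_left_distrib)
  finally show ?thesis .
qed

text \<open>The constant is the minimum of the quadratic form on the compact unit sphere;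
  homogeneity does the rest.\<close>

lemma positive_definite_lower_bound:
  fixes A :: "real^'n::finite^'n"
  assumes "\<And>v. v \<noteq> 0 \<Longrightarrow> v \<bullet> (A *v v) > 0"
  shows "\<exists>c>0. \<forall>v. c * (norm v)\<^sup>2 \<le> v \<bullet> (A *v v)"
proof -
  have cont: "continuous_on (sphere 0 1) (\<lambda>v. v \<bullet> (A *v v))"
    by (intro continuous_intros linear_continuous_on matrix_vector_mul_bounded_linear)
  have "axis undefined 1 \<in> sphere (0::real^'n) 1" by (simp add: norm_axis_1)
  then obtain u where u: "u \<in> sphere 0 1" "\<And>v. v \<in> sphere 0 1 \<Longrightarrow> u \<bullet> (A *v u) \<le> v \<bullet> (A *v v)"
    using continuous_attains_inf[OF compact_sphere _ cont] by blast
  have "u \<bullet> (A *v u) * (norm v)\<^sup>2 \<le> v \<bullet> (A *v v)" for v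
  proof (cases "v = 0")
    case False
    have "u \<bullet> (A *v u) \<le> (v /\<^sub>R norm v) \<bullet> (A *v (v /\<^sub>R norm v))" using False by (intro u) auto
    also have "\<dots> = v \<bullet> (A *v v) / (norm v)\<^sup>2"
      by (simp add: matrix_vector_mult_scaleR power2_eq_square divide_inverse)
    finally show ?thesis using False by (simp add: field_simps)
  qed simp
  moreover have "u \<bullet> (A *v u) > 0" using u(1) by (intro assms) auto
  ultimately show ?thesis by blast
qed

text \<open>With \<open>w\<close> the image of \<open>v\<close> under a coercive matrix, this bounds
  the solution of a linear system by its right-hand side and replaces a bound on the inverse
  matrix.\<close>

lemma norm_le_of_coercive:
  fixes v w :: "'a::real_inner"
  assumes "m * (norm v)\<^sup>2 \<le> v \<bullet> w" "norm w \<le> b" "m > 0"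
  shows "norm v \<le> b / m"
proof (cases "v = 0")
  case True
  then show ?thesis using assms norm_ge_zero[of w] by (simp add: order_trans[of 0 "norm w" b])
next
  case False
  have "norm v * (m * norm v) = m * (norm v)\<^sup>2" by (simp add: power2_eq_square)
  also have "\<dots> \<le> norm v * norm w" using assms(1) norm_cauchy_schwarz order_trans by blast
  also have "\<dots> \<le> norm v * b" using assms(2) by (simp add: mult_left_mono)
  finally have "m * norm v \<le> b" using False by simp
  then show ?thesis using assms(3) by (simp add: field_simps)
qed

lemma eventually_less_at_right_0:
  "b > 0 \<Longrightarrow> \<forall>\<^sub>F r in at_right 0. 0 < r \<and> r < (b::real)"
  unfolding eventually_at_right_field by (intro exI[of _ b]) auto

text \<open>Subtracting the systems at \<open>x\<close> and \<open>y\<close> gives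
  \<open>G x *v (X x - X y) = - (F x - F y) - (G x - G y) *v X y\<close>. The right-hand side is
  Lipschitz once \<open>X\<close> is bounded, and \<open>G x\<close> is coercive near
  \<open>p\<close>.\<close>

lemma linear_system_solution_lipschitz:
  fixes F X :: "real^'n::finite \<Rightarrow> real^'n" and G :: "real^'n \<Rightarrow> real^'n^'n"
  assumes F: "has_strong_derivative F DF p" and G: "has_strong_derivative G DG p"
    and pd: "\<And>v. v \<noteq> 0 \<Longrightarrow> v \<bullet> (G p *v v) > 0"
    and eq: "\<forall>\<^sub>F r in at_right 0. \<forall>z\<in>ball p r. G z *v X z = - F z"
  shows "\<exists>L>0. \<forall>\<^sub>F r in at_right 0. \<forall>x\<in>ball p r. \<forall>y\<in>ball p r. norm (X x - X y) \<le> L * norm (x - y)"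
proof -
  obtain c where c: "c > 0" "\<And>v. c * (norm v)\<^sup>2 \<le> v \<bullet> (G p *v v)"
    using positive_definite_lower_bound[OF pd] by blast
  obtain KF where KF: "KF > 0" "\<forall>\<^sub>F r in at_right 0. \<forall>x\<in>ball p r. \<forall>y\<in>ball p r. norm (F x - F y) \<le> KF * norm (x - y)"
    using has_strong_derivative_lipschitz[OF F] by blast
  obtain KG where KG: "KG > 0" "\<forall>\<^sub>F r in at_right 0. \<forall>x\<in>ball p r. \<forall>y\<in>ball p r. norm (G x - G y) \<le> KG * norm (x - y)"
    using has_strong_derivative_lipschitz[OF G] by blast
  \<comment> \<open>\<open>B\<close> will bound \<open>X\<close> on balls of radius below 1, where
    \<open>norm (F z) \<le> norm (F p) + KF\<close>; \<open>c/2\<close> is the coercivity of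
    \<open>G z\<close> that survives near \<open>p\<close>.\<close>
  define B where "B = (norm (F p) + KF) / (c/2)"
  have "B \<ge> 0" unfolding B_def using c(1) KF(1) by simp
  define L where "L = (KF + KG * B) / (c/2)"
  have "L > 0" unfolding L_def using \<open>B \<ge> 0\<close> KF(1) KG(1) c(1) by (simp add: add_pos_nonneg)
  \<comment> \<open>Below this radius \<open>G z\<close> differs from \<open>G p\<close> by at most
    \<open>c / 2\<close>, half of the coercivity constant of \<open>G p\<close>.\<close>
  have cK: "c / (2 * KG) > 0" using c KG by simp
  have "\<forall>\<^sub>F r in at_right 0. \<forall>x\<in>ball p r. \<forall>y\<in>ball p r. norm (X x - X y) \<le> L * norm (x - y)"
    using KF(2) KG(2) eq eventually_less_at_right_0[OF cK] eventually_less_at_right_0[OF zero_less_one]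
  proof eventually_elim
    case (elim r)
    have r: "0 < r" "r < 1" "KG * r \<le> c / 2" using elim c(1) KG(1) by (auto simp: field_simps)
    then have p: "p \<in> ball p r" by simp
    have coer: "c / 2 * (norm v)\<^sup>2 \<le> v \<bullet> (G z *v v)" if z: "z \<in> ball p r" for z v
    proof -
      have "norm (G z - G p) \<le> KG * norm (z - p)" using elim(2) z p by blast
      also have "\<dots> \<le> KG * r" using z KG(1) by (intro mult_left_mono) (auto simp: dist_norm norm_minus_commute)
      finally have "norm (G z - G p) \<le> c / 2" using r by linarith
      have "\<bar>v \<bullet> ((G z - G p) *v v)\<bar> \<le> norm v * norm ((G z - G p) *v v)" by (rule Cauchy_Schwarz_ineq2)
      also have "\<dots> \<le> norm v * (norm (G z - G p) * norm v)"
        by (intro mult_left_mono norm_matrix_vector_mult_le) auto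
      also have "\<dots> = norm (G z - G p) * (norm v)\<^sup>2" by (simp add: power2_eq_square)
      also have "\<dots> \<le> c / 2 * (norm v)\<^sup>2" using \<open>norm (G z - G p) \<le> c / 2\<close> by (intro mult_right_mono) auto
      finally have "\<bar>v \<bullet> ((G z - G p) *v v)\<bar> \<le> c / 2 * (norm v)\<^sup>2" .
      moreover have "v \<bullet> (G z *v v) = v \<bullet> (G p *v v) + v \<bullet> ((G z - G p) *v v)"
        by (simp add: matrix_vector_mult_diff_rdistrib inner_diff_right)
      ultimately show ?thesis using c(2)[of v] by (simp add: abs_le_iff)
    qed
    have XB: "norm (X z) \<le> B" if z: "z \<in> ball p r" for z
      unfolding B_def
    proof (rule norm_le_of_coercive[OF coer[OF z]])
      have "norm (F z) \<le> norm (F p) + norm (F z - F p)"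
        by (metis add.commute norm_triangle_sub)
      also have "norm (F z - F p) \<le> KF * norm (z - p)" using elim(1) z p by blast
      also have "\<dots> \<le> KF * 1" using z KF(1) r by (intro mult_left_mono) (auto simp: dist_norm norm_minus_commute)
      finally show "norm (G z *v X z) \<le> norm (F p) + KF" using elim(3) z by simp
    qed (use c in simp)
    show ?case
    proof (intro ballI)
      fix x y assume x: "x \<in> ball p r" and y: "y \<in> ball p r"
      have "norm (X x - X y) \<le> ((KF + KG * B) * norm (x - y)) / (c/2)"
      proof (rule norm_le_of_coercive[OF coer[OF x]])
        have "G x *v (X x - X y) = - (F x - F y) - (G x - G y) *v X y"
          using elim(3) x y by (simp add: matrix_vector_mult_diff_rdistrib matrix_vector_mult_diff_distrib)
        also have "norm \<dots> \<le> norm (F x - F y) + norm ((G x - G y) *v X y)"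
          by (metis norm_minus_cancel norm_triangle_ineq4)
        also have "\<dots> \<le> KF * norm (x - y) + (KG * norm (x - y)) * B"
        proof (rule add_mono)
          show "norm (F x - F y) \<le> KF * norm (x - y)" using elim(1) x y by blast
          have "norm ((G x - G y) *v X y) \<le> norm (G x - G y) * norm (X y)" by (rule norm_matrix_vector_mult_le)
          also have "\<dots> \<le> (KG * norm (x - y)) * B"
            using elim(2) x y XB[OF y] KG(1) by (intro mult_mono) auto
          finally show "norm ((G x - G y) *v X y) \<le> (KG * norm (x - y)) * B" .
        qed
        finally show "norm (G x *v (X x - X y)) \<le> (KF + KG * B) * norm (x - y)" by (simp add: algebra_simps)
      qed (use c in simp)
      then show "norm (X x - X y) \<le> L * norm (x - y)" unfolding L_def by (simp only: times_divide_eq_left)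
    qed
  qed
  then show ?thesis using \<open>L > 0\<close> by blast
qed

text \<open>To first order \<open>G p (X x - X y) = - DF (x - y)\<close>, so that \<open>DF (x - y) \<bullet> (X x - X y)\<close> is close to
  \<open>- (X x - X y) \<bullet> G p (X x - X y)\<close>.\<close>

lemma linear_system_solution_dissipative:
  fixes F X :: "real^'n::finite \<Rightarrow> real^'n" and G :: "real^'n \<Rightarrow> real^'n^'n"
  assumes F: "has_strong_derivative F DF p" and G: "has_strong_derivative G DG p"
    and pd: "\<And>v. v \<noteq> 0 \<Longrightarrow> v \<bullet> (G p *v v) > 0"
    and eq: "\<forall>\<^sub>F r in at_right 0. \<forall>z\<in>ball p r. G z *v X z = - F z"
    and "F p = 0" and m: "m > 0" "\<And>v. m * norm v \<le> norm (DF v)"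
  shows "\<exists>d>0. \<forall>\<^sub>F r in at_right 0. \<forall>x\<in>ball p r. \<forall>y\<in>ball p r.
           DF (x - y) \<bullet> (X x - X y) \<le> - d * (norm (x - y))\<^sup>2"
proof -
  obtain c where c: "c > 0" "\<And>v. c * (norm v)\<^sup>2 \<le> v \<bullet> (G p *v v)"
    using positive_definite_lower_bound[OF pd] by blast
  obtain KG where KG: "KG > 0" "\<forall>\<^sub>F r in at_right 0. \<forall>x\<in>ball p r. \<forall>y\<in>ball p r. norm (G x - G y) \<le> KG * norm (x - y)"
    using has_strong_derivative_lipschitz[OF G] by blast
  obtain L where L: "L > 0" "\<forall>\<^sub>F r in at_right 0. \<forall>x\<in>ball p r. \<forall>y\<in>ball p r. norm (X x - X y) \<le> L * norm (x - y)"
    using linear_system_solution_lipschitz[OF F G pd eq] by blast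
  define B where "B = norm (G p) + 1"
  have B: "B > 0" unfolding B_def by (simp add: add_nonneg_pos)
  \<comment> \<open>The bound \<open>m / 2\<close> makes \<open>norm (X x - X y)\<close> at least
    \<open>m / (2 * B)\<close> times \<open>norm (x - y)\<close>. The second bound then lets the
    error absorb at most half of the coercive term.\<close>
  define \<epsilon> where "\<epsilon> = min (m / 2) (c * m / (4 * B))"
  have \<epsilon>: "\<epsilon> > 0" "\<epsilon> \<le> m / 2" "\<epsilon> \<le> c * m / (4 * B)" unfolding \<epsilon>_def using c m B by auto
  \<comment> \<open>Below this radius the two terms containing differences of \<open>G\<close>
    contribute at most \<open>\<epsilon> / 2 * norm \<delta>\<close> together; the strong derivative
    of \<open>F\<close> contributes the other half.\<close>
  have \<epsilon>L: "\<epsilon> / (4 * KG * L) > 0" using \<epsilon> KG L by simp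
  have "\<forall>\<^sub>F r in at_right 0. \<forall>x\<in>ball p r. \<forall>y\<in>ball p r. norm (F x - F y - DF (x - y)) \<le> \<epsilon> / 2 * norm (x - y)"
    using F \<epsilon> unfolding has_strong_derivative_def by (meson half_gt_zero)
  then have "\<forall>\<^sub>F r in at_right 0. \<forall>x\<in>ball p r. \<forall>y\<in>ball p r.
           DF (x - y) \<bullet> (X x - X y) \<le> - (c / 2 * (m / (2 * B))\<^sup>2) * (norm (x - y))\<^sup>2"
    using KG(2) L(2) eq eventually_less_at_right_0[OF \<epsilon>L]
  proof eventually_elim
    case (elim r)
    have r: "0 < r" "2 * KG * L * r \<le> \<epsilon> / 2" using elim \<epsilon> L(1) KG(1) by (auto simp: field_simps)
    then have p: "p \<in> ball p r" by simp
    have "X p \<bullet> (G p *v X p) = 0" using elim p \<open>F p = 0\<close> by simp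
    then have Xp: "X p = 0" using pd[of "X p"] by fastforce
    show ?case
    proof (intro ballI)
      fix x y assume x: "x \<in> ball p r" and y: "y \<in> ball p r"
      define \<delta> where "\<delta> = x - y"
      define D where "D = X x - X y"
      \<comment> \<open>The deviation from the linearised system at \<open>p\<close>, in which
        \<open>G p *v D = - DF \<delta>\<close>.\<close>
      define err where "err = G p *v D + DF \<delta>"
      have near: "norm (z - p) \<le> r" if "z \<in> ball p r" for z
        using that by (auto simp: dist_norm norm_minus_commute)
      have "err = - (F x - F y - DF \<delta>) - (G x - G y) *v X y - (G x - G p) *v D"
        unfolding err_def D_def using elim(4) x y
        by (simp add: matrix_vector_mult_diff_rdistrib matrix_vector_mult_diff_distrib)
      also have "norm \<dots> \<le> norm (F x - F y - DF \<delta>) + norm ((G x - G y) *v X y) + norm ((G x - G p) *v D)"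
        by (smt (verit) norm_minus_cancel norm_triangle_ineq4)
      also have "\<dots> \<le> \<epsilon> / 2 * norm \<delta> + (KG * norm \<delta>) * (L * r) + (KG * r) * (L * norm \<delta>)"
      proof (intro add_mono)
        show "norm (F x - F y - DF \<delta>) \<le> \<epsilon> / 2 * norm \<delta>" unfolding \<delta>_def using elim x y by blast
        have "norm (X y) \<le> L * norm (y - p)" using elim(3) y p Xp by fastforce
        also have "\<dots> \<le> L * r" using near[OF y] L(1) by simp
        finally have "norm (X y) \<le> L * r" .
        moreover have "norm (G x - G y) \<le> KG * norm \<delta>" unfolding \<delta>_def using elim x y by blast
        ultimately show "norm ((G x - G y) *v X y) \<le> (KG * norm \<delta>) * (L * r)"
          using KG(1) by (intro order_trans[OF norm_matrix_vector_mult_le] mult_mono) auto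
        have "norm (G x - G p) \<le> KG * norm (x - p)" using elim(2) x p by blast
        also have "\<dots> \<le> KG * r" using near[OF x] KG(1) by simp
        finally have "norm (G x - G p) \<le> KG * r" .
        moreover have "norm D \<le> L * norm \<delta>" unfolding \<delta>_def D_def using elim x y by blast
        ultimately show "norm ((G x - G p) *v D) \<le> (KG * r) * (L * norm \<delta>)"
          using KG(1) r(1) by (intro order_trans[OF norm_matrix_vector_mult_le] mult_mono) auto
      qed
      also have "\<dots> = (\<epsilon> / 2 + 2 * KG * L * r) * norm \<delta>" by (simp add: algebra_simps)
      also have "\<dots> \<le> (\<epsilon> / 2 + \<epsilon> / 2) * norm \<delta>" using r by (intro mult_right_mono) auto
      finally have err: "norm err \<le> \<epsilon> * norm \<delta>" by simp
      \<comment> \<open>Nondegeneracy of \<open>DF\<close> enters here: a bound in terms of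
        \<open>norm D\<close> becomes one in terms of the distance of the two points.\<close>
      have lower: "m / (2 * B) * norm \<delta> \<le> norm D"
      proof -
        have "m * norm \<delta> \<le> norm (DF \<delta>)" by (rule m)
        also have "DF \<delta> = err - G p *v D" unfolding err_def by simp
        also have "norm \<dots> \<le> norm err + norm (G p *v D)" by (rule norm_triangle_ineq4)
        also have "norm (G p *v D) \<le> norm (G p) * norm D" by (rule norm_matrix_vector_mult_le)
        also have "\<dots> \<le> B * norm D" unfolding B_def by (intro mult_right_mono) auto
        finally have "m * norm \<delta> \<le> norm err + B * norm D" by simp
        moreover have "norm err \<le> m / 2 * norm \<delta>"
          using err \<epsilon>(2) by (meson mult_right_mono norm_ge_zero order_trans)
        ultimately have "m / 2 * norm \<delta> \<le> B * norm D" by simp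
        then show ?thesis using B by (simp add: field_simps)
      qed
      have "err \<bullet> D \<le> norm err * norm D" by (rule norm_cauchy_schwarz)
      also have "\<dots> \<le> (c / 2 * norm D) * norm D"
      proof (rule mult_right_mono)
        have "norm err \<le> c * m / (4 * B) * norm \<delta>"
          using err \<epsilon>(3) by (meson mult_right_mono norm_ge_zero order_trans)
        also have "\<dots> = c / 2 * (m / (2 * B) * norm \<delta>)" by simp
        also have "\<dots> \<le> c / 2 * norm D" using lower c(1) by (intro mult_left_mono) auto
        finally show "norm err \<le> c / 2 * norm D" .
      qed simp
      also have "\<dots> = c / 2 * (norm D)\<^sup>2" by (simp add: power2_eq_square)
      finally have "err \<bullet> D \<le> c / 2 * (norm D)\<^sup>2" .
      moreover have "DF \<delta> \<bullet> D = err \<bullet> D - D \<bullet> (G p *v D)"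
        unfolding err_def by (simp add: inner_add_right inner_add_left inner_commute)
      ultimately have "DF \<delta> \<bullet> D \<le> - (c / 2 * (norm D)\<^sup>2)" using c(2)[of D] by simp
      also have "\<dots> \<le> - (c / 2 * (m / (2 * B) * norm \<delta>)\<^sup>2)"
        using lower c(1) m(1) B by (intro le_imp_neg_le mult_left_mono power_mono) auto
      finally show "DF (x - y) \<bullet> (X x - X y) \<le> - (c / 2 * (m / (2 * B))\<^sup>2) * (norm (x - y))\<^sup>2"
        unfolding \<delta>_def[symmetric] D_def[symmetric] power_mult_distrib by (simp only: mult.assoc mult_minus_left)
    qed
  qed
  moreover have "c / 2 * (m / (2 * B))\<^sup>2 > 0" using c m B by simp
  ultimately show ?thesis by blast
qed

subsection \<open>The gradient field in charts\<close>

locale riemannian_morse =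
  fixes M :: "'a::t2_space set" and A :: "('a, 'n::finite) chart set"
    and g :: "('a, 'n) metric" and f :: "'a \<Rightarrow> real"
  assumes manifold: "smooth_manifold M A" and compact: "compact M"
    and metric: "riemannian_metric A g" and morse: "morse_function A f"
begin

definition chart_image :: "('a, 'n) chart \<Rightarrow> (real^'n) set" where
  "chart_image c = coord c ` chart_dom c"

definition local_grad :: "('a, 'n) chart \<Rightarrow> real^'n \<Rightarrow> real^'n" where
  "local_grad c z = (\<chi> i. partial_deriv i (f \<circ> chart_inv c) z)"

definition local_field :: "('a, 'n) chart \<Rightarrow> real^'n \<Rightarrow> real^'n" where
  "local_field c z = - gradient g c f (chart_inv c z)"

text \<open>The sum is the derivative of component \<open>j\<close> of \<open>local_grad\<close> in
  direction \<open>v\<close>; as a matrix this is the transpose of \<open>hessian\<close>. Symmetry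
  is derived afterwards.\<close>

definition local_hessian :: "('a, 'n) chart \<Rightarrow> real^'n \<Rightarrow> real^'n \<Rightarrow> real^'n" where
  "local_hessian c z v = (\<chi> j. \<Sum>i\<in>UNIV. v $ i * partial_deriv i (partial_deriv j (f \<circ> chart_inv c)) z)"

lemma chart: "c \<in> A \<Longrightarrow> is_chart M c"
  using manifold unfolding smooth_manifold_def smooth_atlas_def by blast

lemma chart_at: "x \<in> M \<Longrightarrow> \<exists>c\<in>A. x \<in> chart_dom c"
  using manifold unfolding smooth_manifold_def smooth_atlas_def by blast

lemma openin_chart_dom: "c \<in> A \<Longrightarrow> openin (top_of_set M) (chart_dom c)"
  using chart unfolding is_chart_def by blast

lemma chart_dom_subset: "c \<in> A \<Longrightarrow> chart_dom c \<subseteq> M"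
  using openin_chart_dom openin_imp_subset by blast

lemma open_chart_image: "c \<in> A \<Longrightarrow> open (chart_image c)"
  using chart unfolding is_chart_def chart_image_def by blast

lemma chart_homeo: "c \<in> A \<Longrightarrow> homeomorphism (chart_dom c) (chart_image c) (coord c) (chart_inv c)"
  using chart unfolding is_chart_def chart_image_def by blast

lemma chart_inv_coord [simp]: "c \<in> A \<Longrightarrow> x \<in> chart_dom c \<Longrightarrow> chart_inv c (coord c x) = x"
  using chart_homeo unfolding homeomorphism_def by blast

lemma coord_chart_inv [simp]: "c \<in> A \<Longrightarrow> z \<in> chart_image c \<Longrightarrow> coord c (chart_inv c z) = z"
  using chart_homeo unfolding homeomorphism_def by blast

lemma chart_inv_in_dom [simp]: "c \<in> A \<Longrightarrow> z \<in> chart_image c \<Longrightarrow> chart_inv c z \<in> chart_dom c"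
  using chart_homeo unfolding homeomorphism_def by blast

lemma coord_in_chart_image [simp]: "x \<in> chart_dom c \<Longrightarrow> coord c x \<in> chart_image c"
  unfolding chart_image_def by blast

lemma continuous_on_coord: "c \<in> A \<Longrightarrow> continuous_on (chart_dom c) (coord c)"
  using chart_homeo unfolding homeomorphism_def by blast

lemma continuous_on_chart_inv: "c \<in> A \<Longrightarrow> continuous_on (chart_image c) (chart_inv c)"
  using chart_homeo unfolding homeomorphism_def by blast

lemma openin_chart_preimage:
  assumes "c \<in> A" "open U"
  shows "openin (top_of_set M) {x \<in> chart_dom c. coord c x \<in> U}"
proof -
  have "openin (top_of_set (chart_dom c)) (chart_dom c \<inter> coord c -` U)"
    using continuous_on_coord assms continuous_openin_preimage_gen by blast
  then have "openin (top_of_set M) (chart_dom c \<inter> coord c -` U)"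
    using openin_chart_dom assms openin_trans by blast
  moreover have "chart_dom c \<inter> coord c -` U = {x \<in> chart_dom c. coord c x \<in> U}" by blast
  ultimately show ?thesis by simp
qed

lemma open_coord_image:
  assumes "c \<in> A" "openin (top_of_set M) V" "V \<subseteq> chart_dom c"
  shows "open (coord c ` V)"
proof -
  have "openin (top_of_set (chart_dom c)) V"
    by (rule openin_subset_trans[OF assms(2,3) chart_dom_subset[OF assms(1)]])
  then have "openin (top_of_set (chart_image c)) (coord c ` V)"
    by (rule homeomorphism_imp_open_map[OF chart_homeo[OF assms(1)]])
  then show ?thesis using open_chart_image[OF assms(1)] openin_open_eq by blast
qed

lemma smooth_local: "c \<in> A \<Longrightarrow> Ck_on k (chart_image c) (f \<circ> chart_inv c)"
  using morse unfolding morse_function_def smooth_fun_def smooth_on_def chart_image_def by blast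

lemma has_derivative_local:
  assumes "c \<in> A" "z \<in> chart_image c"
  shows "((f \<circ> chart_inv c) has_derivative (\<lambda>v. local_grad c z \<bullet> v)) (at z)"
proof -
  have "(f \<circ> chart_inv c) differentiable (at z)"
    using smooth_local[OF assms(1), of "Suc 0"] assms(2) by simp
  from has_derivative_partial[OF this] show ?thesis
    by (rule has_derivative_eq_rhs) (auto simp: local_grad_def inner_vec_def mult.commute)
qed

lemma strong_derivative_local_grad:
  assumes "c \<in> A" "z \<in> chart_image c"
  shows "has_strong_derivative (local_grad c) (local_hessian c z) z"
proof (rule has_strong_derivative_vec)
  fix j
  have "Ck_on (Suc 0) (chart_image c) (partial_deriv j (f \<circ> chart_inv c))"
    using smooth_local[OF assms(1), of "Suc (Suc 0)"] by simp
  from C1_has_strong_derivative[OF open_chart_image[OF assms(1)] this assms(2)]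
  show "has_strong_derivative (\<lambda>z. local_grad c z $ j) (\<lambda>v. local_hessian c z v $ j) z"
    by (simp add: local_grad_def local_hessian_def)
qed

lemma local_hessian_symmetric:
  assumes "c \<in> A" "z \<in> chart_image c"
  shows "local_hessian c z u \<bullet> v = local_hessian c z v \<bullet> u"
  using strong_derivative_gradient_symmetric[OF open_chart_image[OF assms(1)] assms(2)
      has_derivative_local[OF assms(1)] strong_derivative_local_grad[OF assms]] .

lemma metric_pos: "c \<in> A \<Longrightarrow> x \<in> chart_dom c \<Longrightarrow> v \<noteq> 0 \<Longrightarrow> v \<bullet> (g c x *v v) > 0"
  using metric unfolding riemannian_metric_def by blast

text \<open>\<open>matrix_inv\<close> is a choice among two-sided inverses. Positive definiteness
  makes the kernel trivial, so there is one to choose.\<close>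

lemma metric_invertible:
  assumes "c \<in> A" "x \<in> chart_dom c"
  shows "g c x ** matrix_inv (g c x) = mat 1"
proof -
  have "v = 0" if "g c x *v v = 0" for v
    using metric_pos[OF assms, of v] that by fastforce
  then obtain B where "B ** g c x = mat 1" using matrix_left_invertible_ker by blast
  moreover from this have "g c x ** B = mat 1" using matrix_left_right_inverse by blast
  ultimately show ?thesis
    unfolding matrix_inv_def using someI[of "\<lambda>A'. g c x ** A' = mat 1 \<and> A' ** g c x = mat 1" B] by blast
qed

lemma metric_gradient:
  assumes "c \<in> A" "x \<in> chart_dom c"
  shows "g c x *v gradient g c f x = differential c f x"
  unfolding gradient_def matrix_vector_mul_assoc metric_invertible[OF assms] by simp

lemma differential_local: "differential c f x = local_grad c (coord c x)"
  unfolding differential_def local_grad_def ..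

text \<open>This is the system \<open>G X = - F\<close> of the preceding part, with the metric as
  \<open>G\<close> and the coordinate gradient as \<open>F\<close>.\<close>

lemma metric_local_field:
  assumes "c \<in> A" "z \<in> chart_image c"
  shows "g c (chart_inv c z) *v local_field c z = - local_grad c z"
proof -
  have "g c (chart_inv c z) *v local_field c z = - (g c (chart_inv c z) *v gradient g c f (chart_inv c z))"
    unfolding local_field_def by (rule linear_neg[OF matrix_vector_mul_linear])
  then show ?thesis using metric_gradient[of c "chart_inv c z"] assms by (simp add: differential_local)
qed

lemma strong_derivative_metric:
  assumes "c \<in> A" "z \<in> chart_image c"
  shows "\<exists>D. has_strong_derivative (\<lambda>z. g c (chart_inv c z)) D z"
proof -
  have "smooth_on (chart_image c) (g c \<circ> chart_inv c)"
    using metric assms(1) unfolding riemannian_metric_def chart_image_def by blast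
  then have "Ck_on (Suc 0) (chart_image c) (g c \<circ> chart_inv c)" unfolding smooth_on_def by blast
  from C1_has_strong_derivative[OF open_chart_image[OF assms(1)] this assms(2)] show ?thesis
    unfolding comp_def by blast
qed

lemma eventually_metric_local_field:
  assumes "c \<in> A" "p \<in> chart_image c"
  shows "\<forall>\<^sub>F r in at_right 0. \<forall>z\<in>ball p r. g c (chart_inv c z) *v local_field c z = - local_grad c z"
  using eventually_ball_subset[OF open_chart_image[OF assms(1)] assms(2)]
  by eventually_elim (use metric_local_field assms in blast)

lemma local_field_lipschitz:
  assumes "c \<in> A" "p \<in> chart_image c"
  shows "\<exists>L>0. \<forall>\<^sub>F r in at_right 0. \<forall>x\<in>ball p r. \<forall>y\<in>ball p r.
    norm (local_field c x - local_field c y) \<le> L * norm (x - y)"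
proof -
  obtain D where "has_strong_derivative (\<lambda>z. g c (chart_inv c z)) D p"
    using strong_derivative_metric[OF assms] by blast
  from linear_system_solution_lipschitz[OF strong_derivative_local_grad[OF assms] this
      _ eventually_metric_local_field[OF assms]]
  show ?thesis using metric_pos assms by simp
qed

text \<open>The Morse condition in quantitative form: an injective linear map in finite dimension is
  bounded below.\<close>

lemma local_hessian_bounded_below:
  assumes "c \<in> A" "p \<in> chart_image c" "local_grad c p = 0"
  shows "\<exists>m>0. \<forall>v. m * norm v \<le> norm (local_hessian c p v)"
proof -
  let ?H = "hessian c f (chart_inv c p)"
  have "differential c f (chart_inv c p) = 0" using assms by (simp add: differential_local)
  then have "det ?H \<noteq> 0"
    using morse assms unfolding morse_function_def by (meson chart_inv_in_dom)
  then have "det (transpose ?H) \<noteq> 0" by simp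
  then have "inj ((*v) (transpose ?H))"
    using invertible_det_nz invertible_eq_bij bij_is_inj by blast
  moreover have "local_hessian c p = (*v) (transpose ?H)"
    using assms by (auto simp: fun_eq_iff local_hessian_def hessian_def transpose_def
        matrix_vector_mult_def mult.commute)
  ultimately show ?thesis
    using linear_inj_bounded_below_pos[OF matrix_vector_mul_linear] by metis
qed

text \<open>With \<open>H\<close> the Hessian at \<open>p\<close> and \<delta> the difference of two
  orbits, the left-hand side is half of the derivative of
  \<open>H \<delta> \<bullet> \<delta>\<close>, as \<open>H\<close> is symmetric. So this form
  decreases near \<open>p\<close>, whatever the index of \<open>p\<close>.\<close>

lemma local_field_dissipative:
  assumes "c \<in> A" "p \<in> chart_image c" "local_grad c p = 0"
  shows "\<exists>d>0. \<forall>\<^sub>F r in at_right 0. \<forall>x\<in>ball p r. \<forall>y\<in>ball p r.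
    local_hessian c p (x - y) \<bullet> (local_field c x - local_field c y) \<le> - d * (norm (x - y))\<^sup>2"
proof -
  obtain D where D: "has_strong_derivative (\<lambda>z. g c (chart_inv c z)) D p"
    using strong_derivative_metric[OF assms(1,2)] by blast
  obtain m where m: "m > 0" "\<And>v. m * norm v \<le> norm (local_hessian c p v)"
    using local_hessian_bounded_below[OF assms] by blast
  from linear_system_solution_dissipative[OF strong_derivative_local_grad[OF assms(1,2)] D
      _ eventually_metric_local_field[OF assms(1,2)] assms(3) m]
  show ?thesis using metric_pos assms by simp
qed

end

subsection \<open>Integral curves\<close>

context riemannian_morse
begin

section \<open>Behaviour of the differential and the gradient under a change of charts\<close>

lemma open_overlap:
  assumes "c \<in> A" "d \<in> A"
  shows "open (coord c ` (chart_dom c \<inter> chart_dom d))"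
  by (rule open_coord_image) (auto intro: openin_Int openin_chart_dom assms)

lemma transition_has_derivative:
  assumes "c \<in> A" "d \<in> A" "x \<in> chart_dom c" "x \<in> chart_dom d"
  shows "(transition c d has_derivative (*v) (jacobian (transition c d) (coord c x))) (at (coord c x))"
proof -
  have "smooth_on (coord c ` (chart_dom c \<inter> chart_dom d)) (transition c d)"
    using manifold assms(1,2) unfolding smooth_manifold_def smooth_atlas_def by blast
  then have "Ck_on (Suc 0) (coord c ` (chart_dom c \<inter> chart_dom d)) (transition c d)"
    unfolding smooth_on_def by blast
  then have "transition c d differentiable (at (coord c x))" using assms(3,4) by simp
  then show ?thesis
    unfolding jacobian_def using jacobian_works Cartesian_Euclidean_Space.jacobian_def by metis
qed

lemma transition_coord:
  "c \<in> A \<Longrightarrow> x \<in> chart_dom c \<Longrightarrow> transition c d (coord c x) = coord d x"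
  unfolding transition_def by simp

lemma differential_transform:
  assumes "c \<in> A" "d \<in> A" "x \<in> chart_dom c" "x \<in> chart_dom d"
  shows "transpose (jacobian (transition c d) (coord c x)) *v differential d f x = differential c f x"
proof -
  let ?J = "jacobian (transition c d) (coord c x)"
  have "((f \<circ> chart_inv d) has_derivative (\<lambda>v. differential d f x \<bullet> v)) (at (transition c d (coord c x)))"
    using has_derivative_local[OF assms(2), of "coord d x"] assms by (simp add: transition_coord differential_local)
  from has_derivative_compose[OF transition_has_derivative[OF assms] this]
  have 1: "((\<lambda>z. (f \<circ> chart_inv d) (transition c d z)) has_derivative (\<lambda>v. differential d f x \<bullet> (?J *v v))) (at (coord c x))" .
  have "((f \<circ> chart_inv c) has_derivative (\<lambda>v. differential d f x \<bullet> (?J *v v))) (at (coord c x))"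
  proof (rule has_derivative_transform_within_open[OF 1 open_overlap[OF assms(1,2)]])
    show "coord c x \<in> coord c ` (chart_dom c \<inter> chart_dom d)" using assms by blast
    show "(f \<circ> chart_inv d) (transition c d z) = (f \<circ> chart_inv c) z"
      if "z \<in> coord c ` (chart_dom c \<inter> chart_dom d)" for z
      using that assms(1,2) by (auto simp: transition_coord)
  qed
  moreover have "((f \<circ> chart_inv c) has_derivative (\<lambda>v. differential c f x \<bullet> v)) (at (coord c x))"
    using has_derivative_local[OF assms(1), of "coord c x"] assms by (simp add: differential_local)
  ultimately have "(\<lambda>v. differential d f x \<bullet> (?J *v v)) = (\<lambda>v. differential c f x \<bullet> v)"
    by (rule has_derivative_unique)
  then have "(transpose ?J *v differential d f x) \<bullet> v = differential c f x \<bullet> v" for v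
    by (simp add: dot_lmul_matrix fun_eq_iff)
  then show ?thesis using vector_eq_rdot by blast
qed

text \<open>Applying \<open>transpose ?J ** g d x\<close> to both sides yields the differential in
  chart \<open>c\<close>, by the tensor law of the metric and the chain rule. It can be cancelled:
  \<open>transpose ?J\<close> is invertible since \<open>?J\<close> has trivial kernel, and
  \<open>g d x\<close> is positive definite.\<close>

lemma gradient_transform:
  assumes "c \<in> A" "d \<in> A" "x \<in> chart_dom c" "x \<in> chart_dom d"
  shows "jacobian (transition c d) (coord c x) *v gradient g c f x = gradient g d f x"
proof -
  let ?J = "jacobian (transition c d) (coord c x)"
  have gc: "g c x = transpose ?J ** g d x ** ?J"
    using metric assms unfolding riemannian_metric_def by blast
  have "v = 0" if "?J *v v = 0" for v
  proof -
    have "v \<bullet> (g c x *v v) = 0"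
      unfolding gc using that by (simp flip: matrix_vector_mul_assoc)
    then show ?thesis using metric_pos[OF assms(1,3), of v] by fastforce
  qed
  then obtain B where "B ** ?J = mat 1" using matrix_left_invertible_ker by blast
  then have "transpose ?J ** transpose B = mat 1" by (metis matrix_transpose_mul transpose_mat)
  then have "transpose B ** transpose ?J = mat 1" using matrix_left_right_inverse by blast
  then have inj: "u = v" if "transpose ?J *v u = transpose ?J *v v" for u v
    using that by (metis matrix_vector_mul_assoc matrix_vector_mul_lid)
  have "transpose ?J *v (g d x *v (?J *v gradient g c f x)) = g c x *v gradient g c f x"
    unfolding gc matrix_vector_mul_assoc by (simp only: matrix_mul_assoc)
  also have "\<dots> = transpose ?J *v (g d x *v gradient g d f x)"
    unfolding metric_gradient[OF assms(1,3)] metric_gradient[OF assms(2,4)]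
    by (rule differential_transform[OF assms, symmetric])
  finally have "g d x *v (?J *v gradient g c f x) = g d x *v gradient g d f x" by (rule inj)
  then have "g d x *v (?J *v gradient g c f x - gradient g d f x) = 0"
    by (simp add: matrix_vector_mult_diff_distrib)
  then have "?J *v gradient g c f x - gradient g d f x = 0"
    using metric_pos[OF assms(2,4), of "?J *v gradient g c f x - gradient g d f x"] by fastforce
  then show ?thesis by simp
qed

text \<open>Continuity is demanded separately because coordinates are arbitrary outside the domain
  of a chart: differentiability of \<open>coord c (\<gamma> s)\<close> at \<open>t\<close> alone
  does not keep nearby values of \<gamma> in that domain.\<close>

definition integral_curve :: "real set \<Rightarrow> (real \<Rightarrow> 'a) \<Rightarrow> bool" where
  "integral_curve I \<gamma> \<longleftrightarrow> continuous_on I \<gamma> \<and> \<gamma> ` I \<subseteq> M \<and>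
     (\<forall>t\<in>I. \<forall>c\<in>A. \<gamma> t \<in> chart_dom c \<longrightarrow>
        ((\<lambda>s. coord c (\<gamma> s)) has_vector_derivative - gradient g c f (\<gamma> t)) (at t))"

text \<open>A solution in one chart satisfies the equation in all others, because the Jacobian of
  the transition map carries one gradient to the other.\<close>

lemma integral_curve_chart:
  assumes c: "c \<in> A" and I: "open I" and z: "\<And>t. t \<in> I \<Longrightarrow> z t \<in> chart_image c"
    and der: "\<And>t. t \<in> I \<Longrightarrow> (z has_vector_derivative local_field c (z t)) (at t)"
  shows "integral_curve I (\<lambda>t. chart_inv c (z t))"
  unfolding integral_curve_def
proof (intro conjI ballI impI)
  have "continuous_on I z"
    using der by (meson continuous_at_imp_continuous_on has_vector_derivative_continuous)
  then show "continuous_on I (\<lambda>t. chart_inv c (z t))"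
    using z by (intro continuous_on_compose2[OF continuous_on_chart_inv[OF c]]) auto
  show "(\<lambda>t. chart_inv c (z t)) ` I \<subseteq> M" using z c chart_dom_subset[OF c] chart_inv_in_dom by blast
  fix t d assume t: "t \<in> I" and d: "d \<in> A" and x: "chart_inv c (z t) \<in> chart_dom d"
  define x where "x = chart_inv c (z t)"
  have xc: "x \<in> chart_dom c" "coord c x = z t" unfolding x_def using c z[OF t] by auto
  have "(transition c d has_derivative (*v) (jacobian (transition c d) (z t))) (at (z t))"
    using transition_has_derivative[OF c d xc(1)] x xc(2) x_def by simp
  from has_derivative_compose[OF der[OF t, unfolded has_vector_derivative_def] this]
  have "((\<lambda>s. transition c d (z s)) has_vector_derivative
      jacobian (transition c d) (z t) *v local_field c (z t)) (at t)"
    unfolding has_vector_derivative_def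
    by (rule has_derivative_eq_rhs) (simp add: fun_eq_iff matrix_vector_mult_scaleR)
  moreover have "jacobian (transition c d) (z t) *v local_field c (z t) = - gradient g d f x"
    using gradient_transform[OF c d xc(1)] x xc(2) linear_neg[OF matrix_vector_mul_linear]
    unfolding local_field_def x_def by metis
  ultimately show "((\<lambda>s. coord d (chart_inv c (z s))) has_vector_derivative
      - gradient g d f (chart_inv c (z t))) (at t)"
    unfolding transition_def x_def by simp
qed

lemma integral_curve_coord:
  assumes "c \<in> A" "integral_curve I \<gamma>" "t \<in> I" "\<gamma> t \<in> chart_dom c"
  shows "((\<lambda>s. coord c (\<gamma> s)) has_vector_derivative local_field c (coord c (\<gamma> t))) (at t)"
  using assms unfolding integral_curve_def local_field_def by simp

lemma integral_curve_shift:
  assumes "integral_curve I \<gamma>" "\<And>t. t \<in> J \<Longrightarrow> t + a \<in> I"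
  shows "integral_curve J (\<lambda>t. \<gamma> (t + a))"
  unfolding integral_curve_def
proof (intro conjI ballI impI)
  show "continuous_on J (\<lambda>t. \<gamma> (t + a))"
  proof (rule continuous_on_compose2[of I \<gamma>])
    show "continuous_on J (\<lambda>t. t + a)" by (intro continuous_intros)
  qed (use assms in \<open>auto simp: integral_curve_def\<close>)
  show "(\<lambda>t. \<gamma> (t + a)) ` J \<subseteq> M" using assms unfolding integral_curve_def by blast
  fix t c assume t: "t \<in> J" "c \<in> A" "\<gamma> (t + a) \<in> chart_dom c"
  have "((\<lambda>s. coord c (\<gamma> s)) has_vector_derivative - gradient g c f (\<gamma> (t + a))) (at (t + a))"
    using assms t unfolding integral_curve_def by blast
  moreover have "((\<lambda>s. s + a) has_real_derivative 1) (at t)" by (auto intro!: derivative_eq_intros)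
  ultimately show "((\<lambda>s. coord c (\<gamma> (s + a))) has_vector_derivative - gradient g c f (\<gamma> (t + a))) (at t)"
    using vector_diff_chain_at[of "\<lambda>s. s + a" 1 t] has_real_derivative_iff_has_vector_derivative
    by (auto simp: comp_def)
qed

lemma integral_curve_subset: "integral_curve I \<gamma> \<Longrightarrow> J \<subseteq> I \<Longrightarrow> integral_curve J \<gamma>"
  using integral_curve_shift[of I \<gamma> J 0] by auto

lemma integral_curve_cong:
  assumes "open I" "integral_curve I \<gamma>" "\<And>t. t \<in> I \<Longrightarrow> \<gamma> t = \<gamma>' t"
  shows "integral_curve I \<gamma>'"
  unfolding integral_curve_def
proof (intro conjI ballI impI)
  show "continuous_on I \<gamma>'" using assms continuous_on_cong unfolding integral_curve_def by metis
  show "\<gamma>' ` I \<subseteq> M" using assms unfolding integral_curve_def by force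
  fix t c assume t: "t \<in> I" "c \<in> A" "\<gamma>' t \<in> chart_dom c"
  then have "((\<lambda>s. coord c (\<gamma> s)) has_vector_derivative - gradient g c f (\<gamma>' t)) (at t)"
    using assms unfolding integral_curve_def by metis
  then show "((\<lambda>s. coord c (\<gamma>' s)) has_vector_derivative - gradient g c f (\<gamma>' t)) (at t)"
    by (rule has_vector_derivative_transform_within_open[OF _ assms(1) t(1)]) (use assms in simp)
qed

lemma integral_curve_local:
  assumes "\<And>t. t \<in> I \<Longrightarrow> \<exists>J. open J \<and> t \<in> J \<and> integral_curve J \<gamma>"
  shows "integral_curve I \<gamma>"
  unfolding integral_curve_def
proof (intro conjI ballI impI)
  show "continuous_on I \<gamma>"
  proof (rule continuous_at_imp_continuous_on, rule ballI)
    fix t assume "t \<in> I"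
    then obtain J where "open J" "t \<in> J" "integral_curve J \<gamma>" using assms by blast
    then show "isCont \<gamma> t" unfolding integral_curve_def using continuous_on_eq_continuous_at by blast
  qed
  show "\<gamma> ` I \<subseteq> M" using assms unfolding integral_curve_def by blast
  show "((\<lambda>s. coord c (\<gamma> s)) has_vector_derivative - gradient g c f (\<gamma> t)) (at t)"
    if "t \<in> I" "c \<in> A" "\<gamma> t \<in> chart_dom c" for t c
    using assms[OF that(1)] that unfolding integral_curve_def by blast
qed

lemma integral_curve_in_chart:
  assumes I: "open I" and \<gamma>: "integral_curve I \<gamma>" and t: "t \<in> I" and c: "c \<in> A" "\<gamma> t \<in> chart_dom c" and r: "r > 0"
  shows "\<forall>\<^sub>F s in nhds t. s \<in> I \<and> \<gamma> s \<in> chart_dom c \<and> coord c (\<gamma> s) \<in> ball (coord c (\<gamma> t)) r"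
proof -
  let ?V = "{x \<in> chart_dom c. coord c x \<in> ball (coord c (\<gamma> t)) r}"
  have "openin (top_of_set I) (I \<inter> \<gamma> -` ?V)"
    using \<gamma> openin_chart_preimage[OF c(1), of "ball (coord c (\<gamma> t)) r"]
    unfolding integral_curve_def by (intro continuous_openin_preimage[of I \<gamma> M]) auto
  then have "open (I \<inter> \<gamma> -` ?V)" using I openin_open_eq by blast
  moreover have "t \<in> I \<inter> \<gamma> -` ?V" using t c r by auto
  ultimately have "\<forall>\<^sub>F s in nhds t. s \<in> I \<inter> \<gamma> -` ?V" using eventually_nhds by blast
  then show ?thesis by eventually_elim auto
qed

text \<open>The set of times at which the curves agree is closed because the space is Hausdorff, and
  open by Gronwall's inequality in a chart.\<close>

lemma integral_curve_unique:
  assumes I: "open I" "connected I" and \<gamma>: "integral_curve I \<gamma>1" "integral_curve I \<gamma>2"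
    and t0: "t0 \<in> I" "\<gamma>1 t0 = \<gamma>2 t0" and t: "t \<in> I"
  shows "\<gamma>1 t = \<gamma>2 t"
proof -
  define T where "T = {t \<in> I. \<gamma>1 t = \<gamma>2 t}"
  have "continuous_on I (\<lambda>t. (\<gamma>1 t, \<gamma>2 t))"
    using \<gamma> unfolding integral_curve_def by (intro continuous_on_Pair) auto
  from continuous_closedin_preimage[OF this closed_diagonal]
  have closed: "closedin (top_of_set I) T"
    by (rule back_subst[of "closedin _"]) (auto simp: T_def)
  have "open T" unfolding open_contains_ball
  proof
    fix t1 assume "t1 \<in> T"
    then have t1: "t1 \<in> I" "\<gamma>2 t1 = \<gamma>1 t1" unfolding T_def by auto
    obtain c where c: "c \<in> A" "\<gamma>1 t1 \<in> chart_dom c"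
      using chart_at \<gamma>(1) t1 unfolding integral_curve_def by blast
    obtain L where L: "L > 0" "\<forall>\<^sub>F r in at_right 0. \<forall>x\<in>ball (coord c (\<gamma>1 t1)) r. \<forall>y\<in>ball (coord c (\<gamma>1 t1)) r.
        norm (local_field c x - local_field c y) \<le> L * norm (x - y)"
      using local_field_lipschitz[OF c(1) coord_in_chart_image[OF c(2)]] by blast
    obtain r where r: "r > 0" "\<forall>x\<in>ball (coord c (\<gamma>1 t1)) r. \<forall>y\<in>ball (coord c (\<gamma>1 t1)) r.
        norm (local_field c x - local_field c y) \<le> L * norm (x - y)"
      using eventually_at_right_0_ex[OF L(2)] by blast
    have "\<forall>\<^sub>F s in nhds t1. s \<in> I \<and> \<gamma>2 s \<in> chart_dom c \<and> coord c (\<gamma>2 s) \<in> ball (coord c (\<gamma>1 t1)) r"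
      using integral_curve_in_chart[OF I(1) \<gamma>(2) t1(1) c(1) _ r(1)] c(2) unfolding t1(2) .
    with integral_curve_in_chart[OF I(1) \<gamma>(1) t1(1) c r(1)]
    have "\<forall>\<^sub>F s in nhds t1. s \<in> I \<and> \<gamma>1 s \<in> chart_dom c \<and> \<gamma>2 s \<in> chart_dom c \<and>
        coord c (\<gamma>1 s) \<in> ball (coord c (\<gamma>1 t1)) r \<and> coord c (\<gamma>2 s) \<in> ball (coord c (\<gamma>1 t1)) r"
      by eventually_elim blast
    then obtain e where e: "e > 0" "\<And>s. dist s t1 < e \<Longrightarrow> s \<in> I \<and> \<gamma>1 s \<in> chart_dom c \<and> \<gamma>2 s \<in> chart_dom c \<and>
        coord c (\<gamma>1 s) \<in> ball (coord c (\<gamma>1 t1)) r \<and> coord c (\<gamma>2 s) \<in> ball (coord c (\<gamma>1 t1)) r"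
      unfolding eventually_nhds_metric by blast
    have "\<gamma>1 (s + t1) = \<gamma>2 (s + t1)" if s: "s \<in> {-e<..<e}" for s
    proof -
      define \<delta> where "\<delta> s = coord c (\<gamma>1 (s + t1)) - coord c (\<gamma>2 (s + t1))" for s
      have near: "s + t1 \<in> I" "\<gamma>1 (s + t1) \<in> chart_dom c" "\<gamma>2 (s + t1) \<in> chart_dom c"
         "coord c (\<gamma>1 (s + t1)) \<in> ball (coord c (\<gamma>1 t1)) r" "coord c (\<gamma>2 (s + t1)) \<in> ball (coord c (\<gamma>1 t1)) r"
        if "s \<in> {-e<..<e}" for s using e(2)[of "s + t1"] that by (auto simp: dist_real_def)
      have "norm (\<delta> s) \<le> exp (L * \<bar>s\<bar>) * norm (\<delta> 0)"
      proof (rule gronwall[OF _ _ s])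
        fix u assume u: "u \<in> {-e<..<e}"
        have sh: "integral_curve {-e<..<e} (\<lambda>t. \<gamma>1 (t + t1))" "integral_curve {-e<..<e} (\<lambda>t. \<gamma>2 (t + t1))"
          using integral_curve_shift \<gamma> near(1) by blast+
        show "(\<delta> has_vector_derivative local_field c (coord c (\<gamma>1 (u + t1))) - local_field c (coord c (\<gamma>2 (u + t1)))) (at u)"
          unfolding \<delta>_def
          by (intro has_vector_derivative_diff integral_curve_coord[OF c(1) sh(1) u] integral_curve_coord[OF c(1) sh(2) u] near[OF u])
        show "norm (local_field c (coord c (\<gamma>1 (u + t1))) - local_field c (coord c (\<gamma>2 (u + t1)))) \<le> L * norm (\<delta> u)"
          unfolding \<delta>_def using r(2) near(4,5)[OF u] by blast
      qed
      moreover have "\<delta> 0 = 0" unfolding \<delta>_def using t1 by simp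
      ultimately have "coord c (\<gamma>1 (s + t1)) = coord c (\<gamma>2 (s + t1))" unfolding \<delta>_def by simp
      then show ?thesis using near(2,3)[OF s] chart_inv_coord[OF c(1)] by metis
    qed
    moreover have "u - t1 \<in> {-e<..<e}" "u \<in> I" if "u \<in> ball t1 e" for u
      using that e(2)[of u] by (auto simp: dist_real_def)
    ultimately have "ball t1 e \<subseteq> T" unfolding T_def by fastforce
    then show "\<exists>e>0. ball t1 e \<subseteq> T" using e(1) by blast
  qed
  then have "openin (top_of_set I) T" using I(1) by (simp add: T_def openin_open_eq subset_iff)
  then have "T = {} \<or> T = I" using closed I(2) unfolding connected_clopen by blast
  then show ?thesis using t0 t unfolding T_def by blast
qed

end

subsection \<open>The gradient flow\<close>

lemma continuous_on_openin_cover: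
  fixes h :: "'a::t2_space \<Rightarrow> 'b::topological_space"
  assumes "\<And>x. x \<in> S \<Longrightarrow> \<exists>U. openin (top_of_set S) U \<and> x \<in> U \<and> continuous_on U h"
  shows "continuous_on S h"
  unfolding continuous_on_eq_continuous_within
proof
  fix x assume "x \<in> S"
  then obtain U where U: "openin (top_of_set S) U" "x \<in> U" "continuous_on U h" using assms by blast
  then obtain T where T: "open T" "U = S \<inter> T" using openin_open by blast
  have "continuous (at x within U) h" using U continuous_on_eq_continuous_within by blast
  moreover have "at x within U = at x within S" using T U(2) by (intro at_within_nhd[of x T]) auto
  ultimately show "continuous (at x within S) h" by simp
qed

context riemannian_morse
begin

text \<open>Picard's theorem in a chart gives all points near \<open>x\<close> a common life time,
  and Gronwall's inequality makes the maps at fixed times Lipschitz in coordinates.\<close>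

lemma local_flow:
  assumes x: "x \<in> M"
  shows "\<exists>U e \<psi>. openin (top_of_set M) U \<and> x \<in> U \<and> e > 0 \<and>
    (\<forall>y\<in>U. \<psi> 0 y = y \<and> integral_curve {-e<..<e} (\<lambda>t. \<psi> t y)) \<and>
    (\<forall>t\<in>{-e<..<e}. continuous_on U (\<psi> t))"
proof -
  obtain c where c: "c \<in> A" "x \<in> chart_dom c" using chart_at x by blast
  define p where "p = coord c x"
  have p: "p \<in> chart_image c" unfolding p_def using c by simp
  obtain L where L: "L > 0" "\<forall>\<^sub>F r in at_right 0. \<forall>x\<in>ball p r. \<forall>y\<in>ball p r.
      norm (local_field c x - local_field c y) \<le> L * norm (x - y)"
    using local_field_lipschitz[OF c(1) p] by blast
  obtain r where r: "r > 0" "ball p r \<subseteq> chart_image c" "\<forall>x\<in>ball p r. \<forall>y\<in>ball p r.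
      norm (local_field c x - local_field c y) \<le> L * norm (x - y)"
    using eventually_at_right_0_ex[OF eventually_conj[OF eventually_ball_subset[OF open_chart_image[OF c(1)] p] L(2)]]
    by blast
  define R where "R = r / 2"
  have R: "R > 0" "cball p R \<subseteq> ball p r" unfolding R_def using r(1) by auto
  define K where "K = norm (local_field c p) + L * R"
  have K: "K \<ge> 0" unfolding K_def using L(1) R(1) by simp
  have lip: "norm (local_field c x - local_field c y) \<le> L * norm (x - y)"
    if "x \<in> cball p R" "y \<in> cball p R" for x y using that R r(3) by blast
  have bd: "norm (local_field c y) \<le> K" if y: "y \<in> cball p R" for y
  proof -
    have "norm (local_field c y) \<le> norm (local_field c p) + norm (local_field c y - local_field c p)"
      by (metis add.commute norm_triangle_sub)
    also have "norm (local_field c y - local_field c p) \<le> L * norm (y - p)" using lip y R(1) by simp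
    also have "\<dots> \<le> L * R" using y L(1) by (intro mult_left_mono) (auto simp: dist_norm norm_minus_commute)
    finally show ?thesis unfolding K_def by simp
  qed
  \<comment> \<open>The first bound provides the contraction in \<open>picard\<close>. The second
    gives \<open>K * e \<le> R / 2\<close>, so solutions starting within \<open>R / 2\<close> of
    \<open>p\<close> stay in \<open>cball p R\<close>.\<close>
  define e where "e = min (1 / (4 * L)) (R / (2 * K + 2))"
  have e: "e > 0" "L * e \<le> 1 / 4" "K * e \<le> R / 2"
  proof -
    show "e > 0" unfolding e_def using L(1) R(1) K by simp
    have "L * e \<le> L * (1 / (4 * L))" unfolding e_def using L(1) by (intro mult_left_mono) auto
    then show "L * e \<le> 1 / 4" using L(1) by simp
    have "K * e \<le> (K + 1) * (R / (2 * K + 2))" unfolding e_def using K R(1) L(1) by (intro mult_mono) auto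
    also have "\<dots> = R / 2" using K by (simp add: field_simps)
    finally show "K * e \<le> R / 2" .
  qed
  have "\<exists>z. z 0 = y \<and> (\<forall>t\<in>{-e<..<e}. z t \<in> cball p R \<and> (z has_vector_derivative local_field c (z t)) (at t))"
    if "y \<in> ball p (R / 2)" for y
    by (rule picard[OF lip bd]) (use that e R less_imp_le[OF L(1)] in auto)
  then obtain Z where Z: "\<And>y. y \<in> ball p (R / 2) \<Longrightarrow> Z y 0 = y"
      "\<And>y t. y \<in> ball p (R / 2) \<Longrightarrow> t \<in> {-e<..<e} \<Longrightarrow> Z y t \<in> cball p R"
      "\<And>y t. y \<in> ball p (R / 2) \<Longrightarrow> t \<in> {-e<..<e} \<Longrightarrow> (Z y has_vector_derivative local_field c (Z y t)) (at t)"
    by metis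
  have Zim: "Z y t \<in> chart_image c" if "y \<in> ball p (R / 2)" "t \<in> {-e<..<e}" for y t
    using Z(2)[OF that] R r(2) by blast
  have Zcont: "continuous_on (ball p (R / 2)) (\<lambda>y. Z y t)" if t: "t \<in> {-e<..<e}" for t
  proof (rule lipschitz_on_continuous_on[of "exp (L * \<bar>t\<bar>)"], rule lipschitz_onI)
    fix y y' assume y: "y \<in> ball p (R / 2)" "y' \<in> ball p (R / 2)"
    have "norm (Z y t - Z y' t) \<le> exp (L * \<bar>t\<bar>) * norm (Z y 0 - Z y' 0)"
    proof (rule gronwall[OF _ _ t])
      fix u assume u: "u \<in> {-e<..<e}"
      show "((\<lambda>t. Z y t - Z y' t) has_vector_derivative
          local_field c (Z y u) - local_field c (Z y' u)) (at u)"
        by (rule has_vector_derivative_diff[OF Z(3)[OF y(1) u] Z(3)[OF y(2) u]])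
      show "norm (local_field c (Z y u) - local_field c (Z y' u)) \<le> L * norm (Z y u - Z y' u)"
        by (rule lip[OF Z(2)[OF y(1) u] Z(2)[OF y(2) u]])
    qed
    then show "dist (Z y t) (Z y' t) \<le> exp (L * \<bar>t\<bar>) * dist y y'" using Z(1) y by (simp add: dist_norm)
  qed simp
  define U where "U = {x \<in> chart_dom c. coord c x \<in> ball p (R / 2)}"
  define \<psi> where "\<psi> t x = chart_inv c (Z (coord c x) t)" for t x
  have "openin (top_of_set M) U" unfolding U_def by (rule openin_chart_preimage[OF c(1) open_ball])
  moreover have "x \<in> U" unfolding U_def using c R p_def by simp
  moreover have "\<psi> 0 y = y \<and> integral_curve {-e<..<e} (\<lambda>t. \<psi> t y)" if "y \<in> U" for y
  proof
    have y: "y \<in> chart_dom c" "coord c y \<in> ball p (R / 2)" using that unfolding U_def by auto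
    show "\<psi> 0 y = y" unfolding \<psi>_def Z(1)[OF y(2)] by (rule chart_inv_coord[OF c(1) y(1)])
    show "integral_curve {-e<..<e} (\<lambda>t. \<psi> t y)" unfolding \<psi>_def
      by (rule integral_curve_chart[OF c(1) open_greaterThanLessThan]) (use Zim Z(3) y in auto)
  qed
  moreover have "continuous_on U (\<psi> t)" if t: "t \<in> {-e<..<e}" for t
  proof -
    have "continuous_on U (coord c)"
      by (rule continuous_on_subset[OF continuous_on_coord[OF c(1)]]) (auto simp: U_def)
    then have "continuous_on U (\<lambda>x. Z (coord c x) t)"
      by (rule continuous_on_compose2[OF Zcont[OF t]]) (auto simp: U_def)
    then show ?thesis unfolding \<psi>_def
      by (rule continuous_on_compose2[OF continuous_on_chart_inv[OF c(1)]]) (use Zim t in \<open>auto simp: U_def\<close>)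
  qed
  ultimately show ?thesis using e(1) by blast
qed

text \<open>Finitely many local flows cover the compact \<open>M\<close>, and the least of their
  life times serves all points. By uniqueness they agree on overlaps, which makes the glued map
  continuous.\<close>

lemma uniform_local_flow:
  "\<exists>e>0. \<exists>\<psi>. (\<forall>y\<in>M. \<psi> 0 y = y \<and> integral_curve {-e<..<e} (\<lambda>t. \<psi> t y)) \<and>
    (\<forall>t\<in>{-e<..<e}. continuous_on M (\<psi> t))"
proof -
  define P where "P U e \<psi> \<longleftrightarrow> e > 0 \<and>
    (\<forall>y\<in>U. \<psi> 0 y = y \<and> integral_curve {-e<..<e} (\<lambda>t. \<psi> t y)) \<and>
    (\<forall>t\<in>{-e<..<e}. continuous_on U (\<psi> t))" for U e \<psi>
  define C where "C = {U. openin (top_of_set M) U \<and> (\<exists>e \<psi>. P U e \<psi>)}"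
  have "M \<subseteq> \<Union>C"
  proof
    fix x assume "x \<in> M"
    from local_flow[OF this] obtain U e \<psi> where U: "openin (top_of_set M) U" "x \<in> U"
        and "e > 0 \<and> (\<forall>y\<in>U. \<psi> 0 y = y \<and> integral_curve {-e<..<e} (\<lambda>t. \<psi> t y)) \<and>
          (\<forall>t\<in>{-e<..<e}. continuous_on U (\<psi> t))"
      by (elim exE conjE) (rule that; assumption?; simp)
    then have "P U e \<psi>" unfolding P_def by simp
    then show "x \<in> \<Union>C" using U unfolding C_def by blast
  qed
  moreover have "\<forall>U\<in>C. openin (top_of_set M) U" unfolding C_def by blast
  ultimately obtain D where D: "D \<subseteq> C" "finite D" "M \<subseteq> \<Union>D"
    using compact unfolding compact_eq_openin_cover by meson
  have "\<forall>U\<in>D. \<exists>e \<psi>. P U e \<psi>" using D(1) unfolding C_def by blast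
  then obtain E \<Psi> where E: "\<And>U. U \<in> D \<Longrightarrow> P U (E U) (\<Psi> U)" by metis
  \<comment> \<open>The 1 keeps the set nonempty, as the cover may be empty when \<open>M\<close>
    is.\<close>
  define e where "e = Min (insert 1 (E ` D))"
  have e: "e > 0" "\<And>U. U \<in> D \<Longrightarrow> e \<le> E U" unfolding e_def using D(2) E by (auto simp: P_def)
  have "\<forall>y\<in>M. \<exists>U\<in>D. y \<in> U" using D(3) by blast
  then obtain V where V: "\<And>y. y \<in> M \<Longrightarrow> V y \<in> D" "\<And>y. y \<in> M \<Longrightarrow> y \<in> V y" by metis
  define \<psi> where "\<psi> t y = \<Psi> (V y) t y" for t y
  have \<Psi>0: "\<Psi> U 0 y = y" if "U \<in> D" "y \<in> U" for U y using E that unfolding P_def by blast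
  have curve: "integral_curve {-e<..<e} (\<lambda>t. \<Psi> U t y)" if "U \<in> D" "y \<in> U" for U y
    by (rule integral_curve_subset[of "{- E U<..<E U}"]) (use E[OF that(1)] that e(2)[OF that(1)] P_def in auto)
  have eq: "\<psi> t y = \<Psi> U t y" if "y \<in> M" "U \<in> D" "y \<in> U" "t \<in> {-e<..<e}" for t y U
    unfolding \<psi>_def
    by (rule integral_curve_unique[OF open_greaterThanLessThan _ curve[OF V[OF that(1)]] curve[OF that(2,3)], of 0])
      (use that e V \<Psi>0 in auto)
  have cont: "continuous_on M (\<psi> t)" if t: "t \<in> {-e<..<e}" for t
  proof (rule continuous_on_openin_cover)
    fix x assume x: "x \<in> M"
    define U where "U = V x"
    have U: "U \<in> D" "x \<in> U" "openin (top_of_set M) U" unfolding U_def using V x D(1) C_def by auto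
    have "continuous_on U (\<Psi> U t)" using E[OF U(1)] t e(2)[OF U(1)] unfolding P_def by auto
    then have "continuous_on U (\<psi> t)"
      using eq[OF _ U(1) _ t] openin_imp_subset[OF U(3)]
      by (subst continuous_on_cong[OF refl, of _ _ "\<Psi> U t"]) auto
    then show "\<exists>U. openin (top_of_set M) U \<and> x \<in> U \<and> continuous_on U (\<psi> t)" using U by blast
  qed
  have "\<psi> 0 y = y \<and> integral_curve {-e<..<e} (\<lambda>t. \<psi> t y)" if "y \<in> M" for y
    unfolding \<psi>_def using \<Psi>0 curve V that by blast
  then show ?thesis using e(1) cont by blast
qed

lemma is_neg_gradient_flow_iff:
  "is_neg_gradient_flow M A g f \<phi> \<longleftrightarrow> (\<forall>x\<in>M. \<phi> 0 x = x \<and> integral_curve UNIV (\<lambda>t. \<phi> t x))"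
  unfolding is_neg_gradient_flow_def integral_curve_def by (simp add: image_subset_iff) blast

text \<open>Local solutions of a uniform life time \<open>2 e\<close> are concatenated at the times \<open>n e\<close>.\<close>

lemma ex_flow: "\<exists>\<phi>. is_neg_gradient_flow M A g f \<phi>"
proof -
  obtain E \<psi> where E: "E > 0" and \<psi>0: "\<And>y. y \<in> M \<Longrightarrow> \<psi> 0 y = y"
    and curve: "\<And>y. y \<in> M \<Longrightarrow> integral_curve {-E<..<E} (\<lambda>t. \<psi> t y)"
    using uniform_local_flow by metis
  define e where "e = E / 2"
  have e: "e > 0" "E = 2 * e" unfolding e_def using E by auto
  have \<psi>M: "\<psi> t y \<in> M" if "y \<in> M" "t \<in> {-E<..<E}" for t y
    using curve[OF that(1)] that(2) unfolding integral_curve_def by blast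
  \<comment> \<open>The interval consists of the times \<open>s\<close> at which both
    \<open>s\<close> and \<open>s + a\<close> lie within the life time \<open>2 * e\<close>.\<close>
  have comp: "\<psi> s (\<psi> a y) = \<psi> (s + a) y"
    if y: "y \<in> M" and a: "a \<in> {-e..e}" and s: "s \<in> {max (-2*e) (-2*e-a)<..<min (2*e) (2*e-a)}" for s a y
  proof (rule integral_curve_unique[of _ "\<lambda>s. \<psi> s (\<psi> a y)" "\<lambda>s. \<psi> (s + a) y" 0 s])
    show "integral_curve {max (-2*e) (-2*e-a)<..<min (2*e) (2*e-a)} (\<lambda>s. \<psi> s (\<psi> a y))"
      by (rule integral_curve_subset[OF curve]) (use y a e \<psi>M in auto)
    show "integral_curve {max (-2*e) (-2*e-a)<..<min (2*e) (2*e-a)} (\<lambda>s. \<psi> (s + a) y)"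
      by (rule integral_curve_shift[OF curve[OF y]]) (use e in auto)
    show "0 \<in> {max (-2*e) (-2*e-a)<..<min (2*e) (2*e-a)}" using a e by auto
    show "\<psi> 0 (\<psi> a y) = \<psi> (0 + a) y" using \<psi>0 \<psi>M y a e by auto
  qed (use s in auto)
  define P where "P = \<psi> e"
  define Q where "Q = \<psi> (- e)"
  have PQ: "P y \<in> M" "Q y \<in> M" "P (Q y) = y" if "y \<in> M" for y
    unfolding P_def Q_def using \<psi>M[OF that] comp[OF that, of "-e" e] \<psi>0[OF that] e by auto
  \<comment> \<open>The position at time \<open>n * e\<close>, for integers \<open>n\<close> of
    either sign; \<open>Q\<close> is a right inverse of \<open>P\<close> on
    \<open>M\<close>.\<close>
  define X where "X n y = (if n \<ge> 0 then (P ^^ nat n) y else (Q ^^ nat (- n)) y)" for n :: int and y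
  have PM: "(P ^^ k) y \<in> M" "(Q ^^ k) y \<in> M" if "y \<in> M" for k y
    using that PQ by (induction k) auto
  have XM: "X n y \<in> M" if "y \<in> M" for n y unfolding X_def using PM that by auto
  have XS: "X (n + 1) y = P (X n y)" if y: "y \<in> M" for n y
  proof (cases "n \<ge> 0")
    case True
    then have "nat (n + 1) = Suc (nat n)" by simp
    then show ?thesis using True unfolding X_def by simp
  next
    case False
    define k where "k = nat (- (n + 1))"
    have k: "nat (- n) = Suc k" unfolding k_def using False by simp
    have "P (X n y) = (Q ^^ k) y" unfolding X_def using False k PQ(3) PM(2) y by simp
    also have "\<dots> = X (n + 1) y"
      using False unfolding X_def k_def by (cases "n + 1 = 0") auto
    finally show ?thesis by simp
  qed
  define \<phi> where "\<phi> t y = \<psi> (t - of_int \<lfloor>t / e\<rfloor> * e) (X \<lfloor>t / e\<rfloor> y)" for t y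
  \<comment> \<open>The formula based at \<open>n * e\<close> also holds one step backwards. So
    every time has an open window governed by a single local solution, which gives differentiability
    across the seams.\<close>
  have \<phi>: "\<phi> t y = \<psi> (t - of_int n * e) (X n y)"
    if y: "y \<in> M" and t: "t \<in> {(of_int n - 1) * e<..<(of_int n + 1) * e}" for n t y
  proof (cases "t \<ge> of_int n * e")
    case True
    then have "\<lfloor>t / e\<rfloor> = n" using t e by (intro floor_unique) (auto simp: field_simps)
    then show ?thesis unfolding \<phi>_def by simp
  next
    case False
    then have fl: "\<lfloor>t / e\<rfloor> = n - 1" using t e by (intro floor_unique) (auto simp: field_simps)
    have "X n y = \<psi> e (X (n - 1) y)" using XS[OF y, of "n - 1"] unfolding P_def by simp
    then have "\<psi> (t - of_int n * e) (X n y) = \<psi> (t - of_int n * e + e) (X (n - 1) y)"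
      using comp[OF XM[OF y], of e "t - of_int n * e"] t e False by (auto simp: algebra_simps)
    then show ?thesis unfolding \<phi>_def fl by (simp add: algebra_simps)
  qed
  have "\<phi> 0 x = x \<and> integral_curve UNIV (\<lambda>t. \<phi> t x)" if x: "x \<in> M" for x
  proof
    show "\<phi> 0 x = x" using \<phi>[OF x, of 0 0] e \<psi>0 x by (simp add: X_def)
    show "integral_curve UNIV (\<lambda>t. \<phi> t x)"
    proof (rule integral_curve_local)
      fix t
      define n where "n = \<lfloor>t / e\<rfloor>"
      define J where "J = {(of_int n - 1) * e<..<(of_int n + 1) * e}"
      have "of_int n \<le> t / e" "t / e < of_int n + 1" unfolding n_def by linarith+
      then have "t \<in> J" unfolding J_def using e by (auto simp: field_simps)
      moreover have "integral_curve J (\<lambda>t. \<psi> (t + - (of_int n * e)) (X n x))"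
        by (rule integral_curve_shift[OF curve[OF XM[OF x]]]) (use e in \<open>auto simp: J_def algebra_simps\<close>)
      then have "integral_curve J (\<lambda>t. \<phi> t x)"
        by (rule integral_curve_cong[rotated]) (use \<phi>[OF x] J_def in auto)
      ultimately show "\<exists>J. open J \<and> t \<in> J \<and> integral_curve J (\<lambda>t. \<phi> t x)"
        unfolding J_def by (intro exI[of _ "{(of_int n - 1) * e<..<(of_int n + 1) * e}"]) simp
    qed
  qed
  then show ?thesis using is_neg_gradient_flow_iff by blast
qed

end

locale riemannian_morse_flow = riemannian_morse +
  fixes \<phi> :: "real \<Rightarrow> 'a \<Rightarrow> 'a"
  assumes flow: "is_neg_gradient_flow M A g f \<phi>"
begin

lemma flow_0 [simp]: "x \<in> M \<Longrightarrow> \<phi> 0 x = x"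
  using flow is_neg_gradient_flow_iff by blast

lemma flow_curve: "x \<in> M \<Longrightarrow> integral_curve UNIV (\<lambda>t. \<phi> t x)"
  using flow is_neg_gradient_flow_iff by blast

lemma flow_in [simp]: "x \<in> M \<Longrightarrow> \<phi> t x \<in> M"
  using flow_curve unfolding integral_curve_def by blast

lemma continuous_on_orbit: "x \<in> M \<Longrightarrow> continuous_on S (\<lambda>t. \<phi> t x)"
  by (rule continuous_on_subset[OF conjunct1[OF flow_curve[unfolded integral_curve_def]] subset_UNIV])

lemma flow_add:
  assumes "x \<in> M"
  shows "\<phi> s (\<phi> t x) = \<phi> (s + t) x"
  by (rule integral_curve_unique[of UNIV "\<lambda>s. \<phi> s (\<phi> t x)" "\<lambda>s. \<phi> (s + t) x" 0 s])
    (use assms in \<open>auto intro: flow_curve integral_curve_shift[OF flow_curve]\<close>)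

text \<open>For short times \<phi> is the continuous local flow; a general \<open>t\<close> is
  reached in \<open>n\<close> steps of length \<open>t / n\<close>.\<close>

lemma continuous_on_flow: "continuous_on M (\<phi> t)"
proof -
  obtain e \<psi> where e: "e > 0" and \<psi>0: "\<And>y. y \<in> M \<Longrightarrow> \<psi> 0 y = y"
    and curve: "\<And>y. y \<in> M \<Longrightarrow> integral_curve {-e<..<e} (\<lambda>t. \<psi> t y)"
    and cont: "\<And>t. t \<in> {-e<..<e} \<Longrightarrow> continuous_on M (\<psi> t)"
    using uniform_local_flow by metis
  have small: "continuous_on M (\<phi> t)" if t: "t \<in> {-e<..<e}" for t
  proof (subst continuous_on_cong[OF refl])
    show "continuous_on M (\<psi> t)" using cont t .
    fix y assume y: "y \<in> M"
    show "\<phi> t y = \<psi> t y"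
      by (rule integral_curve_unique[OF open_greaterThanLessThan _ integral_curve_subset[OF flow_curve[OF y] subset_UNIV]
            curve[OF y], of 0]) (use e t y \<psi>0 in auto)
  qed
  have iter: "continuous_on M (\<phi> (of_nat n * s))" if s: "s \<in> {-e<..<e}" for n s
  proof (induction n)
    case 0
    show ?case by (subst continuous_on_cong[OF refl, of _ _ id]) auto
  next
    case (Suc n)
    have "continuous_on M (\<lambda>y. \<phi> s (\<phi> (of_nat n * s) y))"
      by (rule continuous_on_compose2[OF small[OF s] Suc]) auto
    then show ?case
      by (subst continuous_on_cong[OF refl, of _ _ "\<lambda>y. \<phi> s (\<phi> (of_nat n * s) y)"])
        (auto simp: flow_add algebra_simps)
  qed
  obtain n :: nat where n: "n > \<bar>t\<bar> / e" using reals_Archimedean2 by blast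
  then have "real n > 0" using e by (smt (verit) divide_nonneg_pos)
  then have "\<bar>t / real n\<bar> < e" using n e by (simp add: field_simps)
  then have "t / real n \<in> {-e<..<e}" using abs_less_iff[of "t / real n" e] by simp
  from iter[OF this, of n] show ?thesis using \<open>real n > 0\<close> by simp
qed

end

subsection \<open>Critical points\<close>

lemma separate_point_finite:
  fixes p :: "'a::t2_space"
  assumes "finite S" "p \<notin> S"
  shows "\<exists>U V. open U \<and> open V \<and> p \<in> U \<and> S \<subseteq> V \<and> U \<inter> V = {}"
  using assms
proof (induction S)
  case empty
  show ?case by (intro exI[of _ UNIV] exI[of _ "{}"]) auto
next
  case (insert q S)
  then obtain U V where UV: "open U" "open V" "p \<in> U" "S \<subseteq> V" "U \<inter> V = {}" by auto
  obtain U' V' where UV': "open U'" "open V'" "p \<in> U'" "q \<in> V'" "U' \<inter> V' = {}"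
    using hausdorff[of p q] insert by auto
  show ?case
    by (intro exI[of _ "U \<inter> U'"] exI[of _ "V \<union> V'"]) (use UV UV' in auto)
qed

context riemannian_morse
begin

definition critical :: "'a \<Rightarrow> bool" where
  "critical x \<longleftrightarrow> (\<exists>c\<in>A. x \<in> chart_dom c \<and> differential c f x = 0)"

lemma critical_iff:
  assumes "c \<in> A" "x \<in> chart_dom c"
  shows "critical x \<longleftrightarrow> differential c f x = 0"
proof
  assume "critical x"
  then obtain d where "d \<in> A" "x \<in> chart_dom d" "differential d f x = 0" unfolding critical_def by blast
  then show "differential c f x = 0" using differential_transform[OF assms(1) _ assms(2)]
    by (metis matrix_vector_mult_0_right)
qed (use assms critical_def in blast)

lemma continuous_on_f: "continuous_on M f"
proof (rule continuous_on_openin_cover)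
  fix x assume "x \<in> M"
  then obtain c where c: "c \<in> A" "x \<in> chart_dom c" using chart_at by blast
  have "continuous_on (chart_image c) (f \<circ> chart_inv c)" using smooth_local[OF c(1), of 0] by simp
  then have "continuous_on (chart_dom c) (\<lambda>x. (f \<circ> chart_inv c) (coord c x))"
    by (rule continuous_on_compose2[OF _ continuous_on_coord[OF c(1)]]) auto
  then have "continuous_on (chart_dom c) f"
    by (rule continuous_on_eq) (use c(1) in simp)
  then show "\<exists>U. openin (top_of_set M) U \<and> x \<in> U \<and> continuous_on U f" using openin_chart_dom c by blast
qed

text \<open>At a critical point the Hessian is bounded below by \<open>m\<close>, and a
  linearisation error of \<open>m / 2\<close> leaves no room for a second zero of the gradient
  nearby. At other points the gradient stays nonzero by Lipschitz continuity.\<close>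

lemma isolated_critical:
  assumes "x \<in> M"
  shows "\<exists>U. openin (top_of_set M) U \<and> x \<in> U \<and> (\<forall>y\<in>U. critical y \<longrightarrow> y = x)"
proof -
  obtain c where c: "c \<in> A" "x \<in> chart_dom c" using chart_at assms by blast
  define p where "p = coord c x"
  have p: "p \<in> chart_image c" unfolding p_def using c by simp
  have "\<exists>r>0. \<forall>z\<in>ball p r. local_grad c z = 0 \<longrightarrow> z = p"
  proof (cases "local_grad c p = 0")
    case True
    obtain m where m: "m > 0" "\<And>v. m * norm v \<le> norm (local_hessian c p v)"
      using local_hessian_bounded_below[OF c(1) p True] by blast
    have "\<forall>\<^sub>F r in at_right 0. \<forall>x\<in>ball p r. \<forall>y\<in>ball p r.
        norm (local_grad c x - local_grad c y - local_hessian c p (x - y)) \<le> m / 2 * norm (x - y)"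
      using strong_derivative_local_grad[OF c(1) p] half_gt_zero[OF m(1)]
      unfolding has_strong_derivative_def by blast
    then obtain r where r: "r > 0" "\<forall>x\<in>ball p r. \<forall>y\<in>ball p r.
        norm (local_grad c x - local_grad c y - local_hessian c p (x - y)) \<le> m / 2 * norm (x - y)"
      using eventually_at_right_0_ex by blast
    have "z = p" if z: "z \<in> ball p r" "local_grad c z = 0" for z
    proof -
      have "norm (local_grad c z - local_grad c p - local_hessian c p (z - p)) \<le> m / 2 * norm (z - p)"
        using r z(1) by simp
      then have "m * norm (z - p) \<le> m / 2 * norm (z - p)"
        using m(2)[of "z - p"] z(2) True by simp
      then show ?thesis using m(1) by (simp add: mult_le_cancel_right)
    qed
    then show ?thesis using r(1) by blast
  next
    case False
    obtain L where L: "L > 0" "\<forall>\<^sub>F r in at_right 0. \<forall>x\<in>ball p r. \<forall>y\<in>ball p r.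
        norm (local_grad c x - local_grad c y) \<le> L * norm (x - y)"
      using has_strong_derivative_lipschitz[OF strong_derivative_local_grad[OF c(1) p]] by blast
    have "norm (local_grad c p) / L > 0" using False L(1) by simp
    from eventually_at_right_0_ex[OF eventually_conj[OF L(2) eventually_less_at_right_0[OF this]]]
    obtain r where r: "r > 0" "\<forall>x\<in>ball p r. \<forall>y\<in>ball p r.
        norm (local_grad c x - local_grad c y) \<le> L * norm (x - y)" "r < norm (local_grad c p) / L" by blast
    have "local_grad c z \<noteq> 0" if z: "z \<in> ball p r" for z
    proof
      assume "local_grad c z = 0"
      moreover have "norm (local_grad c p - local_grad c z) \<le> L * norm (p - z)" using r z by simp
      ultimately have "norm (local_grad c p) \<le> L * norm (p - z)" by simp
      moreover have "L * norm (p - z) < L * r" using z L(1) by (simp add: dist_norm)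
      moreover have "L * r < norm (local_grad c p)" using r(3) L(1) by (simp add: field_simps)
      ultimately show False by linarith
    qed
    then show ?thesis using r(1) by blast
  qed
  then obtain r where r: "r > 0" "\<And>z. z \<in> ball p r \<Longrightarrow> local_grad c z = 0 \<Longrightarrow> z = p" by blast
  show ?thesis
  proof (intro exI conjI ballI impI)
    show "openin (top_of_set M) {y \<in> chart_dom c. coord c y \<in> ball p r}"
      by (rule openin_chart_preimage[OF c(1) open_ball])
    show "x \<in> {y \<in> chart_dom c. coord c y \<in> ball p r}" using c r p_def by simp
    fix y assume y: "y \<in> {y \<in> chart_dom c. coord c y \<in> ball p r}" "critical y"
    then have "local_grad c (coord c y) = 0" using critical_iff[OF c(1)] differential_local by auto
    then have "coord c y = coord c x" using r(2) y(1) p_def by auto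
    then show "y = x" using y(1) c chart_inv_coord by (metis (no_types, lifting) mem_Collect_eq)
  qed
qed

lemma finite_critical: "finite {x \<in> M. critical x}"
proof -
  define C where "C = {U. openin (top_of_set M) U \<and> (\<exists>x. \<forall>y\<in>U. critical y \<longrightarrow> y = x)}"
  have "M \<subseteq> \<Union>C"
  proof
    fix x assume "x \<in> M"
    then obtain U where "openin (top_of_set M) U" "x \<in> U" "\<forall>y\<in>U. critical y \<longrightarrow> y = x"
      using isolated_critical by metis
    then show "x \<in> \<Union>C" unfolding C_def by blast
  qed
  moreover have "\<forall>U\<in>C. openin (top_of_set M) U" unfolding C_def by blast
  ultimately obtain D where D: "D \<subseteq> C" "finite D" "M \<subseteq> \<Union>D"
    using compact unfolding compact_eq_openin_cover by meson
  have "finite {y \<in> U. critical y}" if U: "U \<in> D" for U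
  proof -
    obtain x where "\<forall>y\<in>U. critical y \<longrightarrow> y = x" using U D(1) C_def by blast
    then have "{y \<in> U. critical y} \<subseteq> {x}" by blast
    then show ?thesis using finite_subset by blast
  qed
  then have "finite (\<Union>U\<in>D. {y \<in> U. critical y})" using D(2) by blast
  moreover have "{x \<in> M. critical x} \<subseteq> (\<Union>U\<in>D. {y \<in> U. critical y})" using D(3) by blast
  ultimately show ?thesis using finite_subset by blast
qed

text \<open>A semidefinite nondegenerate symmetric form is definite, and then \<open>f\<close> does
  not decrease along coordinate rays leaving \<open>x\<close>. Used in contrapositive form to obtain
  a negative direction.\<close>

lemma local_minimum_of_nonneg_hessian:
  assumes c: "c \<in> A" "x \<in> chart_dom c" and crit: "critical x"
    and psd: "\<And>v. v \<bullet> local_hessian c (coord c x) v \<ge> 0"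
  shows "local_minimum M f x"
proof -
  define p where "p = coord c x"
  have p: "p \<in> chart_image c" unfolding p_def using c by simp
  have F0: "local_grad c p = 0" using crit critical_iff[OF c] differential_local p_def by metis
  define H where "H = local_hessian c p"
  have Hsym: "H u \<bullet> v = H v \<bullet> u" for u v unfolding H_def by (rule local_hessian_symmetric[OF c(1) p])
  have Hbl: "bounded_linear H"
    unfolding H_def using strong_derivative_local_grad[OF c(1) p] has_strong_derivative_def by blast
  have Hpsd: "v \<bullet> H v \<ge> 0" for v using psd unfolding H_def p_def .
  obtain m0 where m0: "m0 > 0" "\<And>v. m0 * norm v \<le> norm (H v)"
    unfolding H_def using local_hessian_bounded_below[OF c(1) p F0] by blast
  have pd: "v \<bullet> H v > 0" if "v \<noteq> 0" for v
  proof (rule ccontr)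
    assume "\<not> v \<bullet> H v > 0"
    then have v0: "v \<bullet> H v = 0" using Hpsd[of v] by simp
    define w where "w = H v"
    have w: "w \<bullet> w > 0"
      using m0(1) m0(2)[of v] \<open>v \<noteq> 0\<close> unfolding w_def by (metis inner_gt_zero_iff mult_pos_pos norm_zero not_le zero_less_norm_iff)
    \<comment> \<open>If \<open>v \<bullet> H v = 0\<close>, the form at
      \<open>t *\<^sub>R v + w\<close> is affine in \<open>t\<close> with slope
      \<open>2 * (w \<bullet> w)\<close>; this \<open>t\<close> gives it the value -1.\<close>
    define t where "t = - (w \<bullet> H w + 1) / (2 * (w \<bullet> w))"
    have "(t *\<^sub>R v + w) \<bullet> H (t *\<^sub>R v + w) = t * t * (v \<bullet> H v) + 2 * t * (w \<bullet> w) + w \<bullet> H w"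
      using Hbl Hsym[of w v] unfolding w_def
      by (simp add: linear_simps inner_add_left inner_add_right inner_commute algebra_simps)
    also have "\<dots> = - 1" unfolding v0 t_def using w by (simp add: field_simps)
    finally show False using Hpsd[of "t *\<^sub>R v + w"] by simp
  qed
  have mat: "H = (*v) (matrix H)" using Hbl by (simp add: bounded_linear.linear matrix_vector_mul(2) fun_eq_iff)
  obtain m where m: "m > 0" "\<And>v. m * (norm v)\<^sup>2 \<le> v \<bullet> H v"
    using positive_definite_lower_bound[of "matrix H"] pd mat by metis
  \<comment> \<open>The tolerance is the coercivity constant \<open>m\<close> itself, so the error
    can at most cancel the quadratic term.\<close>
  have "\<forall>\<^sub>F r in at_right 0. \<forall>x\<in>ball p r. \<forall>y\<in>ball p r.
      norm (local_grad c x - local_grad c y - H (x - y)) \<le> m * norm (x - y)"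
    using strong_derivative_local_grad[OF c(1) p] m(1) unfolding has_strong_derivative_def H_def by blast
  from eventually_at_right_0_ex[OF eventually_conj[OF this eventually_ball_subset[OF open_chart_image[OF c(1)] p]]]
  obtain r where r: "r > 0" "\<forall>x\<in>ball p r. \<forall>y\<in>ball p r.
      norm (local_grad c x - local_grad c y - H (x - y)) \<le> m * norm (x - y)" "ball p r \<subseteq> chart_image c" by blast
  have ge: "(f \<circ> chart_inv c) p \<le> (f \<circ> chart_inv c) z" if z: "z \<in> ball p r" for z
  proof -
    define k where "k t = (f \<circ> chart_inv c) (p + t *\<^sub>R (z - p))" for t
    have "k 0 \<le> k 1"
    proof (rule DERIV_nonneg_imp_nondecreasing[of 0 1 k])
      fix t :: real assume t: "0 \<le> t" "t \<le> 1"
      define w where "w = p + t *\<^sub>R (z - p)"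
      have "norm (w - p) \<le> norm (z - p)" unfolding w_def using t by (simp add: mult_left_le_one_le)
      then have w: "w \<in> ball p r" using z by (simp add: dist_norm norm_minus_commute)
      have "((\<lambda>t. p + t *\<^sub>R (z - p)) has_derivative (\<lambda>s. s *\<^sub>R (z - p))) (at t)"
        by (auto intro!: derivative_eq_intros)
      moreover have "((f \<circ> chart_inv c) has_derivative (\<lambda>v. local_grad c w \<bullet> v)) (at w)"
        using has_derivative_local[OF c(1)] w r(3) by blast
      ultimately have "(k has_derivative (\<lambda>s. local_grad c w \<bullet> (s *\<^sub>R (z - p)))) (at t)"
        unfolding k_def w_def by (rule has_derivative_compose)
      then have "DERIV k t :> local_grad c w \<bullet> (z - p)"
        unfolding has_field_derivative_def by (rule has_derivative_eq_rhs) (simp add: fun_eq_iff)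
      moreover have "local_grad c w \<bullet> (z - p) \<ge> 0"
      proof -
        have "norm (local_grad c w - local_grad c p - H (w - p)) \<le> m * norm (w - p)"
          using r w by simp
        then have "norm (local_grad c w - t *\<^sub>R H (z - p)) \<le> m * (t * norm (z - p))"
          using F0 t Hbl unfolding w_def by (simp add: linear_simps)
        then have "norm (local_grad c w - t *\<^sub>R H (z - p)) * norm (z - p) \<le> m * (t * norm (z - p)) * norm (z - p)"
          by (rule mult_right_mono) simp
        then have "\<bar>(local_grad c w - t *\<^sub>R H (z - p)) \<bullet> (z - p)\<bar> \<le> t * (m * (norm (z - p))\<^sup>2)"
          using Cauchy_Schwarz_ineq2[of "local_grad c w - t *\<^sub>R H (z - p)" "z - p"]
          by (simp add: power2_eq_square mult_ac)
        also have "\<dots> \<le> t * ((z - p) \<bullet> H (z - p))" using m(2) t by (intro mult_left_mono) auto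
        finally have "- (t * ((z - p) \<bullet> H (z - p))) \<le> (local_grad c w - t *\<^sub>R H (z - p)) \<bullet> (z - p)"
          by linarith
        moreover have "(local_grad c w - t *\<^sub>R H (z - p)) \<bullet> (z - p)
            = local_grad c w \<bullet> (z - p) - t * ((z - p) \<bullet> H (z - p))"
          by (simp only: inner_diff_left[of "local_grad c w"] inner_scaleR_left inner_commute[of "H (z - p)" "z - p"])
        ultimately show ?thesis by linarith
      qed
      ultimately show "\<exists>y. DERIV k t :> y \<and> y \<ge> 0" by blast
    qed simp
    then show ?thesis unfolding k_def by simp
  qed
  have "f x \<le> f y" if "y \<in> chart_dom c" "coord c y \<in> ball p r" for y
    using ge[OF that(2)] that(1) c p_def by simp
  then show ?thesis unfolding local_minimum_def
    using openin_chart_preimage[OF c(1), of "ball p r"] c r(1) p_def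
    by (intro exI[of _ "{y \<in> chart_dom c. coord c y \<in> ball p r}"]) auto
qed

end

subsection \<open>Long time behaviour of the flow\<close>

context riemannian_morse_flow
begin

lemma differential_gradient_nonneg:
  assumes "c \<in> A" "x \<in> chart_dom c"
  shows "differential c f x \<bullet> gradient g c f x \<ge> 0"
    and "\<not> critical x \<Longrightarrow> differential c f x \<bullet> gradient g c f x > 0"
proof -
  have eq: "differential c f x \<bullet> gradient g c f x = gradient g c f x \<bullet> (g c x *v gradient g c f x)"
    unfolding metric_gradient[OF assms] by (rule inner_commute)
  show "differential c f x \<bullet> gradient g c f x \<ge> 0"
    unfolding eq using metric_pos[OF assms] by (cases "gradient g c f x = 0") (auto simp: less_imp_le)
  assume "\<not> critical x"
  then have "differential c f x \<noteq> 0" using critical_iff[OF assms] by blast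
  then have "gradient g c f x \<noteq> 0" using metric_gradient[OF assms] by (metis matrix_vector_mult_0_right)
  then show "differential c f x \<bullet> gradient g c f x > 0" unfolding eq by (rule metric_pos[OF assms])
qed

lemma f_along_orbit:
  assumes x: "x \<in> M" and c: "c \<in> A" "\<phi> t x \<in> chart_dom c"
  shows "((\<lambda>s. f (\<phi> s x)) has_real_derivative - (differential c f (\<phi> t x) \<bullet> gradient g c f (\<phi> t x))) (at t)"
proof -
  have "((\<lambda>s. coord c (\<phi> s x)) has_derivative (\<lambda>s. s *\<^sub>R - gradient g c f (\<phi> t x))) (at t)"
    using flow_curve[OF x] c unfolding integral_curve_def has_vector_derivative_def by blast
  moreover have "((f \<circ> chart_inv c) has_derivative (\<lambda>v. differential c f (\<phi> t x) \<bullet> v)) (at (coord c (\<phi> t x)))"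
    using has_derivative_local[OF c(1) coord_in_chart_image[OF c(2)]] by (simp add: differential_local)
  ultimately have "((\<lambda>s. (f \<circ> chart_inv c) (coord c (\<phi> s x))) has_derivative
      (\<lambda>s. differential c f (\<phi> t x) \<bullet> (s *\<^sub>R - gradient g c f (\<phi> t x)))) (at t)"
    by (rule has_derivative_compose)
  then have der: "((\<lambda>s. (f \<circ> chart_inv c) (coord c (\<phi> s x))) has_real_derivative
      - (differential c f (\<phi> t x) \<bullet> gradient g c f (\<phi> t x))) (at t)"
    unfolding has_field_derivative_def by (rule has_derivative_eq_rhs) (simp add: fun_eq_iff mult.commute)
  have ev: "\<forall>\<^sub>F s in nhds t. (f \<circ> chart_inv c) (coord c (\<phi> s x)) = f (\<phi> s x)"
    using integral_curve_in_chart[OF open_UNIV flow_curve[OF x] UNIV_I c zero_less_one]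
    by eventually_elim (use c(1) in simp)
  show ?thesis by (rule iffD1[OF DERIV_cong_ev[OF refl ev refl] der])
qed

lemma f_decreasing:
  assumes x: "x \<in> M" and "s \<le> t"
  shows "f (\<phi> t x) \<le> f (\<phi> s x)"
proof (rule DERIV_nonpos_imp_nonincreasing[of s t "\<lambda>s. f (\<phi> s x)", OF assms(2)])
  fix u
  obtain c where c: "c \<in> A" "\<phi> u x \<in> chart_dom c" using chart_at flow_in[OF x] by blast
  show "\<exists>y. ((\<lambda>s. f (\<phi> s x)) has_real_derivative y) (at u) \<and> y \<le> 0"
    using f_along_orbit[OF x c] differential_gradient_nonneg(1)[OF c] by (intro exI conjI) auto
qed

lemma f_strictly_decreasing:
  assumes x: "x \<in> M" and "\<not> critical x"
  shows "f (\<phi> 1 x) < f x"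
proof -
  obtain c where c: "c \<in> A" "x \<in> chart_dom c" using chart_at x by blast
  have "((\<lambda>s. f (\<phi> s x)) has_real_derivative - (differential c f x \<bullet> gradient g c f x)) (at 0)"
    using f_along_orbit[OF x c(1), of 0] x c(2) by simp
  moreover have "- (differential c f x \<bullet> gradient g c f x) < 0"
    using differential_gradient_nonneg(2)[OF c assms(2)] by simp
  ultimately obtain d where d: "d > 0" "\<And>h. 0 < h \<Longrightarrow> h < d \<Longrightarrow> f (\<phi> (0 + h) x) < f (\<phi> 0 x)"
    using DERIV_neg_dec_right[of "\<lambda>s. f (\<phi> s x)"] by blast
  \<comment> \<open>The derivative gives a strict drop only just after time 0; monotonicity carries
    it to time 1.\<close>
  define h where "h = min (d / 2) 1"
  have h: "0 < h" "h < d" "h \<le> 1" unfolding h_def using d(1) by auto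
  have "f (\<phi> 1 x) \<le> f (\<phi> h x)" by (rule f_decreasing[OF x h(3)])
  also have "\<dots> < f x" using d(2)[OF h(1,2)] x by simp
  finally show ?thesis .
qed

text \<open>LaSalle's argument: a non-critical cluster point \<open>y\<close> of the orbit has \<open>f (\<phi> 1 y) < f y\<close>, where
  \<open>f y\<close> is the infimum of \<open>f\<close> on the orbit.\<close>

lemma orbit_eventually_near_critical:
  assumes x: "x \<in> M" and N: "openin (top_of_set M) N" "\<And>p. p \<in> M \<Longrightarrow> critical p \<Longrightarrow> p \<in> N"
  shows "\<forall>\<^sub>F t in at_top. \<phi> t x \<in> N"
proof (rule ccontr)
  assume notev: "\<not> (\<forall>\<^sub>F t in at_top. \<phi> t x \<in> N)"
  \<comment> \<open>The values of the orbit at late times outside \<open>N\<close>. A cluster point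
    of this filter exists by compactness of \<open>M - N\<close>, without choosing a
    sequence.\<close>
  define F where "F = filtermap (\<lambda>t. \<phi> t x) (inf at_top (principal {t. \<phi> t x \<notin> N}))"
  have evF: "eventually P F \<longleftrightarrow> (\<forall>\<^sub>F t in at_top. \<phi> t x \<notin> N \<longrightarrow> P (\<phi> t x))" for P
    unfolding F_def eventually_filtermap eventually_inf_principal by simp
  have "\<not> eventually (\<lambda>_. False) F" unfolding evF using notev by simp
  then have "F \<noteq> bot" by auto
  moreover have "eventually (\<lambda>y. y \<in> M - N) F" unfolding evF using x by simp
  moreover have "compact (M - N)"
  proof -
    have "closedin (top_of_set M) (M - N)" using N(1) by (simp add: closedin_diff)
    then show ?thesis using compact closedin_compact by blast
  qed
  ultimately obtain y where y: "y \<in> M - N" "inf (nhds y) F \<noteq> bot"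
    unfolding compact_filter by blast
  have freq: "\<exists>t\<ge>T. \<phi> t x \<in> V" if V: "openin (top_of_set M) V" "y \<in> V" for V T
  proof (rule ccontr)
    assume no: "\<not> (\<exists>t\<ge>T. \<phi> t x \<in> V)"
    obtain W where W: "open W" "V = M \<inter> W" using V(1) openin_open by blast
    have "eventually (\<lambda>z. z \<in> W) (nhds y)" using W V(2) eventually_nhds by blast
    moreover have "eventually (\<lambda>z. z \<notin> W) F"
      unfolding evF using eventually_ge_at_top[of T] by eventually_elim (use no W x in auto)
    ultimately have "eventually (\<lambda>_. False) (inf (nhds y) F)" unfolding eventually_inf by blast
    then show False using y(2) by (simp add: eventually_False)
  qed
  have yM: "y \<in> M" using y by blast
  have openin_less: "openin (top_of_set M) {z \<in> M. h z < a}" "openin (top_of_set M) {z \<in> M. h z > a}"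
    if "continuous_on M h" for h :: "'a \<Rightarrow> real" and a
  proof -
    have "{z \<in> M. h z < a} = M \<inter> h -` {..<a}" "{z \<in> M. h z > a} = M \<inter> h -` {a<..}" by auto
    then show "openin (top_of_set M) {z \<in> M. h z < a}" "openin (top_of_set M) {z \<in> M. h z > a}"
      using continuous_openin_preimage_gen[OF that open_lessThan]
        continuous_openin_preimage_gen[OF that open_greaterThan] by simp_all
  qed
  \<comment> \<open>Otherwise a visit near \<open>y\<close> after time \<open>T\<close> would have a
    larger value of \<open>f\<close> than the orbit at time \<open>T\<close>.\<close>
  have "f y \<le> f (\<phi> T x)" for T
  proof (rule ccontr)
    assume "\<not> f y \<le> f (\<phi> T x)"
    then obtain t where "t \<ge> T" "\<phi> t x \<in> {z \<in> M. f z > f (\<phi> T x)}"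
      using freq[OF openin_less(2)[OF continuous_on_f, of "f (\<phi> T x)"]] yM by fastforce
    then show False using f_decreasing[OF x, of T t] by simp
  qed
  moreover have "f (\<phi> 1 y) < f y" using f_strictly_decreasing[OF yM] N(2)[OF yM] y(1) by blast
  moreover have "continuous_on M (\<lambda>z. f (\<phi> 1 z))"
    by (rule continuous_on_compose2[OF continuous_on_f continuous_on_flow]) auto
  ultimately obtain t where "f (\<phi> 1 (\<phi> t x)) < f y"
    using freq[OF openin_less(1)[of "\<lambda>z. f (\<phi> 1 z)" "f y"]] yM by blast
  moreover have "\<phi> 1 (\<phi> t x) = \<phi> (1 + t) x" by (rule flow_add[OF x])
  ultimately show False using \<open>\<And>T. f y \<le> f (\<phi> T x)\<close>[of "1 + t"] by simp
qed

text \<open>The tail of the orbit is connected and lies in the union of two disjoint open sets, one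
  around \<open>p\<close> and one around the other critical points. As it meets the first, it stays
  there.\<close>

lemma orbit_converges:
  assumes x: "x \<in> M"
  shows "\<exists>p\<in>M. critical p \<and> ((\<lambda>t. \<phi> t x) \<longlongrightarrow> p) at_top"
proof -
  define C where "C = {p \<in> M. critical p}"
  have finC: "finite C" unfolding C_def by (rule finite_critical)
  have near: "\<forall>\<^sub>F t in at_top. \<phi> t x \<in> W" if "open W" "C \<subseteq> W" for W
  proof -
    have "\<forall>\<^sub>F t in at_top. \<phi> t x \<in> M \<inter> W"
      by (rule orbit_eventually_near_critical[OF x openin_open_Int[OF that(1)]]) (use that(2) C_def in blast)
    then show ?thesis by eventually_elim blast
  qed
  \<comment> \<open>If each critical point had a neighbourhood that the orbit eventually avoids, the
    orbit would eventually avoid the union of these finitely many sets, contrary to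
    \<open>near\<close>.\<close>
  have "\<exists>p\<in>C. \<forall>V. open V \<longrightarrow> p \<in> V \<longrightarrow> (\<exists>\<^sub>F t in at_top. \<phi> t x \<in> V)"
  proof (rule ccontr)
    assume "\<not> ?thesis"
    then have "\<forall>p\<in>C. \<exists>V. open V \<and> p \<in> V \<and> \<not> (\<exists>\<^sub>F t in at_top. \<phi> t x \<in> V)"
      by blast
    from bchoice[OF this] obtain V where
      V: "\<forall>p\<in>C. open (V p) \<and> p \<in> V p \<and> \<not> (\<exists>\<^sub>F t in at_top. \<phi> t x \<in> V p)" ..
    have "\<forall>\<^sub>F t in at_top. \<forall>p\<in>C. \<phi> t x \<notin> V p"
      using V by (intro eventually_ball_finite[OF finC]) (simp add: not_frequently)
    moreover have "\<forall>\<^sub>F t in at_top. \<phi> t x \<in> (\<Union>p\<in>C. V p)" by (rule near) (use V in auto)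
    ultimately have "\<forall>\<^sub>F t::real in at_top. False" by eventually_elim blast
    then show False by simp
  qed
  then obtain p where p: "p \<in> C" "\<And>V. open V \<Longrightarrow> p \<in> V \<Longrightarrow> \<exists>\<^sub>F t in at_top. \<phi> t x \<in> V" by blast
  have "((\<lambda>t. \<phi> t x) \<longlongrightarrow> p) at_top"
  proof (rule topological_tendstoI)
    fix S assume S: "open S" "p \<in> S"
    obtain U W where UW: "open U" "open W" "p \<in> U" "C - {p} \<subseteq> W" "U \<inter> W = {}"
      using separate_point_finite[of "C - {p}" p] finC by auto
    have "\<forall>\<^sub>F t in at_top. \<phi> t x \<in> (S \<inter> U) \<union> W" by (rule near) (use S UW in auto)
    then obtain T where T: "\<And>t. t \<ge> T \<Longrightarrow> \<phi> t x \<in> (S \<inter> U) \<union> W" unfolding eventually_at_top_linorder by blast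
    obtain t0 where t0: "t0 \<ge> T" "\<phi> t0 x \<in> S \<inter> U"
    proof -
      have "\<exists>\<^sub>F t in at_top. \<phi> t x \<in> S \<inter> U" using p(2)[of "S \<inter> U"] S UW by auto
      then have "\<exists>\<^sub>F t in at_top. t \<ge> T \<and> \<phi> t x \<in> S \<inter> U"
        using eventually_ge_at_top[of T] by (simp add: frequently_eventually_conj conj_commute)
      then show ?thesis using that frequently_ex by blast
    qed
    have "connected ((\<lambda>t. \<phi> t x) ` {T..})"
      by (intro connected_continuous_image continuous_on_orbit[OF x] connected_Ici)
    then have "W \<inter> ((\<lambda>t. \<phi> t x) ` {T..}) = {}"
      using connectedD[of "(\<lambda>t. \<phi> t x) ` {T..}" "S \<inter> U" W] S UW T t0 by blast
    then have "\<phi> t x \<in> S" if "t \<ge> T" for t using T[OF that] that by blast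
    then show "\<forall>\<^sub>F t in at_top. \<phi> t x \<in> S" unfolding eventually_at_top_linorder by blast
  qed
  then show ?thesis using p(1) unfolding C_def by blast
qed

text \<open>Along two orbits staying near a critical point at which the Hessian \<open>H\<close> is negative in some
  direction, the form \<open>- H \<delta> \<bullet> \<delta>\<close> of their difference \<open>\<delta>\<close> grows at least linearly, once it is positive.\<close>

lemma escape_of_negative_direction:
  assumes c: "c \<in> A" "p \<in> chart_dom c" and crit: "critical p"
    and neg: "v \<bullet> local_hessian c (coord c p) v < 0"
  shows "\<exists>W. openin (top_of_set M) W \<and> p \<in> W \<and>
    (\<forall>V. openin (top_of_set M) V \<longrightarrow> V \<noteq> {} \<longrightarrow> (\<exists>y\<in>V. \<exists>t\<ge>0. \<phi> t y \<notin> W))"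
proof -
  define q where "q = coord c p"
  have q: "q \<in> chart_image c" unfolding q_def using c by simp
  have F0: "local_grad c q = 0" using crit critical_iff[OF c] differential_local q_def by metis
  define H where "H = local_hessian c q"
  have Hsym: "H u \<bullet> w = H w \<bullet> u" for u w unfolding H_def by (rule local_hessian_symmetric[OF c(1) q])
  have Hbl: "bounded_linear H"
    unfolding H_def using strong_derivative_local_grad[OF c(1) q] has_strong_derivative_def by blast
  obtain K where K: "K > 0" "\<And>u. norm (H u) \<le> norm u * K" using bounded_linear.pos_bounded[OF Hbl] by blast
  obtain d where d: "d > 0" "\<forall>\<^sub>F r in at_right 0. \<forall>x\<in>ball q r. \<forall>y\<in>ball q r.
      H (x - y) \<bullet> (local_field c x - local_field c y) \<le> - d * (norm (x - y))\<^sup>2"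
    unfolding H_def using local_field_dissipative[OF c(1) q F0] by blast
  obtain r where r: "r > 0" "\<forall>x\<in>ball q r. \<forall>y\<in>ball q r.
      H (x - y) \<bullet> (local_field c x - local_field c y) \<le> - d * (norm (x - y))\<^sup>2"
    using eventually_at_right_0_ex[OF d(2)] by blast
  define W where "W = {x \<in> chart_dom c. coord c x \<in> ball q r}"
  have W: "openin (top_of_set M) W" "p \<in> W"
    unfolding W_def using openin_chart_preimage[OF c(1) open_ball] c(2) r(1) q_def by auto
  have "\<exists>y\<in>V. \<exists>t\<ge>0. \<phi> t y \<notin> W" if V: "openin (top_of_set M) V" "V \<noteq> {}" for V
  proof (rule ccontr)
    assume "\<not> ?thesis"
    then have stay: "\<phi> t y \<in> W" if "y \<in> V" "t \<ge> 0" for t y using that by blast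
    have VM: "V \<subseteq> M" using V(1) by (rule openin_imp_subset)
    have VW: "V \<subseteq> W"
    proof
      fix y assume "y \<in> V"
      then show "y \<in> W" using stay[of y 0] VM by auto
    qed
    obtain y1 where y1: "y1 \<in> V" using V(2) by blast
    define z1 where "z1 = coord c y1"
    have "open (coord c ` V)" by (rule open_coord_image[OF c(1) V(1)]) (use VW W_def in auto)
    moreover have "z1 \<in> coord c ` V" unfolding z1_def using y1 by blast
    ultimately obtain \<epsilon> where \<epsilon>: "\<epsilon> > 0" "ball z1 \<epsilon> \<subseteq> coord c ` V" using open_contains_ball by blast
    define a where "a = norm v + 1"
    have a: "a > 0" unfolding a_def by (simp add: add_nonneg_pos)
    \<comment> \<open>The second starting point is the first one moved by
      \<open>s *\<^sub>R v\<close>, with \<open>s\<close> so small that it stays within the image of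
      \<open>V\<close>.\<close>
    define s where "s = \<epsilon> / (2 * a)"
    have s: "s > 0" unfolding s_def using \<epsilon>(1) a by simp
    have "norm (s *\<^sub>R v) < \<epsilon>"
    proof -
      have "norm v < 2 * a" unfolding a_def by (smt (verit) norm_ge_zero)
      then have "norm (s *\<^sub>R v) < s * (2 * a)" using s by simp
      also have "\<dots> = \<epsilon>" unfolding s_def using a by simp
      finally show ?thesis .
    qed
    then have "z1 + s *\<^sub>R v \<in> ball z1 \<epsilon>" by (simp add: dist_norm)
    then obtain y2 where y2: "y2 \<in> V" "coord c y2 = z1 + s *\<^sub>R v" using \<epsilon>(2) by (metis image_iff subsetD)
    define \<delta> where "\<delta> t = coord c (\<phi> t y2) - coord c (\<phi> t y1)" for t
    define D where "D t = local_field c (coord c (\<phi> t y2)) - local_field c (coord c (\<phi> t y1))" for t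
    have yM: "y1 \<in> M" "y2 \<in> M" using y1 y2 VM by auto
    have inW: "\<phi> t y1 \<in> chart_dom c" "\<phi> t y2 \<in> chart_dom c" "coord c (\<phi> t y1) \<in> ball q r" "coord c (\<phi> t y2) \<in> ball q r"
      if "t \<ge> 0" for t using stay y1 y2(1) that unfolding W_def by auto
    have d\<delta>: "(\<delta> has_vector_derivative D t) (at t)" if t: "t \<ge> 0" for t
      unfolding \<delta>_def D_def
      by (intro has_vector_derivative_diff integral_curve_coord[OF c(1) flow_curve] UNIV_I inW t yM)
    define Q where "Q t = - (H (\<delta> t) \<bullet> \<delta> t)" for t
    have dQ: "(Q has_real_derivative - 2 * (H (\<delta> t) \<bullet> D t)) (at t)" if t: "t \<ge> 0" for t
    proof -
      have 1: "(\<delta> has_derivative (\<lambda>s. s *\<^sub>R D t)) (at t)" using d\<delta>[OF t] unfolding has_vector_derivative_def .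
      from has_derivative_minus[OF has_derivative_inner[OF bounded_linear.has_derivative[OF Hbl 1] 1]]
      show ?thesis unfolding Q_def has_field_derivative_def
        by (rule has_derivative_eq_rhs) (use Hsym[of "D t" "\<delta> t"] Hbl in \<open>simp add: fun_eq_iff linear_simps algebra_simps\<close>)
    qed
    have Q'ge: "- 2 * (H (\<delta> t) \<bullet> D t) \<ge> 2 * d * (norm (\<delta> t))\<^sup>2" if t: "t \<ge> 0" for t
      using r(2) inW[OF t] unfolding \<delta>_def D_def by fastforce
    have Qle: "Q t \<le> K * (norm (\<delta> t))\<^sup>2" for t
    proof -
      have "Q t \<le> norm (H (\<delta> t)) * norm (\<delta> t)"
        unfolding Q_def using Cauchy_Schwarz_ineq2[of "H (\<delta> t)" "\<delta> t"] by linarith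
      also have "\<dots> \<le> (norm (\<delta> t) * K) * norm (\<delta> t)" by (intro mult_right_mono K) auto
      finally show ?thesis by (simp add: power2_eq_square mult_ac)
    qed
    have "\<delta> 0 = s *\<^sub>R v" unfolding \<delta>_def using y2 yM z1_def by simp
    then have "Q 0 = s * s * - (v \<bullet> H v)"
      unfolding Q_def using Hbl by (simp add: linear_simps inner_commute)
    then have Q0: "Q 0 > 0" using s neg unfolding H_def q_def by (simp add: mult_pos_pos mult_pos_neg)
    have Qmono: "Q 0 \<le> Q t" if "t \<ge> 0" for t
    proof (rule DERIV_nonneg_imp_nondecreasing[of 0 t Q, OF that])
      fix u :: real assume u: "0 \<le> u"
      have "0 \<le> 2 * d * (norm (\<delta> u))\<^sup>2" using d(1) by simp
      also have "\<dots> \<le> - 2 * (H (\<delta> u) \<bullet> D u)" by (rule Q'ge[OF u])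
      finally show "\<exists>y. DERIV Q u :> y \<and> y \<ge> 0" using dQ[OF u] by blast
    qed
    \<comment> \<open>Since \<open>Q\<close> is at least \<open>Q 0\<close> and at most
      \<open>K\<close> times the squared distance, that distance cannot shrink to 0;
      \<open>b\<close> is the resulting lower bound for the derivative of \<open>Q\<close>.\<close>
    define b where "b = 2 * d * (Q 0 / K)"
    have b: "b > 0" unfolding b_def using d K Q0 by simp
    have lin: "Q 0 - b * 0 \<le> Q t - b * t" if "t \<ge> 0" for t
    proof (rule DERIV_nonneg_imp_nondecreasing[of 0 t "\<lambda>t. Q t - b * t", OF that])
      fix u :: real assume u: "0 \<le> u"
      have "Q 0 / K \<le> (norm (\<delta> u))\<^sup>2" using Qmono[OF u] Qle[of u] K(1) by (simp add: field_simps)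
      then have "b \<le> 2 * d * (norm (\<delta> u))\<^sup>2" unfolding b_def using d(1) by (intro mult_left_mono) auto
      then have "b \<le> - 2 * (H (\<delta> u) \<bullet> D u)" using Q'ge[OF u] by linarith
      moreover have "((\<lambda>t. Q t - b * t) has_real_derivative - 2 * (H (\<delta> u) \<bullet> D u) - b) (at u)"
        using dQ[OF u] by (auto intro!: derivative_eq_intros)
      ultimately show "\<exists>y. DERIV (\<lambda>t. Q t - b * t) u :> y \<and> y \<ge> 0"
        by (intro exI[of _ "- 2 * (H (\<delta> u) \<bullet> D u) - b"]) simp
    qed
    \<comment> \<open>By this time the linear growth has used up \<open>K * (2 * r)\<^sup>2\<close>,
      the largest value that \<open>Q\<close> can take while both orbits are in the ball of radius
      \<open>r\<close>.\<close>
    define t where "t = K * (2 * r)\<^sup>2 / b"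
    have t: "t \<ge> 0" unfolding t_def using K b by simp
    have "norm (\<delta> t) \<le> norm (coord c (\<phi> t y2) - q) + norm (coord c (\<phi> t y1) - q)"
      unfolding \<delta>_def by (metis diff_diff_eq2 diff_add_cancel norm_triangle_ineq4 add_diff_cancel_right)
    also have "\<dots> \<le> r + r"
      using inW(3,4)[OF t] by (intro add_mono) (auto simp: dist_norm norm_minus_commute)
    finally have "norm (\<delta> t) \<le> 2 * r" by simp
    then have "Q t \<le> K * (2 * r)\<^sup>2"
      using K(1) by (intro order_trans[OF Qle] mult_left_mono power_mono) auto
    moreover have "b * t = K * (2 * r)\<^sup>2" unfolding t_def using b by simp
    ultimately show False using lin[OF t] Q0 by simp
  qed
  then show ?thesis using W by blast
qed

end

subsection \<open>Generic orbits\<close>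

lemma Hausdorff_space_top_of_set: "Hausdorff_space (top_of_set (S :: 'a::t2_space set))"
proof (rule Hausdorff_space_subtopology)
  show "Hausdorff_space (euclidean :: 'a topology)"
    unfolding Hausdorff_space_def disjnt_def using hausdorff by (metis open_openin)
qed

context riemannian_morse_flow
begin

text \<open>The exceptional sets \<open>T p n\<close> hold the points whose orbit is in a closed
  neighbourhood of a bad critical point from time \<open>n\<close> on. Convergence to such a point
  puts the starting point into one of them.\<close>

lemma generic_convergence:
  "\<exists>\<G>. countable \<G> \<and>
     (\<forall>T\<in>\<G>. closedin (top_of_set M) T \<and> (top_of_set M) interior_of T = {}) \<and>
     (\<forall>y\<in>M - \<Union>\<G>. \<exists>p. local_minimum M f p \<and> ((\<lambda>t. \<phi> t y) \<longlongrightarrow> p) at_top)"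
proof -
  define N where "N = {p \<in> M. critical p \<and> \<not> local_minimum M f p}"
  have "finite N" by (rule finite_subset[OF _ finite_critical]) (auto simp: N_def)
  \<comment> \<open>\<open>K\<close> is closed so that \<open>T p n\<close> is closed; the open
    \<open>B\<close> inside it catches the orbits converging to \<open>p\<close>.\<close>
  define trapping where "trapping p B K \<longleftrightarrow> openin (top_of_set M) B \<and> closedin (top_of_set M) K \<and>
      p \<in> B \<and> B \<subseteq> K \<and>
      (\<forall>V. openin (top_of_set M) V \<longrightarrow> V \<noteq> {} \<longrightarrow> (\<exists>y\<in>V. \<exists>t\<ge>0. \<phi> t y \<notin> K))" for p B K
  have trap: "\<exists>B K. trapping p B K" if p: "p \<in> N" for p
  proof -
    have p': "p \<in> M" "critical p" "\<not> local_minimum M f p" using p unfolding N_def by auto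
    obtain c where c: "c \<in> A" "p \<in> chart_dom c" using chart_at p' by blast
    obtain v where v: "v \<bullet> local_hessian c (coord c p) v < 0"
      using local_minimum_of_nonneg_hessian[OF c p'(2)] p'(3) not_le by blast
    obtain W where W: "openin (top_of_set M) W" "p \<in> W"
        "\<And>V. openin (top_of_set M) V \<Longrightarrow> V \<noteq> {} \<Longrightarrow> \<exists>y\<in>V. \<exists>t\<ge>0. \<phi> t y \<notin> W"
      using escape_of_negative_direction[OF c p'(2) v] by metis
    have "regular_space (top_of_set M)"
      by (rule compact_Hausdorff_imp_regular_space)
        (use compact Hausdorff_space_top_of_set in \<open>auto simp: compact_space_subtopology\<close>)
    then have "neighbourhood_base_of (closedin (top_of_set M)) (top_of_set M)"
      by (simp add: neighbourhood_base_of_closedin)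
    then obtain B K where "openin (top_of_set M) B" "closedin (top_of_set M) K" "p \<in> B" "B \<subseteq> K" and "K \<subseteq> W"
      using W(1,2) unfolding neighbourhood_base_of by metis
    moreover have "\<exists>y\<in>V. \<exists>t\<ge>0. \<phi> t y \<notin> K" if V: "openin (top_of_set M) V" "V \<noteq> {}" for V
      using W(3)[OF V] \<open>K \<subseteq> W\<close> by blast
    ultimately have "trapping p B K" unfolding trapping_def by simp
    then show ?thesis by blast
  qed
  then obtain B K where BK: "\<And>p. p \<in> N \<Longrightarrow> trapping p (B p) (K p)" by metis
  have OK: "openin (top_of_set M) (B p)" "closedin (top_of_set M) (K p)" "p \<in> B p" "B p \<subseteq> K p"
      "\<And>V. openin (top_of_set M) V \<Longrightarrow> V \<noteq> {} \<Longrightarrow> \<exists>y\<in>V. \<exists>t\<ge>0. \<phi> t y \<notin> K p" if "p \<in> N" for p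
    using BK[OF that] unfolding trapping_def by simp_all
  define T where "T p n = {y \<in> M. \<forall>t\<ge>real n. \<phi> t y \<in> K p}" for p and n :: nat
  define \<G> where "\<G> = (\<lambda>(p, n). T p n) ` (N \<times> UNIV)"
  have cnt: "countable \<G>"
    unfolding \<G>_def by (rule countable_image[OF countable_SIGMA[OF countable_finite[OF \<open>finite N\<close>]]]) simp
  have "closedin (top_of_set M) (T p n) \<and> (top_of_set M) interior_of (T p n) = {}" if p: "p \<in> N" for p n
  proof
    obtain C where C: "closed C" "K p = M \<inter> C" using OK(2)[OF p] unfolding closedin_closed by blast
    have "closedin (top_of_set M) (\<Inter>t\<in>{real n..}. M \<inter> \<phi> t -` C)"
      by (intro closedin_INT continuous_closedin_preimage continuous_on_flow C) auto
    also have "(\<Inter>t\<in>{real n..}. M \<inter> \<phi> t -` C) = T p n"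
    proof (intro equalityI subsetI)
      show "y \<in> (\<Inter>t\<in>{real n..}. M \<inter> \<phi> t -` C)" if "y \<in> T p n" for y
        using that unfolding T_def C(2) by auto
      show "y \<in> T p n" if "y \<in> (\<Inter>t\<in>{real n..}. M \<inter> \<phi> t -` C)" for y
        using that unfolding T_def C(2) by (auto simp: Ball_def)
    qed
    finally show "closedin (top_of_set M) (T p n)" .
    define V where "V = (top_of_set M) interior_of (T p n)"
    have V: "openin (top_of_set M) V" "V \<subseteq> T p n" unfolding V_def by (auto simp: interior_of_subset)
    show "(top_of_set M) interior_of (T p n) = {}"
    proof (rule ccontr)
      assume "\<not> ?thesis"
      then obtain x where x: "x \<in> V" unfolding V_def by blast
      have VM: "V \<subseteq> M" using V(2) T_def by auto
      \<comment> \<open>The image of \<open>V\<close> under the flow for time \<open>n\<close>,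
        written as a preimage to see that it is open. Its points would never leave
        \<open>K p\<close> at nonnegative times.\<close>
      define V' where "V' = M \<inter> \<phi> (- real n) -` V"
      have "openin (top_of_set M) V'" unfolding V'_def
        by (rule continuous_openin_preimage[OF continuous_on_flow _ V(1)]) auto
      moreover have "\<phi> (real n) x \<in> V'"
        unfolding V'_def using x VM by (auto simp: flow_add subset_iff)
      ultimately obtain y t where y: "y \<in> V'" "t \<ge> 0" "\<phi> t y \<notin> K p" using OK(5)[OF p] by blast
      have yM: "y \<in> M" and yV: "\<phi> (- real n) y \<in> V" using y(1) unfolding V'_def by auto
      then have "\<phi> (t + real n) (\<phi> (- real n) y) \<in> K p" using V(2) y(2) unfolding T_def by auto
      then show False using y(3) yM by (simp add: flow_add)
    qed
  qed
  then have nd: "\<forall>T\<in>\<G>. closedin (top_of_set M) T \<and> (top_of_set M) interior_of T = {}"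
    unfolding \<G>_def by auto
  have conv: "\<exists>p. local_minimum M f p \<and> ((\<lambda>t. \<phi> t y) \<longlongrightarrow> p) at_top" if y: "y \<in> M - \<Union>\<G>" for y
  proof -
    obtain p where p: "p \<in> M" "critical p" "((\<lambda>t. \<phi> t y) \<longlongrightarrow> p) at_top" using orbit_converges y by blast
    have "local_minimum M f p"
    proof (rule ccontr)
      assume "\<not> local_minimum M f p"
      then have pN: "p \<in> N" using p N_def by blast
      obtain U where U: "open U" "B p = M \<inter> U" using OK(1)[OF pN] openin_open by blast
      have "p \<in> U" using OK(3)[OF pN] U by blast
      then have "\<forall>\<^sub>F t in at_top. \<phi> t y \<in> U" using p(3) U(1) topological_tendstoD by blast
      then obtain t0 where t0: "\<And>t. t \<ge> t0 \<Longrightarrow> \<phi> t y \<in> U" unfolding eventually_at_top_linorder by blast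
      obtain n :: nat where "real n \<ge> t0" using real_arch_simple by blast
      then have "y \<in> T p n" unfolding T_def using t0 y U OK(4)[OF pN] by auto
      then show False using y pN unfolding \<G>_def by blast
    qed
    then show ?thesis using p(3) by blast
  qed
  show ?thesis by (intro exI[of _ \<G>] conjI ballI cnt nd[rule_format] conv)
qed

text \<open>On the forward orbit and at its limit \<open>f\<close> is at most \<open>f y\<close>,
  hence negative. The orbit with its limit added is connected, so it lies in one nodal
  domain.\<close>

lemma limit_in_negative_nodal_domain:
  assumes D: "D \<in> nodal_domains M f" and y: "y \<in> D" "f y < 0"
    and p: "p \<in> M" "((\<lambda>t. \<phi> t y) \<longlongrightarrow> p) at_top"
  shows "p \<in> D"
proof -
  have yM: "y \<in> M" using D y(1) in_components_subset unfolding nodal_domains_def by blast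
  have le: "f (\<phi> t y) \<le> f y" if "t \<ge> 0" for t using f_decreasing[OF yM that] yM by simp
  have "((\<lambda>t. f (\<phi> t y)) \<longlongrightarrow> f p) at_top"
    by (rule continuous_on_tendsto_compose[OF continuous_on_f p(2,1)]) (use yM in simp)
  moreover have "\<forall>\<^sub>F t in at_top. f (\<phi> t y) \<le> f y"
    using eventually_ge_at_top[of 0] by eventually_elim (rule le)
  ultimately have "f p \<le> f y" by (rule tendsto_upperbound) simp
  define S where "S = (\<lambda>t. \<phi> t y) ` {0..}"
  have pcl: "p \<in> closure S"
  proof (rule Lim_in_closed_set[OF closed_closure _ _ p(2)])
    show "\<forall>\<^sub>F t in at_top. \<phi> t y \<in> closure S"
      using eventually_ge_at_top[of 0] by eventually_elim (use closure_subset[of S] S_def in blast)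
  qed simp
  have "connected S"
    unfolding S_def by (rule connected_continuous_image[OF continuous_on_orbit[OF yM] connected_Ici])
  then have "connected (insert p S)"
    by (rule connected_intermediate_closure) (use closure_subset[of S] pcl in \<open>simp_all add: subset_insertI\<close>)
  moreover have "insert p S \<subseteq> M - f -` {0}"
  proof -
    have "f (\<phi> t y) \<noteq> 0" if "t \<ge> 0" for t using le[OF that] y(2) by simp
    moreover have "f p \<noteq> 0" using \<open>f p \<le> f y\<close> y(2) by simp
    ultimately show ?thesis using p(1) yM unfolding S_def by auto
  qed
  moreover have "y \<in> insert p S" unfolding S_def using yM by (auto intro: image_eqI[of _ _ 0])
  ultimately have "insert p S \<subseteq> D"
    using components_maximal[OF D[unfolded nodal_domains_def]] y(1) by blast
  then show ?thesis by blast
qed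

end

context riemannian_morse
begin

text \<open>Charts make \<open>M\<close> locally connected: each point of \<open>D\<close> has a
  coordinate ball that avoids the zero set, and that ball is connected.\<close>

lemma openin_nodal_domain:
  assumes D: "D \<in> nodal_domains M f"
  shows "openin (top_of_set M) D"
proof (subst openin_subopen, rule ballI)
  fix x assume x: "x \<in> D"
  have DN: "D \<subseteq> M - f -` {0}" using D in_components_subset unfolding nodal_domains_def by blast
  then obtain c where c: "c \<in> A" "x \<in> chart_dom c" using chart_at x by blast
  define V where "V = chart_dom c \<inter> (M - f -` {0})"
  have "openin (top_of_set M) (M \<inter> f -` (- {0}))"
    by (intro continuous_openin_preimage_gen continuous_on_f) auto
  moreover have "V = chart_dom c \<inter> (M \<inter> f -` (- {0}))" unfolding V_def by auto
  ultimately have "openin (top_of_set M) V" using openin_Int[OF openin_chart_dom[OF c(1)]] by simp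
  then have "open (coord c ` V)" by (rule open_coord_image[OF c(1)]) (auto simp: V_def)
  moreover have "coord c x \<in> coord c ` V" unfolding V_def using c x DN by blast
  ultimately obtain r where r: "r > 0" "ball (coord c x) r \<subseteq> coord c ` V" using open_contains_ball by blast
  define U where "U = {y \<in> chart_dom c. coord c y \<in> ball (coord c x) r}"
  have im: "ball (coord c x) r \<subseteq> chart_image c" using r(2) unfolding V_def chart_image_def by blast
  have UV: "U \<subseteq> V"
  proof
    fix y assume "y \<in> U"
    then obtain z where "z \<in> V" "y \<in> chart_dom c" "coord c y = coord c z" unfolding U_def using r(2) by auto
    then show "y \<in> V" using chart_inv_coord[OF c(1)] unfolding V_def by (metis IntD1)
  qed
  have "U = chart_inv c ` ball (coord c x) r"
    unfolding U_def using im c(1) by (auto intro!: image_eqI[of _ "chart_inv c" "coord c _"])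
  moreover have "continuous_on (ball (coord c x) r) (chart_inv c)"
    by (rule continuous_on_subset[OF continuous_on_chart_inv[OF c(1)] im])
  ultimately have "connected U" using connected_continuous_image connected_ball by metis
  moreover have xU: "x \<in> U" unfolding U_def using c r by simp
  ultimately have "U \<subseteq> D"
    using components_maximal[OF D[unfolded nodal_domains_def], of U] UV x unfolding V_def by blast
  moreover have "openin (top_of_set M) U" unfolding U_def by (rule openin_chart_preimage[OF c(1) open_ball])
  ultimately show "\<exists>T. openin (top_of_set M) T \<and> x \<in> T \<and> T \<subseteq> D" using xU by blast
qed

end

subsection \<open>Reversing the flow\<close>

lemma partial_deriv_cong:
  assumes "open S" "z \<in> S" "\<And>z. z \<in> S \<Longrightarrow> h z = k z" "h differentiable (at z)"
  shows "k differentiable (at z)" "partial_deriv i k z = partial_deriv i h z"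
proof -
  have "(h has_derivative frechet_derivative h (at z)) (at z)"
    using assms(4) frechet_derivative_works by blast
  then have k: "(k has_derivative frechet_derivative h (at z)) (at z)"
    by (rule has_derivative_transform_within_open[OF _ assms(1,2)]) (rule assms(3))
  then show "k differentiable (at z)" unfolding differentiable_def by blast
  show "partial_deriv i k z = partial_deriv i h z"
    unfolding partial_deriv_def using frechet_derivative_at[OF k] by simp
qed

text \<open>Partial derivatives commute with a sign change only where the function is
  differentiable, so the recursion in \<open>Ck_on\<close> has to be carried through equalities
  valid on \<open>S\<close> alone.\<close>

lemma Ck_on_cong:
  assumes "open S" "\<And>z. z \<in> S \<Longrightarrow> h z = k z" "Ck_on n S h"
  shows "Ck_on n S k"
  using assms(2,3)
proof (induction n arbitrary: h k)
  case 0
  then show ?case using continuous_on_cong[of S S h k] by simp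
next
  case (Suc n)
  have dif: "h differentiable (at z)" if "z \<in> S" for z using Suc.prems(2) that by simp
  have "Ck_on n S (partial_deriv i k)" for i
  proof (rule Suc.IH[of "partial_deriv i h"])
    show "partial_deriv i h z = partial_deriv i k z" if "z \<in> S" for z
      using partial_deriv_cong(2)[OF assms(1) that Suc.prems(1) dif[OF that]] by simp
    show "Ck_on n S (partial_deriv i h)" using Suc.prems(2) by simp
  qed
  moreover have "k differentiable (at z)" if "z \<in> S" for z
    by (rule partial_deriv_cong(1)[OF assms(1) that Suc.prems(1) dif[OF that]])
  ultimately show ?case by simp
qed

lemma partial_deriv_uminus:
  assumes "h differentiable (at z)"
  shows "partial_deriv i (\<lambda>z. - h z) z = - partial_deriv i h z"
proof -
  have "(h has_derivative frechet_derivative h (at z)) (at z)"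
    using assms frechet_derivative_works by blast
  from frechet_derivative_at[OF has_derivative_minus[OF this]] show ?thesis
    unfolding partial_deriv_def by (metis (no_types, lifting))
qed

lemma Ck_on_uminus:
  assumes "open S" "Ck_on n S h"
  shows "Ck_on n S (\<lambda>z. - h z)"
  using assms(2)
proof (induction n arbitrary: h)
  case 0
  then show ?case by (simp add: continuous_on_minus)
next
  case (Suc n)
  have dif: "h differentiable (at z)" if "z \<in> S" for z using Suc.prems that by simp
  have "Ck_on n S (partial_deriv i (\<lambda>z. - h z))" for i
  proof (rule Ck_on_cong[OF assms(1)])
    show "Ck_on n S (\<lambda>z. - partial_deriv i h z)" by (rule Suc.IH) (use Suc.prems in simp)
    show "- partial_deriv i h z = partial_deriv i (\<lambda>z. - h z) z" if "z \<in> S" for z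
      using partial_deriv_uminus[OF dif[OF that]] by simp
  qed
  then show ?case using dif differentiable_minus by simp
qed

context riemannian_morse
begin

lemma differential_uminus:
  assumes "c \<in> A" "x \<in> chart_dom c"
  shows "differential c (\<lambda>x. - f x) x = - differential c f x"
proof -
  have "(f \<circ> chart_inv c) differentiable (at (coord c x))"
    using smooth_local[OF assms(1), of "Suc 0"] assms(2) by simp
  from partial_deriv_uminus[OF this] show ?thesis
    unfolding differential_def comp_def by (simp add: vec_eq_iff)
qed

lemma hessian_uminus:
  assumes "c \<in> A" "x \<in> chart_dom c"
  shows "hessian c (\<lambda>x. - f x) x = - hessian c f x"
proof -
  have "partial_deriv i (partial_deriv j ((\<lambda>x. - f x) \<circ> chart_inv c)) (coord c x)
      = - partial_deriv i (partial_deriv j (f \<circ> chart_inv c)) (coord c x)" for i j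
  proof -
    have eq: "- partial_deriv j (f \<circ> chart_inv c) z = partial_deriv j ((\<lambda>x. - f x) \<circ> chart_inv c) z"
      if "z \<in> chart_image c" for z
      using partial_deriv_uminus[of "f \<circ> chart_inv c" z j] smooth_local[OF assms(1), of "Suc 0"] that
      by (simp add: comp_def)
    have dif: "partial_deriv j (f \<circ> chart_inv c) differentiable (at (coord c x))"
      using smooth_local[OF assms(1), of "Suc (Suc 0)"] assms(2) by simp
    then have "(\<lambda>z. - partial_deriv j (f \<circ> chart_inv c) z) differentiable (at (coord c x))"
      by (rule differentiable_minus)
    from partial_deriv_cong(2)[OF open_chart_image[OF assms(1)] coord_in_chart_image[OF assms(2)] eq this]
    have "partial_deriv i (partial_deriv j ((\<lambda>x. - f x) \<circ> chart_inv c)) (coord c x)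
      = partial_deriv i (\<lambda>z. - partial_deriv j (f \<circ> chart_inv c) z) (coord c x)" .
    then show ?thesis using partial_deriv_uminus[OF dif] by simp
  qed
  then show ?thesis unfolding hessian_def by (simp add: vec_eq_iff)
qed

lemma gradient_uminus:
  assumes "c \<in> A" "x \<in> chart_dom c"
  shows "gradient g c (\<lambda>x. - f x) x = - gradient g c f x"
  unfolding gradient_def differential_uminus[OF assms] by (rule linear_neg[OF matrix_vector_mul_linear])

lemma morse_uminus: "morse_function A (\<lambda>x. - f x)"
  unfolding morse_function_def
proof (intro conjI ballI impI)
  have "Ck_on k (chart_image c) ((\<lambda>x. - f x) \<circ> chart_inv c)" if "c \<in> A" for c k
    using Ck_on_uminus[OF open_chart_image[OF that] smooth_local[OF that]] unfolding comp_def .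
  then show "smooth_fun A (\<lambda>x. - f x)" unfolding smooth_fun_def smooth_on_def chart_image_def by blast
  fix c x assume c: "c \<in> A" "x \<in> chart_dom c" and d: "differential c (\<lambda>x. - f x) x = 0"
  have "det (hessian c f x) \<noteq> 0"
    using d morse c unfolding differential_uminus[OF c] morse_function_def by simp
  \<comment> \<open>Invertibility passes to the negated matrix through its kernel, which avoids the
    dimension-dependent sign of the determinant.\<close>
  then have "invertible (hessian c f x)" by (simp add: invertible_det_nz)
  then have "\<And>v. hessian c f x *v v = 0 \<Longrightarrow> v = 0"
    using invertible_left_inverse matrix_left_invertible_ker by metis
  moreover have "(- hessian c f x) *v v = - (hessian c f x *v v)" for v
    by (simp add: vec_eq_iff matrix_vector_mult_def sum_negf)
  ultimately have "\<And>v. (- hessian c f x) *v v = 0 \<Longrightarrow> v = 0" by simp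
  then have "invertible (- hessian c f x)"
    using invertible_left_inverse matrix_left_invertible_ker by metis
  then show "det (hessian c (\<lambda>x. - f x) x) \<noteq> 0"
    unfolding hessian_uminus[OF c] by (simp add: invertible_det_nz)
qed

lemma riemannian_morse_uminus: "riemannian_morse M A g (\<lambda>x. - f x)"
  by (unfold_locales) (rule manifold compact metric morse_uminus)+

end

text \<open>Makes the forward results available for backward limits: minima of \<open>- f\<close>
  are maxima of \<open>f\<close>, and domains where \<open>- f\<close> is negative are those where
  \<open>f\<close> is positive.\<close>

lemma (in riemannian_morse_flow) reversed_flow:
  "riemannian_morse_flow M A g (\<lambda>x. - f x) (\<lambda>t. \<phi> (- t))"
proof -
  interpret rev: riemannian_morse M A g "\<lambda>x. - f x" by (rule riemannian_morse_uminus)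
  have "is_neg_gradient_flow M A g (\<lambda>x. - f x) (\<lambda>t. \<phi> (- t))"
    unfolding is_neg_gradient_flow_def
  proof (intro ballI conjI allI impI)
    fix x assume x: "x \<in> M"
    show "\<phi> (- 0) x = x" "\<phi> (- t) x \<in> M" for t using x by simp_all
    show "continuous_on UNIV (\<lambda>t. \<phi> (- t) x)"
      by (rule continuous_on_compose2[OF continuous_on_orbit[OF x, of UNIV]]) (auto intro!: continuous_intros)
    fix t c assume c: "c \<in> A" "\<phi> (- t) x \<in> chart_dom c"
    have "((\<lambda>s. coord c (\<phi> s x)) has_vector_derivative - gradient g c f (\<phi> (- t) x)) (at (- t))"
      using flow_curve[OF x] c unfolding integral_curve_def by blast
    moreover have "(uminus has_real_derivative - 1) (at t)" by (auto intro!: derivative_eq_intros)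
    ultimately show "((\<lambda>s. coord c (\<phi> (- s) x)) has_vector_derivative
        - gradient g c (\<lambda>x. - f x) (\<phi> (- t) x)) (at t)"
      using vector_diff_chain_at[of uminus "- 1" t "\<lambda>s. coord c (\<phi> s x)" "- gradient g c f (\<phi> (- t) x)"]
        has_real_derivative_iff_has_vector_derivative gradient_uminus[OF c]
      by (simp add: comp_def)
  qed
  then show ?thesis by (simp add: riemannian_morse_flow_def riemannian_morse_flow_axioms_def rev.riemannian_morse_axioms)
qed

subsection \<open>Orbits connecting extrema\<close>

context riemannian_morse_flow
begin

text \<open>The exceptional sets for \<open>f\<close> and \<open>- f\<close> together form one
  countable family. The compact Hausdorff space \<open>M\<close> is a Baire space, so the nonempty
  open \<open>D\<close> has a point outside all of them.\<close>

lemma ex_connecting_orbit: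
  assumes D: "D \<in> nodal_domains M f"
  shows "\<exists>y p q. y \<in> D \<and> local_minimum M f p \<and> local_maximum M f q \<and>
    ((\<lambda>t. \<phi> t y) \<longlongrightarrow> p) at_top \<and> ((\<lambda>t. \<phi> t y) \<longlongrightarrow> q) at_bot \<and>
    (f y < 0 \<longrightarrow> p \<in> D) \<and> (f y > 0 \<longrightarrow> q \<in> D)"
proof -
  interpret rev: riemannian_morse_flow M A g "\<lambda>x. - f x" "\<lambda>t. \<phi> (- t)" by (rule reversed_flow)
  obtain \<G>1 where \<G>1: "countable \<G>1" "\<forall>T\<in>\<G>1. closedin (top_of_set M) T \<and> (top_of_set M) interior_of T = {}"
      and conv1: "\<forall>y\<in>M - \<Union>\<G>1. \<exists>p. local_minimum M f p \<and> ((\<lambda>t. \<phi> t y) \<longlongrightarrow> p) at_top"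
    using generic_convergence by (elim exE conjE) (rule that)
  obtain \<G>2 where \<G>2: "countable \<G>2" "\<forall>T\<in>\<G>2. closedin (top_of_set M) T \<and> (top_of_set M) interior_of T = {}"
      and conv2: "\<forall>y\<in>M - \<Union>\<G>2. \<exists>p. local_minimum M (\<lambda>x. - f x) p \<and> ((\<lambda>t. \<phi> (- t) y) \<longlongrightarrow> p) at_top"
    using rev.generic_convergence by (elim exE conjE) (rule that)
  have DM: "D \<subseteq> M" and D0: "D \<noteq> {}"
    using D in_components_subset in_components_nonempty unfolding nodal_domains_def by blast+
  have comp: "compact_space (top_of_set M)" using compact by (simp add: compact_space_subtopology)
  have "(top_of_set M) interior_of \<Union>(\<G>1 \<union> \<G>2) = {}"
  proof (rule Baire_category_alt)
    show "completely_metrizable_space (top_of_set M) \<or>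
        locally_compact_space (top_of_set M) \<and> regular_space (top_of_set M)"
      using compact_Hausdorff_imp_regular_space[OF comp Hausdorff_space_top_of_set]
        compact_imp_locally_compact_space[OF comp] by blast
    show "countable (\<G>1 \<union> \<G>2)" using \<G>1(1) \<G>2(1) by simp
    show "closedin (top_of_set M) T \<and> (top_of_set M) interior_of T = {}" if "T \<in> \<G>1 \<union> \<G>2" for T
      using that \<G>1(2) \<G>2(2) by blast
  qed
  then have "\<not> D \<subseteq> \<Union>(\<G>1 \<union> \<G>2)"
    using interior_of_maximal[OF _ openin_nodal_domain[OF D]] D0 by blast
  then obtain y where y: "y \<in> D" "y \<in> M - \<Union>\<G>1" "y \<in> M - \<Union>\<G>2" using DM by blast
  obtain p where p: "local_minimum M f p" "((\<lambda>t. \<phi> t y) \<longlongrightarrow> p) at_top" using conv1 y(2) by blast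
  obtain q where q: "local_minimum M (\<lambda>x. - f x) q" "((\<lambda>t. \<phi> (- t) y) \<longlongrightarrow> q) at_top" using conv2 y(3) by blast
  have qmax: "local_maximum M f q" using q(1) unfolding local_minimum_def local_maximum_def by simp
  have pM: "p \<in> M" using p(1) openin_imp_subset unfolding local_minimum_def by blast
  have qM: "q \<in> M" using q(1) openin_imp_subset unfolding local_minimum_def by blast
  have D': "D \<in> nodal_domains M (\<lambda>x. - f x)"
    using D unfolding nodal_domains_def by (simp add: vimage_def)
  have "p \<in> D" if "f y < 0" by (rule limit_in_negative_nodal_domain[OF D y(1) that pM p(2)])
  moreover have "q \<in> D" if "f y > 0"
    by (rule rev.limit_in_negative_nodal_domain[OF D' y(1) _ qM q(2)]) (use that in simp)
  moreover have "((\<lambda>t. \<phi> t y) \<longlongrightarrow> q) at_bot" using q(2) unfolding filterlim_at_bot_mirror .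
  ultimately show ?thesis using y(1) p qmax by blast
qed

end

section \<open>Counting nodal domains by Neumann domains and signs\<close>

theorem corollary1p6:
  fixes M :: "'a::t2_space set"
    and A :: "('a, 2) chart set"
    and g :: "('a, 2) metric"
    and f :: "'a \<Rightarrow> real"
  assumes "smooth_manifold M A"
    and "compact M"
    and "connected M"
    and "orientable M A"
    and "riemannian_metric A g"
    and "morse_eigenfunction A g f"
  shows "2 * ecard (neumann_domains M A g f) \<ge> ecard (nodal_domains M f)"
proof -
  interpret riemannian_morse M A g f
    using assms unfolding morse_eigenfunction_def by unfold_locales auto
  define \<phi> where "\<phi> = neg_gradient_flow M A g f"
  have "is_neg_gradient_flow M A g f \<phi>"
    unfolding \<phi>_def neg_gradient_flow_def by (rule someI_ex[OF ex_flow])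
  then interpret riemannian_morse_flow M A g f \<phi> by unfold_locales
  define orbit where "orbit D y p q \<longleftrightarrow> y \<in> D \<and> local_minimum M f p \<and> local_maximum M f q \<and>
    ((\<lambda>t. \<phi> t y) \<longlongrightarrow> p) at_top \<and> ((\<lambda>t. \<phi> t y) \<longlongrightarrow> q) at_bot \<and>
    (f y < 0 \<longrightarrow> p \<in> D) \<and> (f y > 0 \<longrightarrow> q \<in> D)" for D y p q
  have "\<forall>D\<in>nodal_domains M f. \<exists>y p q. orbit D y p q"
    unfolding orbit_def using ex_connecting_orbit by blast
  then obtain Y P Q where YPQ: "\<And>D. D \<in> nodal_domains M f \<Longrightarrow> orbit D (Y D) (P D) (Q D)" by metis
  define S where "S D = stable_set M A g f (P D) \<inter> unstable_set M A g f (Q D)" for D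
  have nonzero: "y \<in> M" "f y \<noteq> 0" if "D \<in> nodal_domains M f" "y \<in> D" for D y
    using that in_components_subset unfolding nodal_domains_def by blast+
  have lims: "((\<lambda>t. \<phi> t y) \<longlongrightarrow> P D) at_top" "((\<lambda>t. \<phi> t y) \<longlongrightarrow> Q D) at_bot" if "y \<in> S D" for y D
    using that unfolding S_def stable_set_def unstable_set_def \<phi>_def by auto
  have YS: "Y D \<in> S D" if "D \<in> nodal_domains M f" for D
    using YPQ[OF that] nonzero(1)[OF that] unfolding orbit_def S_def stable_set_def unstable_set_def \<phi>_def by blast
  \<comment> \<open>The Neumann domain of the chosen point together with the sign of
    \<open>f\<close> there; the two values of the sign account for the factor 2.\<close>
  define h where "h D = (connected_component_set (S D) (Y D), f (Y D) > 0)" for D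
  have "h ` nodal_domains M f \<subseteq> neumann_domains M A g f \<times> UNIV"
  proof
    fix z assume "z \<in> h ` nodal_domains M f"
    then obtain D where D: "D \<in> nodal_domains M f" "z = h D" by blast
    have "connected_component_set (S D) (Y D) \<in> components (S D)"
      using YS[OF D(1)] by (rule componentsI)
    then have "connected_component_set (S D) (Y D) \<in> neumann_domains M A g f"
      unfolding neumann_domains_def S_def using YPQ[OF D(1)] unfolding orbit_def by blast
    then show "z \<in> neumann_domains M A g f \<times> UNIV" unfolding D(2) h_def by simp
  qed
  moreover have "inj_on h (nodal_domains M f)"
  proof (rule inj_onI)
    fix D E assume D: "D \<in> nodal_domains M f" and E: "E \<in> nodal_domains M f" and eq: "h D = h E"
    \<comment> \<open>Equality of the two components puts \<open>Y E\<close> into \<open>S D\<close>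
      as well as \<open>S E\<close>. Uniqueness of its forward and backward limits then identifies
      the extrema chosen for \<open>D\<close> and \<open>E\<close>.\<close>
    have "Y E \<in> connected_component_set (S D) (Y D)"
      using eq YS[OF E] unfolding h_def by (simp add: connected_component_refl_eq)
    then have YE: "Y E \<in> S D" using connected_component_subset by blast
    have PE: "P D = P E" by (rule tendsto_unique[OF _ lims(1)[OF YE] lims(1)[OF YS[OF E]]]) simp
    have QE: "Q D = Q E" by (rule tendsto_unique[OF _ lims(2)[OF YE] lims(2)[OF YS[OF E]]]) simp
    have sign: "f (Y D) > 0 \<longleftrightarrow> f (Y E) > 0" using eq unfolding h_def by simp
    have "Y D \<in> D" "Y E \<in> E" using YPQ[OF D] YPQ[OF E] unfolding orbit_def by blast+
    then have nz: "f (Y D) \<noteq> 0" "f (Y E) \<noteq> 0" using nonzero(2) D E by blast+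
    have "D \<inter> E \<noteq> {}"
    proof (cases "f (Y D) > 0")
      case True
      then have "Q D \<in> D" "Q E \<in> E" using sign YPQ[OF D] YPQ[OF E] unfolding orbit_def by blast+
      then show ?thesis using QE by auto
    next
      case False
      then have "f (Y D) < 0" "f (Y E) < 0" using sign nz by linarith+
      then have "P D \<in> D" "P E \<in> E" using YPQ[OF D] YPQ[OF E] unfolding orbit_def by blast+
      then show ?thesis using PE by auto
    qed
    then show "D = E" using D E components_eq unfolding nodal_domains_def by blast
  qed
  ultimately have card: "finite (nodal_domains M f) \<and> card (nodal_domains M f) \<le> 2 * card (neumann_domains M A g f)"
    if fin: "finite (neumann_domains M A g f)"
  proof -
    have "finite (neumann_domains M A g f \<times> (UNIV :: bool set))" using fin by simp
    then show ?thesis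
      using inj_on_finite[OF \<open>inj_on h _\<close> \<open>_ \<subseteq> _\<close>] card_inj_on_le[OF \<open>inj_on h _\<close> \<open>_ \<subseteq> _\<close>]
      by (simp add: card_cartesian_product mult.commute)
  qed
  show ?thesis
  proof (cases "finite (neumann_domains M A g f)")
    case True
    then show ?thesis using card[OF True] unfolding ecard_def
      by (simp add: numeral_eq_enat)
  next
    case False
    moreover have "(2 :: enat) * \<infinity> = \<infinity>" by (simp add: imult_is_infinity)
    ultimately show ?thesis unfolding ecard_def by simp
  qed
qed

end
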